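(* Let $n\ge 2$ and suppose $\Omega\subset\mathbb{R}^n$ is a bounded strong $BV$-extension domain for which the strong extension operator $T\colon BV(\Omega)\to BV(\mathbb{R}^n)$ is linear. Then there exists a linear $W^{1,1}$-extension operator from $W^{1,1}(\Omega)$ to $W^{1,1}(\mathbb{R}^n)$.
   Context: A domain is a connected open set. For an open set $U\subset\mathbb{R}^n$, $W^{1,1}(U)=\{u\in L^1(U): \nabla u\in L^1(U;\mathbb{R}^n)\}$ with norm $\|u\|_{W^{1,1}(U)}=\|u\|_{L^1(U)}+\|\nabla u\|_{L^1(U)}$; $\|Du\|(U)=\sup\{\int_U u\,\mathrm{div}(v)\,dx : v\in C_0^\infty(U;\mathbb{R}^n),\ |v|\le 1\}$; $BV(U)=\{u\in L^1(U): \|Du\|(U)<\infty\}$ with norm $\|u\|_{BV(U)}=\|u\|_{L^1(U)}+\|Du\|(U)$. For any set $F\subset U$, $\|Du\|(F)=\inf\{\|Du\|(V): F\subset V\subset U,\ V\text{ open}\}$. A domain $\Omega$ is a strong $BV$-extension domain if there is a constant $C>0$ such that for every $u\in BV(\Omega)$ there exists $Tu\in BV(\mathbb{R}^n)$ with $Tu|_\Omega=u$, $\|Tu\|_{BV(\mathbb{R}^n)}\le C\|u\|_{BV(\Omega)}$ and $\|D(Tu)\|(\partial\Omega)=0$. The map $u\mapsto Tu$ is the (strong) extension operator. A $W^{1,1}$-extension operator is a map $R\colon W^{1,1}(\Omega)\to W^{1,1}(\mathbb{R}^n)$ with $Ru|_\Omega=u$ and $\|Ru\|_{W^{1,1}(\mathbb{R}^n)}\le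 C\|u\|_{W^{1,1}(\Omega)}$ for all $u\in W^{1,1}(\Omega)$ and some constant $C>0$. *)

theory Defs
  imports "HOL-Analysis.Analysis"
begin

definition is_domain :: "'a::euclidean_space set \<Rightarrow> bool" where
  "is_domain \<Omega> \<longleftrightarrow> open \<Omega> \<and> connected \<Omega>"

text \<open>For \<open>f\<close> differentiable at \<open>x\<close>, the vector \<open>frechet_derivative f (at x) b\<close> is the directional
  derivative of \<open>f\<close> at \<open>x\<close> along \<open>b\<close>; for \<open>b\<close> in \<open>Basis\<close> it is a partial derivative.\<close>

primrec C_k :: "nat \<Rightarrow> ('a::euclidean_space \<Rightarrow> 'b::real_normed_vector) \<Rightarrow> bool" where
  "C_k 0 f \<longleftrightarrow> continuous_on UNIV f"
| "C_k (Suc k) f \<longleftrightarrow>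
     (\<forall>x. f differentiable (at x)) \<and> (\<forall>b\<in>Basis. C_k k (\<lambda>x. frechet_derivative f (at x) b))"

text \<open>An element of the space \<open>C\<^sub>0\<^sup>\<infinity>\<close> of an open set \<open>U\<close> is identified with its extension by zero
  to the whole space.\<close>

definition test_functions :: "'a::euclidean_space set \<Rightarrow> ('a \<Rightarrow> 'b::real_normed_vector) set" where
  "test_functions U =
     {v. (\<forall>k. C_k k v) \<and> compact (closure {x. v x \<noteq> 0}) \<and> closure {x. v x \<noteq> 0} \<subseteq> U}"

definition divergence :: "('a::euclidean_space \<Rightarrow> 'a) \<Rightarrow> 'a \<Rightarrow> real" where
  "divergence v x = (\<Sum>b\<in>Basis. frechet_derivative v (at x) b \<bullet> b)"

text \<open>Functions on \<open>U\<close> are represented by functions on the whole space whose values outside \<open>U\<close>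
  are irrelevant. Elements of the Lebesgue, Sobolev and BV spaces are represented by
  functions rather than by classes modulo equality almost everywhere.\<close>

definition L1 :: "'a::euclidean_space set \<Rightarrow> ('a \<Rightarrow> 'b::euclidean_space) set" where
  "L1 U = {u. set_integrable lebesgue U u}"

definition L1_loc :: "'a::euclidean_space set \<Rightarrow> ('a \<Rightarrow> 'b::euclidean_space) set" where
  "L1_loc U = {u. \<forall>K. compact K \<and> K \<subseteq> U \<longrightarrow> set_integrable lebesgue K u}"

definition L1_norm :: "'a::euclidean_space set \<Rightarrow> ('a \<Rightarrow> 'b::euclidean_space) \<Rightarrow> real" where
  "L1_norm U u = (LINT x:U|lebesgue. norm (u x))"

definition ae_eq_on :: "'a::euclidean_space set \<Rightarrow> ('a \<Rightarrow> 'b) \<Rightarrow> ('a \<Rightarrow> 'b) \<Rightarrow> bool" where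
  "ae_eq_on U u v \<longleftrightarrow> (AE x in lebesgue. x \<in> U \<longrightarrow> u x = v x)"

definition has_weak_gradient ::
    "'a::euclidean_space set \<Rightarrow> ('a \<Rightarrow> real) \<Rightarrow> ('a \<Rightarrow> 'a) \<Rightarrow> bool" where
  "has_weak_gradient U u g \<longleftrightarrow> u \<in> L1_loc U \<and> g \<in> L1_loc U \<and>
     (\<forall>\<phi>\<in>test_functions U. \<forall>b\<in>Basis.
        (LINT x:U|lebesgue. u x * frechet_derivative \<phi> (at x) b)
          = - (LINT x:U|lebesgue. (g x \<bullet> b) * \<phi> x))"

text \<open>On an open set a weak gradient is unique up to equality almost everywhere, so the choice
  made here does not affect integrability or integrals.\<close>

definition weak_gradient :: "'a::euclidean_space set \<Rightarrow> ('a \<Rightarrow> real) \<Rightarrow> 'a \<Rightarrow> 'a" where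
  "weak_gradient U u = (SOME g. has_weak_gradient U u g)"

definition W11 :: "'a::euclidean_space set \<Rightarrow> ('a \<Rightarrow> real) set" where
  "W11 U = {u. u \<in> L1 U \<and> (\<exists>g. has_weak_gradient U u g \<and> g \<in> L1 U)}"

definition W11_norm :: "'a::euclidean_space set \<Rightarrow> ('a \<Rightarrow> real) \<Rightarrow> real" where
  "W11_norm U u = L1_norm U u + L1_norm U (weak_gradient U u)"

text \<open>\<open>variation u U\<close> is the total variation of \<open>u\<close> on an open set \<open>U\<close>; \<open>variation_in U u F\<close>
  is its extension to arbitrary subsets \<open>F\<close> of \<open>U\<close>.\<close>

definition variation :: "('a::euclidean_space \<Rightarrow> real) \<Rightarrow> 'a set \<Rightarrow> ereal" where
  "variation u U =
     (SUP v\<in>{v\<in>test_functions U. \<forall>x. norm (v x) \<le> 1}.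
        ereal (LINT x:U|lebesgue. u x * divergence v x))"

definition variation_in ::
    "'a::euclidean_space set \<Rightarrow> ('a \<Rightarrow> real) \<Rightarrow> 'a set \<Rightarrow> ereal" where
  "variation_in U u F = (INF V\<in>{V. open V \<and> F \<subseteq> V \<and> V \<subseteq> U}. variation u V)"

definition BV :: "'a::euclidean_space set \<Rightarrow> ('a \<Rightarrow> real) set" where
  "BV U = {u. u \<in> L1 U \<and> variation u U < \<infinity>}"

definition BV_norm :: "'a::euclidean_space set \<Rightarrow> ('a \<Rightarrow> real) \<Rightarrow> ereal" where
  "BV_norm U u = ereal (L1_norm U u) + variation u U"

definition strong_BV_extension_domain :: "'a::euclidean_space set \<Rightarrow> bool" where
  "strong_BV_extension_domain \<Omega> \<longleftrightarrow> is_domain \<Omega> \<and>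
     (\<exists>C>0. \<forall>u\<in>BV \<Omega>. \<exists>w\<in>BV UNIV. ae_eq_on \<Omega> w u \<and>
        BV_norm UNIV w \<le> ereal C * BV_norm \<Omega> u \<and> variation_in UNIV w (frontier \<Omega>) = 0)"

text \<open>The following two predicates say that a map on representatives descends to a map, and to a
  linear map, from classes of functions on \<open>\<Omega>\<close> to classes of functions on the whole space.\<close>

definition respects_ae ::
    "'a::euclidean_space set \<Rightarrow> ('a \<Rightarrow> real) set \<Rightarrow> (('a \<Rightarrow> real) \<Rightarrow> 'a \<Rightarrow> real) \<Rightarrow> bool" where
  "respects_ae \<Omega> X T \<longleftrightarrow>
     (\<forall>u\<in>X. \<forall>v\<in>X. ae_eq_on \<Omega> u v \<longrightarrow> ae_eq_on UNIV (T u) (T v))"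

definition linear_ae ::
    "('a::euclidean_space \<Rightarrow> real) set \<Rightarrow> (('a \<Rightarrow> real) \<Rightarrow> 'a \<Rightarrow> real) \<Rightarrow> bool" where
  "linear_ae X T \<longleftrightarrow>
     (\<forall>u\<in>X. \<forall>v\<in>X. \<forall>a b.
        ae_eq_on UNIV (T (\<lambda>x. a * u x + b * v x)) (\<lambda>x. a * T u x + b * T v x))"

definition strong_BV_extension_operator ::
    "'a::euclidean_space set \<Rightarrow> (('a \<Rightarrow> real) \<Rightarrow> 'a \<Rightarrow> real) \<Rightarrow> bool" where
  "strong_BV_extension_operator \<Omega> T \<longleftrightarrow>
     T \<in> BV \<Omega> \<rightarrow> BV UNIV \<and> respects_ae \<Omega> (BV \<Omega>) T \<and>
     (\<exists>C>0. \<forall>u\<in>BV \<Omega>. ae_eq_on \<Omega> (T u) u \<and>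
        BV_norm UNIV (T u) \<le> ereal C * BV_norm \<Omega> u \<and> variation_in UNIV (T u) (frontier \<Omega>) = 0)"

definition W11_extension_operator ::
    "'a::euclidean_space set \<Rightarrow> (('a \<Rightarrow> real) \<Rightarrow> 'a \<Rightarrow> real) \<Rightarrow> bool" where
  "W11_extension_operator \<Omega> R \<longleftrightarrow>
     R \<in> W11 \<Omega> \<rightarrow> W11 UNIV \<and> respects_ae \<Omega> (W11 \<Omega>) R \<and>
     (\<exists>C>0. \<forall>u\<in>W11 \<Omega>. ae_eq_on \<Omega> (R u) u \<and> W11_norm UNIV (R u) \<le> C * W11_norm \<Omega> u)"

end

theory Submission
  imports Defs
begin

text \<open>
  Write \<open>E = - closure \<Omega>\<close> for the exterior. A bounded extension to the whole space already exists
  in \<open>BV\<close>; it fails to be a Sobolev function only because \<open>T u\<close> may have a singular gradient in \<open>E\<close>.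
  The idea is to replace \<open>T u\<close> in \<open>E\<close>, and only there, by a smoothing that is linear, bounded from
  \<open>BV\<close> to \<open>W11\<close>, and equal to \<open>T u\<close> at the boundary in a sense strong enough that no gradient is
  created there.

  The smoothing averages over balls whose radius shrinks to zero at the boundary. Let \<open>r\<close> be a
  function of class C^1 with Lipschitz constant 1/2 that is positive exactly on \<open>E\<close>, let \<open>\<rho>\<close> be a
  smooth bump on the unit ball with integral one, and put
    \<open>S f x = \<integral> \<rho>(y) f(x + r(x) y) dy\<close>.
  Off \<open>E\<close> this is \<open>f\<close>. Two facts carry the argument.

  \<^item> Averages at scale \<open>r\<close> are bounded on \<open>L1\<close> (\<open>average_le\<close>): for fixed \<open>x\<close> one substitutes
    \<open>z = x + r(x) y\<close>, and the Lipschitz bound makes \<open>r(x)\<close> and \<open>r(z)\<close> comparable whenever \<open>z\<close> lies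
    in the ball around \<open>x\<close>, so that Tonelli's theorem gives the estimate without any Jacobian.

  \<^item> For \<open>f\<close> of class C^1 the derivative of \<open>S f\<close> has two expressions. Differentiating under the
    integral gives an average of the derivatives of \<open>f\<close>, hence an \<open>L1\<close> bound by the variation of \<open>f\<close>
    that also holds locally. Integrating by parts in \<open>y\<close> moves all derivatives to the bump
    (\<open>smooth_deriv_eq_average\<close>), so on compact subsets of \<open>E\<close> the derivative depends continuously on
    \<open>f\<close> in \<open>L1\<close>. Approximating a \<open>BV\<close> function by mollification therefore yields a weak gradient of
    \<open>S f\<close> in \<open>E\<close> with integral at most a constant times the variation of \<open>f\<close>
    (\<open>average_grad_bound\<close>).

  The gradient of a mollified function is controlled by duality: integrated against its own sign it
  becomes the pairing of \<open>f\<close> with the divergence of a mollified sign function, which is an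
  admissible field for the variation (\<open>mollified_gradient_bound\<close>).

  It remains to glue. A test function is split by cutoffs into a part near \<open>\<partial>\<Omega>\<close>, a part in \<open>\<Omega>\<close>
  and a part in \<open>E\<close>. The boundary part contributes at most a constant times the variation of \<open>T u\<close>
  on a small neighbourhood of \<open>\<partial>\<Omega>\<close>, which tends to zero because \<open>T\<close> is a strong extension operator;
  this uses that \<open>r\<close> is so small near \<open>\<partial>\<Omega>\<close> that averaging cannot leave the neighbourhood. In the
  limit \<open>S (T u)\<close> has the weak gradient of \<open>u\<close> on \<open>\<Omega>\<close>, the gradient found above on \<open>E\<close>, and zero
  on \<open>\<partial>\<Omega>\<close>, whatever the measure of \<open>\<partial>\<Omega>\<close> (\<open>smoothing_has_weak_gradient\<close>). Linearity of
  \<open>u \<mapsto> S (T u)\<close> is inherited from \<open>T\<close>.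
\<close>

section \<open>Calculus of iterated derivatives\<close>

lemma frechet_derivative_eqI:
  assumes "(f has_derivative D) (at x)"
  shows "frechet_derivative f (at x) h = D h"
  using frechet_derivative_at[OF assms] by simp

lemma C_k_SucI:
  assumes "\<And>x. (f has_derivative D x) (at x)" and "\<And>b. b \<in> Basis \<Longrightarrow> C_k k (\<lambda>x. D x b)"
  shows "C_k (Suc k) f"
proof -
  have "frechet_derivative f (at x) = D x" for x
    by (rule frechet_derivative_at[OF assms(1), symmetric])
  then show ?thesis
    using assms by (auto simp: differentiable_def)
qed

lemma C_k_SucD:
  assumes "C_k (Suc k) f"
  shows "(f has_derivative frechet_derivative f (at x)) (at x)"
    and "b \<in> Basis \<Longrightarrow> C_k k (\<lambda>x. frechet_derivative f (at x) b)"
  using assms by (auto simp: frechet_derivative_works[symmetric])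

lemma C_k_continuous: "C_k k f \<Longrightarrow> continuous_on UNIV f"
  by (cases k) (auto intro!: continuous_at_imp_continuous_on differentiable_imp_continuous_within)

lemma C_k_Suc_imp: "C_k (Suc k) f \<Longrightarrow> C_k k f"
proof (induction k arbitrary: f)
  case 0
  then show ?case using C_k_continuous[OF 0] by simp
next
  case (Suc k)
  show ?case
    using C_k_SucD[OF Suc.prems] Suc.IH by (intro C_k_SucI) auto
qed

lemma C_k_const: "C_k k (\<lambda>x. c)"
  by (induction k arbitrary: c) (auto intro!: C_k_SucI[where D = "\<lambda>x h. 0"] derivative_intros simp: continuous_on_const)

lemma C_k_bounded_linear:
  assumes L: "bounded_linear L" and f: "C_k k f"
  shows "C_k k (\<lambda>x. L (f x))"
  using f
proof (induction k arbitrary: f)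
  case 0
  then show ?case using bounded_linear.continuous_on[OF L] by auto
next
  case (Suc k)
  show ?case
    using C_k_SucD[OF Suc.prems] Suc.IH
    by (intro C_k_SucI[where D = "\<lambda>x h. L (frechet_derivative f (at x) h)"] bounded_linear.has_derivative[OF L]) auto
qed

lemma C_k_add:
  assumes "C_k k f" "C_k k g"
  shows "C_k k (\<lambda>x. f x + g x)"
  using assms
proof (induction k arbitrary: f g)
  case 0
  then show ?case by (auto intro: continuous_on_add)
next
  case (Suc k)
  show ?case
    using C_k_SucD[OF Suc.prems(1)] C_k_SucD[OF Suc.prems(2)] Suc.IH
    by (intro C_k_SucI[where D = "\<lambda>x h. frechet_derivative f (at x) h + frechet_derivative g (at x) h"] has_derivative_add) auto
qed

lemma C_k_diff:
  assumes "C_k k f" "C_k k g"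
  shows "C_k k (\<lambda>x. f x - g x)"
  using C_k_add[OF assms(1) C_k_bounded_linear[OF bounded_linear_minus[OF bounded_linear_ident] assms(2)]] by simp

lemma C_k_mult:
  fixes f g :: "'a::euclidean_space \<Rightarrow> real"
  assumes "C_k k f" "C_k k g"
  shows "C_k k (\<lambda>x. f x * g x)"
  using assms
proof (induction k arbitrary: f g)
  case 0
  then show ?case by (auto intro: continuous_on_mult)
next
  case (Suc k)
  show ?case
    using C_k_SucD[OF Suc.prems(1)] C_k_SucD[OF Suc.prems(2)] Suc.IH C_k_Suc_imp[OF Suc.prems(1)] C_k_Suc_imp[OF Suc.prems(2)]
    by (intro C_k_SucI[where D = "\<lambda>x h. f x * frechet_derivative g (at x) h + frechet_derivative f (at x) h * g x"] has_derivative_mult C_k_add) auto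
qed

text \<open>Dividing \<open>exp (- 1 / t)\<close> by powers of \<open>t\<close> gives a family whose derivatives are combinations of its
  members, which turns smoothness at the origin into an induction.\<close>

definition flat :: "nat \<Rightarrow> real \<Rightarrow> real" where
  "flat j t = (if t \<le> 0 then 0 else exp (- 1 / t) / t ^ j)"

lemma flat_tendsto_0: "((\<lambda>t. exp (- 1 / t) / t ^ j) \<longlongrightarrow> 0) (at_right (0::real))"
proof -
  have *: "((\<lambda>s. s ^ j / exp s) \<longlongrightarrow> 0) (at_top :: real filter)"
    by (rule tendsto_power_div_exp_0)
  have "((\<lambda>t. inverse t ^ j / exp (inverse t)) \<longlongrightarrow> 0) (at_right (0::real))"
    using filterlim_compose[OF * filterlim_inverse_at_top_right] .
  then show ?thesis
    by (simp add: field_simps exp_minus)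
qed

text \<open>At the origin both one-sided difference quotients tend to zero, because the exponential beats
  every power of \<open>1 / t\<close>; elsewhere this is the quotient rule.\<close>

lemma flat_DERIV: "(flat j has_real_derivative (- real j * flat (Suc j) t + flat (Suc (Suc j)) t)) (at t)"
proof -
  consider "t < 0" | "t > 0" | "t = 0" by linarith
  then show ?thesis
  proof cases
    case 1
    have "(flat j has_real_derivative 0) (at t)"
    proof (rule has_field_derivative_transform_within_open[where f = "\<lambda>x. 0" and S = "{..<0}"])
    qed (use 1 in \<open>auto simp: flat_def intro!: derivative_eq_intros\<close>)
    then show ?thesis using 1 by (simp add: flat_def)
  next
    case 2
    have "n = 0 \<or> t ^ n = t * t ^ (n - Suc 0)" for n
      by (cases n) auto
    then have "((\<lambda>t. exp (- 1 / t) / t ^ j) has_real_derivative (- real j * flat (Suc j) t + flat (Suc (Suc j)) t)) (at t)"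
      using 2 by (cases j) (auto intro!: derivative_eq_intros simp: flat_def field_simps power2_eq_square)
    then show ?thesis
    proof (rule has_field_derivative_transform_within_open[where S = "{0<..}"])
    qed (use 2 in \<open>auto simp: flat_def\<close>)
  next
    case 3
    have "((\<lambda>y. (flat j y - flat j 0) / (y - 0)) \<longlongrightarrow> 0) (at 0)"
    proof -
      have "((\<lambda>y. (flat j y - flat j 0) / (y - 0)) \<longlongrightarrow> 0) (at_left 0)"
        by (rule tendsto_eventually) (auto simp: flat_def eventually_at_filter)
      moreover have "((\<lambda>y. (flat j y - flat j 0) / (y - 0)) \<longlongrightarrow> 0) (at_right 0)"
        by (rule Lim_transform_eventually[OF flat_tendsto_0[of "Suc j"]])
           (auto simp: flat_def eventually_at_filter)
      ultimately show ?thesis by (simp add: filterlim_split_at)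
    qed
    then show ?thesis
      using 3 by (simp add: has_field_derivative_iff flat_def)
  qed
qed

text \<open>The chain rule turns one member of the family \<open>flat\<close> into a polynomial multiple of two others,
  so the induction has to run over all members at once.\<close>

lemma C_k_flat_ball: "C_k k (\<lambda>x::'a::euclidean_space. flat j (d - x \<bullet> x))"
proof (induction k arbitrary: j)
  case 0
  have "continuous_on UNIV (flat j)"
    using flat_DERIV by (auto intro!: continuous_at_imp_continuous_on DERIV_isCont)
  then show ?case
    by (auto intro!: continuous_on_compose2[of UNIV "flat j"] continuous_intros)
next
  case (Suc k)
  have lin: "C_k k (\<lambda>x::'a. x \<bullet> b)" for b
  proof (cases k)
    case (Suc k')
    show ?thesis unfolding Suc
      by (rule C_k_SucI[where D = "\<lambda>x h. h \<bullet> b"]) (auto intro!: derivative_eq_intros C_k_const)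
  qed (auto intro: continuous_intros)
  have *: "((\<lambda>x. flat j (d - x \<bullet> x)) has_derivative
      (\<lambda>h. (- real j * flat (Suc j) (d - x \<bullet> x) + flat (Suc (Suc j)) (d - x \<bullet> x)) * (-2 * (x \<bullet> h)))) (at x)" for x :: 'a
    by (rule has_derivative_compose[of "\<lambda>x. d - x \<bullet> x", OF _ flat_DERIV[unfolded has_field_derivative_def], THEN has_derivative_eq_rhs])
       (auto intro!: derivative_eq_intros simp: inner_commute)
  show ?case
  proof (rule C_k_SucI[OF *])
    fix b :: 'a assume "b \<in> Basis"
    show "C_k k (\<lambda>x. (- real j * flat (Suc j) (d - x \<bullet> x) + flat (Suc (Suc j)) (d - x \<bullet> x)) * (-2 * (x \<bullet> b)))"
      by (intro C_k_mult C_k_add C_k_const Suc.IH lin)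
  qed
qed

section \<open>Compactly supported functions and integration by parts\<close>

lemma frechet_derivative_expand:
  fixes f :: "'a::euclidean_space \<Rightarrow> 'b::real_normed_vector"
  assumes "f differentiable (at x)"
  shows "frechet_derivative f (at x) h = (\<Sum>b\<in>Basis. (h \<bullet> b) *\<^sub>R frechet_derivative f (at x) b)"
proof -
  have lin: "linear (frechet_derivative f (at x))"
    using assms by (rule linear_frechet_derivative)
  have "frechet_derivative f (at x) h = frechet_derivative f (at x) (\<Sum>b\<in>Basis. (h \<bullet> b) *\<^sub>R b)"
    by (simp add: euclidean_representation)
  also have "\<dots> = (\<Sum>b\<in>Basis. (h \<bullet> b) *\<^sub>R frechet_derivative f (at x) b)"
    by (simp add: linear_sum[OF lin] linear_cmul[OF lin] o_def)
  finally show ?thesis .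
qed

lemma C_1_continuous_derivative:
  assumes "C_k (Suc k) f" "continuous_on UNIV h"
  shows "continuous_on UNIV (\<lambda>x. frechet_derivative f (at x) (h x))"
proof -
  have "continuous_on UNIV (\<lambda>x. \<Sum>b\<in>Basis. (h x \<bullet> b) *\<^sub>R frechet_derivative f (at x) b)"
    using assms by (intro continuous_intros) (auto dest: C_k_continuous)
  then show ?thesis
    using assms(1) by (simp add: frechet_derivative_expand[symmetric])
qed

lemma frechet_derivative_eq_0_open:
  assumes "open S" "x \<in> S" "\<And>y. y \<in> S \<Longrightarrow> f y = 0"
  shows "frechet_derivative f (at x) h = 0"
proof -
  have "(f has_derivative (\<lambda>h. 0)) (at x)"
    by (rule has_derivative_transform_within_open[of "\<lambda>x. 0", OF _ assms(1,2)]) (use assms(3) in auto)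
  then show ?thesis by (rule frechet_derivative_eqI)
qed

lemma open_norm_gt: "open {x::'a::real_normed_vector. R < norm x}"
  by (intro open_Collect_less continuous_intros)

text \<open>Bounded support is expressed by vanishing outside a ball. This form passes to derivatives
  because the complement of a closed ball is open.\<close>

lemma frechet_derivative_vanish:
  fixes f :: "'a::real_normed_vector \<Rightarrow> 'b::real_normed_vector"
  assumes "\<forall>x. R < norm x \<longrightarrow> f x = 0"
  shows "\<forall>x. R < norm x \<longrightarrow> frechet_derivative f (at x) h = 0"
proof (intro allI impI)
  fix x :: 'a assume "R < norm x"
  then show "frechet_derivative f (at x) h = 0"
    using frechet_derivative_eq_0_open[of "{x. R < norm x}" x f h] open_norm_gt[where R = R and 'a = 'a] assms by auto
qed

lemma vanish_bounded:
  fixes f :: "'a::euclidean_space \<Rightarrow> 'b::real_normed_vector"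
  assumes "continuous_on UNIV f" "\<forall>x. R < norm x \<longrightarrow> f x = 0"
  obtains B where "B > 0" "\<And>x. norm (f x) \<le> B"
proof -
  have "compact (f ` cball 0 R)"
    using assms(1) by (intro compact_continuous_image compact_cball) (auto intro: continuous_on_subset)
  then obtain B where B: "B > 0" "\<forall>y\<in>f ` cball 0 R. norm y \<le> B"
    using compact_imp_bounded bounded_pos by metis
  have "norm (f x) \<le> B" for x
    using B assms(2) by (cases "norm x \<le> R") auto
  then show ?thesis using that B by auto
qed

lemma vanish_uniformly_continuous:
  fixes f :: "'a::euclidean_space \<Rightarrow> 'b::real_normed_vector"
  assumes "continuous_on UNIV f" "\<forall>x. R < norm x \<longrightarrow> f x = 0" "e > 0"
  shows "\<exists>d>0. \<forall>x y. dist y x < d \<longrightarrow> dist (f y) (f x) < e"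
proof -
  have "uniformly_continuous_on (cball 0 (R + 1)) f"
    using assms(1) by (intro compact_uniformly_continuous compact_cball) (auto intro: continuous_on_subset)
  then obtain d where d: "d > 0" "\<And>x y. x \<in> cball 0 (R+1) \<Longrightarrow> y \<in> cball 0 (R+1) \<Longrightarrow> dist y x < d \<Longrightarrow> dist (f y) (f x) < e"
    using assms(3) unfolding uniformly_continuous_on_def by metis
  have "dist (f y) (f x) < e" if "dist y x < min d 1" for x y
  proof (cases "norm x \<le> R + 1 \<and> norm y \<le> R + 1")
    case True
    then show ?thesis using d(2)[of x y] that by auto
  next
    case False
    have "\<bar>norm x - norm y\<bar> < 1"
      using that norm_triangle_ineq3[of x y] by (auto simp: dist_norm norm_minus_commute)
    with False have "R < norm x \<and> R < norm y" by linarith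
    then show ?thesis using assms(2,3) by simp
  qed
  then show ?thesis using d(1) by (intro exI[of _ "min d 1"]) auto
qed

lemma vanish_integrable:
  fixes f :: "'a::euclidean_space \<Rightarrow> 'b::euclidean_space"
  assumes "continuous_on UNIV f" "\<forall>x. R < norm x \<longrightarrow> f x = 0"
  shows "integrable lborel f"
proof -
  have "integrable lborel (\<lambda>x. indicator (cball 0 R) x *\<^sub>R f x)"
    using assms(1) by (intro borel_integrable_compact compact_cball) (auto intro: continuous_on_subset)
  moreover have "(\<lambda>x. indicator (cball 0 R) x *\<^sub>R f x) = f"
    using assms(2) by (auto simp: indicator_def fun_eq_iff)
  ultimately show ?thesis by simp
qed

text \<open>The partial derivatives are continuous with compact support, hence uniformly continuous, and
  the mean value inequality makes the first-order expansion uniform in the base point.\<close>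

lemma uniformly_differentiable:
  fixes f :: "'a::euclidean_space \<Rightarrow> real"
  assumes f: "C_k (Suc 0) f" "\<forall>x. R < norm x \<longrightarrow> f x = 0" and "e > 0"
  shows "\<exists>d>0. \<forall>x h. norm h < d \<longrightarrow> \<bar>f (x + h) - f x - frechet_derivative f (at x) h\<bar> \<le> e * norm h"
proof -
  let ?D = "\<lambda>x. frechet_derivative f (at x)"
  have "\<forall>b\<in>Basis. \<exists>d. d > 0 \<and> (\<forall>x y. dist y x < d \<longrightarrow> dist (?D y b) (?D x b) < e / DIM('a))"
  proof
    fix b :: 'a assume b: "b \<in> Basis"
    have "continuous_on UNIV (\<lambda>x. ?D x b)" "0 < e / DIM('a)" using f b \<open>e > 0\<close> by auto
    then show "\<exists>d. d > 0 \<and> (\<forall>x y. dist y x < d \<longrightarrow> dist (?D y b) (?D x b) < e / DIM('a))"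
      by (intro vanish_uniformly_continuous[OF _ frechet_derivative_vanish[OF f(2)]])
  qed
  from bchoice[OF this] obtain d where d: "\<And>b. b \<in> Basis \<Longrightarrow> d b > 0"
    "\<And>b x y. b \<in> Basis \<Longrightarrow> dist y x < d b \<Longrightarrow> dist (?D y b) (?D x b) < e / DIM('a)" by blast
  define d0 where "d0 = Min (d ` Basis)"
  have d0: "d0 > 0" "\<And>b. b \<in> Basis \<Longrightarrow> d0 \<le> d b"
    using d(1) by (auto simp: d0_def)
  have on: "onorm (\<lambda>h. ?D y h - ?D x h) \<le> e" if "dist y x < d0" for x y
  proof (rule onorm_le)
    fix h
    have "?D y h - ?D x h = (\<Sum>b\<in>Basis. (h \<bullet> b) * (?D y b - ?D x b))"
      using f frechet_derivative_expand[of f x h] frechet_derivative_expand[of f y h]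
      by (simp add: sum_subtractf algebra_simps)
    also have "norm \<dots> \<le> (\<Sum>b\<in>(Basis::'a set). norm h * (e / DIM('a)))"
    proof (rule sum_norm_le)
      fix b :: 'a assume b: "b \<in> Basis"
      have "\<bar>?D y b - ?D x b\<bar> \<le> e / DIM('a)"
        using d(2)[OF b, of y x] d0(2)[OF b] that by (auto simp: dist_norm)
      then show "norm ((h \<bullet> b) * (?D y b - ?D x b)) \<le> norm h * (e / DIM('a))"
        unfolding real_norm_def abs_mult using Basis_le_norm[OF b, of h] by (intro mult_mono) auto
    qed
    also have "\<dots> = e * norm h" by simp
    finally show "norm (?D y h - ?D x h) \<le> e * norm h" .
  qed
  have "\<bar>f (x + h) - f x - ?D x h\<bar> \<le> e * norm h" if h: "norm h < d0" for x h
  proof -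
    have "norm (f (x + h) - f x - ?D x ((x + h) - x)) \<le> norm ((x + h) - x) * e"
    proof (rule differentiable_bound_linearization[where S = "ball x d0" and f' = ?D])
      fix t :: real assume "t \<in> {0..1}"
      then have "norm (t *\<^sub>R h) \<le> norm h" by (auto intro: mult_left_le_one_le)
      then show "x + t *\<^sub>R (x + h - x) \<in> ball x d0" using h by (simp add: dist_norm)
    next
      fix y assume "y \<in> ball x d0"
      then show "onorm (?D y - ?D x) \<le> e"
        using on[of y x] by (simp add: fun_diff_def dist_commute)
    qed (use f d0 C_k_SucD[OF f(1)] in \<open>auto intro: has_derivative_at_withinI\<close>)
    then show ?thesis by (simp add: mult.commute)
  qed
  then show ?thesis using d0(1) by blast
qed

lemma integral_le_integral:
  fixes f g :: "'a \<Rightarrow> real"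
  assumes "integrable M f" "integrable M g" "\<And>x. f x \<le> g x"
  shows "integral\<^sup>L M f \<le> integral\<^sup>L M g"
  using assms by (intro integral_mono_AE) auto

lemma integral_lborel_shift:
  fixes f :: "'a::euclidean_space \<Rightarrow> 'b::euclidean_space"
  assumes "f \<in> borel_measurable borel"
  shows "(\<integral>x. f (x + c) \<partial>lborel) = (\<integral>x. f x \<partial>lborel)"
proof -
  have "(\<integral>x. f x \<partial>distr lborel borel ((+) c)) = (\<integral>x. f (c + x) \<partial>lborel)"
    using assms by (intro integral_distr) auto
  then show ?thesis by (simp add: lborel_distr_plus add.commute)
qed

lemma integrable_lborel_shift:
  fixes f :: "'a::euclidean_space \<Rightarrow> 'b::euclidean_space"
  assumes "integrable lborel f"
  shows "integrable lborel (\<lambda>x. f (x + c))"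
proof -
  have "integrable (distr lborel borel ((+) c)) f" using assms by (simp add: lborel_distr_plus)
  then have "integrable lborel (\<lambda>x. f (c + x))"
    using assms by (subst (asm) integrable_distr_eq) auto
  then show ?thesis by (simp add: add.commute)
qed

lemma lborel_eq_distr_reflect: "distr lborel borel (\<lambda>x. c - x) = (lborel :: 'a::euclidean_space measure)"
  using lborel_affine[of "-1::real" c, symmetric] by (simp add: density_1)

lemma integral_lborel_reflect:
  fixes f :: "'a::euclidean_space \<Rightarrow> 'b::euclidean_space"
  assumes "f \<in> borel_measurable borel"
  shows "(\<integral>x. f (c - x) \<partial>lborel) = (\<integral>x. f x \<partial>lborel)"
proof -
  have "(\<integral>x. f x \<partial>distr lborel borel (\<lambda>x. c - x)) = (\<integral>x. f (c - x) \<partial>lborel)"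
    using assms by (intro integral_distr) auto
  then show ?thesis by (simp add: lborel_eq_distr_reflect)
qed

lemma integrable_indicator_bounded:
  fixes S :: "'a::euclidean_space set"
  assumes "bounded S" "S \<in> sets borel"
  shows "integrable lborel (indicator S :: 'a \<Rightarrow> real)"
  using emeasure_bounded_finite[OF assms(1)] assms(2) by (auto intro!: integrable_real_indicator)

lemma integrable_indicator_cball: "integrable lborel (indicator (cball (c::'a::euclidean_space) r) :: 'a \<Rightarrow> real)"
  by (intro integrable_indicator_bounded) auto

text \<open>Translation invariance gives integral zero to the difference quotients, and these converge to
  the derivative uniformly with supports in one fixed ball.\<close>

lemma integral_partial_derivative_0:
  fixes f :: "'a::euclidean_space \<Rightarrow> real"
  assumes f: "C_k (Suc 0) f" "\<forall>x. R < norm x \<longrightarrow> f x = 0"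
  shows "(\<integral>x. frechet_derivative f (at x) h \<partial>lborel) = 0"
proof -
  let ?D = "\<lambda>x. frechet_derivative f (at x)"
  have cf: "continuous_on UNIV f" and cD: "continuous_on UNIV (\<lambda>x. ?D x v)" for v
    using C_k_continuous[OF f(1)] C_1_continuous_derivative[OF f(1)] by auto
  have intf: "integrable lborel f" and intD: "integrable lborel (\<lambda>x. ?D x v)" for v
    using vanish_integrable[OF cf f(2)] vanish_integrable[OF cD frechet_derivative_vanish[OF f(2)]] by auto
  have mf: "f \<in> borel_measurable borel" using cf by (rule borel_measurable_continuous_onI)
  have lin: "linear (?D x)" for x using f by (intro linear_frechet_derivative) auto
  define V where "V = measure lborel (cball (0::'a) (R + norm h))"
  have "\<bar>\<integral>x. ?D x h \<partial>lborel\<bar> \<le> e * norm h * V" if "e > 0" for e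
  proof -
    obtain d where d: "d > 0" "\<And>x k. norm k < d \<Longrightarrow> \<bar>f (x + k) - f x - ?D x k\<bar> \<le> e * norm k"
      using uniformly_differentiable[OF f \<open>e > 0\<close>] by blast
    define t where "t = min 1 (d / (norm h + 1)) / 2"
    have t: "t > 0" "t \<le> 1" "t * norm h < d"
    proof -
      show "t > 0" using d(1) norm_ge_zero[of h] by (simp add: t_def add_nonneg_pos)
      show "t \<le> 1" by (simp add: t_def)
      have "t * norm h \<le> (d / (norm h + 1)) / 2 * norm h"
        unfolding t_def by (intro mult_right_mono divide_right_mono min.cobounded2) auto
      also have "\<dots> = d * (norm h / (norm h + 1) / 2)" by simp
      also have "\<dots> < d * 1" using d(1) by (intro mult_strict_left_mono) (simp_all add: divide_simps add_nonneg_pos)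
      also have "\<dots> = d" by simp
      finally show "t * norm h < d" .
    qed
    have bd: "\<bar>f (x + t *\<^sub>R h) - f x - ?D x (t *\<^sub>R h)\<bar> \<le> indicator (cball 0 (R + norm h)) x * (e * norm (t *\<^sub>R h))" for x
    proof (cases "norm x \<le> R + norm h")
      case True
      then show ?thesis using d(2)[of "t *\<^sub>R h" x] t by simp
    next
      case False
      have th: "norm (t *\<^sub>R h) \<le> norm h" using t by (simp add: mult_left_le_one_le)
      have "norm x \<le> norm (x + t *\<^sub>R h) + norm (t *\<^sub>R h)"
        using norm_triangle_ineq4[of "x + t *\<^sub>R h" "t *\<^sub>R h"] by simp
      then have "R < norm (x + t *\<^sub>R h)" "R < norm x" using False th norm_ge_zero[of h] by linarith+
      then show ?thesis
        using f(2) frechet_derivative_vanish[OF f(2)] False by simp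
    qed
    have "\<bar>\<integral>x. (f (x + t *\<^sub>R h) - f x - ?D x (t *\<^sub>R h)) \<partial>lborel\<bar>
        \<le> (\<integral>x. \<bar>f (x + t *\<^sub>R h) - f x - ?D x (t *\<^sub>R h)\<bar> \<partial>lborel)"
      by (rule integral_abs_bound)
    also have "\<dots> \<le> (\<integral>x. indicator (cball (0::'a) (R + norm h)) x * (e * norm (t *\<^sub>R h)) \<partial>lborel)"
      apply (rule integral_le_integral)
      apply (intro integrable_abs Bochner_Integration.integrable_diff integrable_lborel_shift intf intD)
      apply (intro integrable_mult_left integrable_indicator_cball)
      apply (rule bd)
      done
    finally have "\<bar>\<integral>x. (f (x + t *\<^sub>R h) - f x - ?D x (t *\<^sub>R h)) \<partial>lborel\<bar>
        \<le> (\<integral>x. indicator (cball (0::'a) (R + norm h)) x * (e * norm (t *\<^sub>R h)) \<partial>lborel)" .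
    moreover have "(\<integral>x. (f (x + t *\<^sub>R h) - f x - ?D x (t *\<^sub>R h)) \<partial>lborel) = - t * (\<integral>x. ?D x h \<partial>lborel)"
      by (simp add: integral_lborel_shift[OF mf] integrable_lborel_shift intf intD linear_cmul[OF lin])
    ultimately have "t * \<bar>\<integral>x. ?D x h \<partial>lborel\<bar> \<le> t * (e * norm h * V)"
      using t by (simp add: abs_mult V_def ac_simps)
    then show ?thesis using t by simp
  qed
  then have *: "\<bar>\<integral>x. ?D x h \<partial>lborel\<bar> \<le> e * (norm h * V)" if "e > 0" for e
    using that by (simp add: mult.assoc)
  have "\<bar>\<integral>x. ?D x h \<partial>lborel\<bar> \<le> 0"
  proof (rule field_le_epsilon)
    fix e :: real assume "e > 0"
    have nn: "0 \<le> norm h * V" by (simp add: V_def)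
    have "\<bar>\<integral>x. ?D x h \<partial>lborel\<bar> \<le> e / (norm h * V + 1) * (norm h * V)"
      using *[of "e / (norm h * V + 1)"] \<open>e > 0\<close> nn by (simp add: add_nonneg_pos)
    also have "\<dots> \<le> e" using nn \<open>e > 0\<close> by (simp add: field_simps)
    finally show "\<bar>\<integral>x. ?D x h \<partial>lborel\<bar> \<le> 0 + e" by simp
  qed
  then show ?thesis by simp
qed

lemma frechet_derivative_mult:
  fixes f g :: "'a::euclidean_space \<Rightarrow> real"
  assumes "f differentiable (at x)" "g differentiable (at x)"
  shows "frechet_derivative (\<lambda>x. f x * g x) (at x) h =
    f x * frechet_derivative g (at x) h + frechet_derivative f (at x) h * g x"
proof -
  have "((\<lambda>x. f x * g x) has_derivative
      (\<lambda>h. f x * frechet_derivative g (at x) h + frechet_derivative f (at x) h * g x)) (at x)"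
    using assms by (intro has_derivative_mult) (auto simp: frechet_derivative_works)
  then show ?thesis by (rule frechet_derivative_eqI)
qed

lemma integral_by_parts:
  fixes f g :: "'a::euclidean_space \<Rightarrow> real"
  assumes f: "C_k (Suc 0) f" and g: "C_k (Suc 0) g" "\<forall>x. R < norm x \<longrightarrow> g x = 0"
  shows "(\<integral>x. f x * frechet_derivative g (at x) h \<partial>lborel) =
       - (\<integral>x. frechet_derivative f (at x) h * g x \<partial>lborel)"
proof -
  have cD: "continuous_on UNIV (\<lambda>x. frechet_derivative f (at x) h)" "continuous_on UNIV (\<lambda>x. frechet_derivative g (at x) h)"
    using C_1_continuous_derivative[OF f] C_1_continuous_derivative[OF g(1)] by auto
  have c: "continuous_on UNIV f" "continuous_on UNIV g" using C_k_continuous[OF f] C_k_continuous[OF g(1)] by auto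
  have "0 = (\<integral>x. frechet_derivative (\<lambda>x. f x * g x) (at x) h \<partial>lborel)"
    by (rule integral_partial_derivative_0[symmetric, where R = R]) (use C_k_mult[OF f g(1)] g(2) in auto)
  also have "\<dots> = (\<integral>x. f x * frechet_derivative g (at x) h + frechet_derivative f (at x) h * g x \<partial>lborel)"
    using f g by (simp add: frechet_derivative_mult)
  also have "\<dots> = (\<integral>x. f x * frechet_derivative g (at x) h \<partial>lborel) + (\<integral>x. frechet_derivative f (at x) h * g x \<partial>lborel)"
    by (intro Bochner_Integration.integral_add vanish_integrable[where R = R] continuous_on_mult c cD)
       (use g frechet_derivative_vanish[OF g(2)] in auto)
  finally show ?thesis by simp
qed

section \<open>Mollification\<close>

definition conv :: "('a::euclidean_space \<Rightarrow> real) \<Rightarrow> ('a \<Rightarrow> real) \<Rightarrow> 'a \<Rightarrow> real" where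
  "conv f \<rho> x = (\<integral>z. f z * \<rho> (x - z) \<partial>lborel)"

lemma integrable_mult_bounded_measure:
  fixes f g :: "'a \<Rightarrow> real"
  assumes "integrable M f" "g \<in> borel_measurable M" "\<And>x. \<bar>g x\<bar> \<le> B"
  shows "integrable M (\<lambda>x. f x * g x)"
proof (rule Bochner_Integration.integrable_bound[of M "\<lambda>x. B * f x"])
  show "AE x in M. norm (f x * g x) \<le> norm (B * f x)"
  proof (intro AE_I2)
    fix x
    have "\<bar>f x\<bar> * \<bar>g x\<bar> \<le> \<bar>f x\<bar> * \<bar>B\<bar>"
      using assms(3)[of x] by (intro mult_left_mono) auto
    then show "norm (f x * g x) \<le> norm (B * f x)" by (simp add: abs_mult mult.commute)
  qed
qed (use assms in auto)

lemma integrable_mult_bounded: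
  fixes f g :: "'a::euclidean_space \<Rightarrow> real"
  assumes "integrable lborel f" "g \<in> borel_measurable borel" "\<And>x. \<bar>g x\<bar> \<le> B"
  shows "integrable lborel (\<lambda>x. f x * g x)"
  by (rule integrable_mult_bounded_measure[OF assms(1) _ assms(3)]) (use assms(2) in simp)

lemma integrable_mult_vanish:
  fixes f g :: "'a::euclidean_space \<Rightarrow> real"
  assumes "integrable lborel f" "continuous_on UNIV g" "\<forall>x. R < norm x \<longrightarrow> g x = 0"
  shows "integrable lborel (\<lambda>x. f x * g x)"
proof -
  obtain B where B: "\<And>x. norm (g x) \<le> B" using vanish_bounded[OF assms(2,3)] by blast
  show ?thesis
    by (rule integrable_mult_bounded[OF assms(1), of g B])
       (use B assms(2) in \<open>auto intro: borel_measurable_continuous_onI\<close>)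
qed

lemma conv_integrable_integrand:
  fixes f \<rho> :: "'a::euclidean_space \<Rightarrow> real"
  assumes f: "integrable lborel f" and \<rho>: "continuous_on UNIV \<rho>" "\<forall>x. R < norm x \<longrightarrow> \<rho> x = 0"
  shows "integrable lborel (\<lambda>z. f z * \<rho> (x - z))"
proof -
  obtain B where B: "\<And>x. norm (\<rho> x) \<le> B" using vanish_bounded[OF \<rho>] by blast
  have "continuous_on UNIV (\<lambda>z. \<rho> (x - z))"
    by (rule continuous_on_compose2[OF \<rho>(1)]) (auto intro: continuous_intros)
  then show ?thesis
    using B by (intro integrable_mult_bounded[OF f, where B = B]) (auto intro: borel_measurable_continuous_onI)
qed

lemma conv_continuous:
  fixes f \<rho> :: "'a::euclidean_space \<Rightarrow> real"
  assumes f: "integrable lborel f" and \<rho>: "continuous_on UNIV \<rho>" "\<forall>x. R < norm x \<longrightarrow> \<rho> x = 0"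
  shows "continuous_on UNIV (conv f \<rho>)"
  unfolding continuous_on_iff
proof (intro ballI allI impI)
  fix x :: 'a and e :: real assume "e > 0"
  define N where "N = (\<integral>x. \<bar>f x\<bar> \<partial>lborel)"
  have N: "N \<ge> 0" by (simp add: N_def)
  have e': "0 < e / (N + 1)" using \<open>e > 0\<close> N by simp
  obtain d where d: "d > 0" "\<And>x y. dist y x < d \<Longrightarrow> dist (\<rho> y) (\<rho> x) < e / (N + 1)"
    using vanish_uniformly_continuous[OF \<rho> e'] by blast
  have "dist (conv f \<rho> y) (conv f \<rho> x) < e" if "dist y x < d" for y
  proof -
    have "conv f \<rho> y - conv f \<rho> x = (\<integral>z. f z * \<rho> (y - z) - f z * \<rho> (x - z) \<partial>lborel)"
      unfolding conv_def
      by (intro Bochner_Integration.integral_diff[symmetric] conv_integrable_integrand[OF f \<rho>])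
    also have "\<bar>\<dots>\<bar> \<le> (\<integral>z. \<bar>f z * \<rho> (y - z) - f z * \<rho> (x - z)\<bar> \<partial>lborel)"
      by (rule integral_abs_bound)
    also have "\<dots> \<le> (\<integral>z. \<bar>f z\<bar> * (e / (N + 1)) \<partial>lborel)"
    proof (rule integral_le_integral)
      fix z
      have "\<bar>\<rho> (y - z) - \<rho> (x - z)\<bar> \<le> e / (N + 1)"
        using d(2)[of "y - z" "x - z"] that by (simp add: dist_norm)
      then show "\<bar>f z * \<rho> (y - z) - f z * \<rho> (x - z)\<bar> \<le> \<bar>f z\<bar> * (e / (N + 1))"
        unfolding right_diff_distrib[symmetric] abs_mult by (intro mult_left_mono) auto
    qed (intro integrable_abs Bochner_Integration.integrable_diff integrable_mult_left f conv_integrable_integrand[OF f \<rho>])+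
    also have "\<dots> = N * (e / (N + 1))" by (simp add: N_def)
    also have "\<dots> < e" using \<open>e > 0\<close> N by (simp add: field_simps)
    finally show ?thesis by (simp add: dist_norm)
  qed
  then show "\<exists>d>0. \<forall>x'\<in>UNIV. dist x' x < d \<longrightarrow> dist (conv f \<rho> x') (conv f \<rho> x) < e" using d(1) by auto
qed

text \<open>The uniform expansion of the kernel, multiplied by \<open>f\<close> and integrated, is an expansion of the
  convolution with error at most a small multiple of the \<open>L1\<close> norm of \<open>f\<close>.\<close>

lemma conv_has_derivative:
  fixes f \<rho> :: "'a::euclidean_space \<Rightarrow> real"
  assumes f: "integrable lborel f" and \<rho>: "C_k (Suc 0) \<rho>" "\<forall>x. R < norm x \<longrightarrow> \<rho> x = 0"
  shows "(conv f \<rho> has_derivative (\<lambda>h. conv f (\<lambda>x. frechet_derivative \<rho> (at x) h) x)) (at x)"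
proof -
  let ?D = "\<lambda>x. frechet_derivative \<rho> (at x)"
  have c\<rho>: "continuous_on UNIV \<rho>" and cD: "continuous_on UNIV (\<lambda>x. ?D x v)" for v
    using C_k_continuous[OF \<rho>(1)] C_1_continuous_derivative[OF \<rho>(1)] by auto
  note vD = frechet_derivative_vanish[OF \<rho>(2)]
  have int\<rho>: "integrable lborel (\<lambda>z. f z * \<rho> (x - z))" and intD: "integrable lborel (\<lambda>z. f z * ?D (x - z) v)" for x v
    using conv_integrable_integrand[OF f c\<rho> \<rho>(2)] conv_integrable_integrand[OF f cD vD] by auto
  have lin: "linear (?D x)" for x using \<rho> by (intro linear_frechet_derivative) auto
  have "linear (\<lambda>h. conv f (\<lambda>x. ?D x h) x)"
  proof (rule linearI)
    fix h k show "conv f (\<lambda>x. ?D x (h + k)) x = conv f (\<lambda>x. ?D x h) x + conv f (\<lambda>x. ?D x k) x"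
      unfolding conv_def by (simp add: linear_add[OF lin] distrib_left intD)
  next
    fix r h show "conv f (\<lambda>x. ?D x (r *\<^sub>R h)) x = r *\<^sub>R conv f (\<lambda>x. ?D x h) x"
      unfolding conv_def by (simp add: linear_cmul[OF lin] mult.left_commute)
  qed
  moreover have "\<exists>d>0. \<forall>y. norm (y - x) < d \<longrightarrow> norm (conv f \<rho> y - conv f \<rho> x - conv f (\<lambda>w. ?D w (y - x)) x) \<le> e * norm (y - x)"
    if "e > 0" for e
  proof -
    define N where "N = (\<integral>x. \<bar>f x\<bar> \<partial>lborel)"
    have N: "N \<ge> 0" by (simp add: N_def)
    have e': "0 < e / (N + 1)" using \<open>e > 0\<close> N by simp
    obtain d where d: "d > 0" "\<And>x h. norm h < d \<Longrightarrow> \<bar>\<rho> (x + h) - \<rho> x - ?D x h\<bar> \<le> e / (N + 1) * norm h"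
      using uniformly_differentiable[OF \<rho> e'] by blast
    have "norm (conv f \<rho> y - conv f \<rho> x - conv f (\<lambda>w. ?D w (y - x)) x) \<le> e * norm (y - x)" if "norm (y - x) < d" for y
    proof -
      have eq: "conv f \<rho> y - conv f \<rho> x - conv f (\<lambda>w. ?D w (y - x)) x =
          (\<integral>z. f z * \<rho> (y - z) - f z * \<rho> (x - z) - f z * ?D (x - z) (y - x) \<partial>lborel)"
        unfolding conv_def by (simp add: int\<rho> intD)
      have "norm (conv f \<rho> y - conv f \<rho> x - conv f (\<lambda>w. ?D w (y - x)) x)
          \<le> (\<integral>z. \<bar>f z * \<rho> (y - z) - f z * \<rho> (x - z) - f z * ?D (x - z) (y - x)\<bar> \<partial>lborel)"
        unfolding eq real_norm_def by (rule integral_abs_bound)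
      also have "\<dots> \<le> (\<integral>z. \<bar>f z\<bar> * (e / (N + 1) * norm (y - x)) \<partial>lborel)"
      proof (rule integral_le_integral)
        fix z
        have "\<bar>\<rho> (y - z) - \<rho> (x - z) - ?D (x - z) (y - x)\<bar> \<le> e / (N + 1) * norm (y - x)"
          using d(2)[of "y - x" "x - z"] that by simp
        then show "\<bar>f z * \<rho> (y - z) - f z * \<rho> (x - z) - f z * ?D (x - z) (y - x)\<bar> \<le> \<bar>f z\<bar> * (e / (N + 1) * norm (y - x))"
          unfolding right_diff_distrib[symmetric] abs_mult by (intro mult_left_mono) auto
      qed (intro integrable_abs Bochner_Integration.integrable_diff integrable_mult_left f int\<rho> intD)+
      also have "\<dots> = N / (N + 1) * e * norm (y - x)" by (simp add: N_def)
      also have "\<dots> \<le> 1 * e * norm (y - x)" using \<open>e > 0\<close> N by (intro mult_right_mono) auto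
      finally show ?thesis by simp
    qed
    then show ?thesis using d(1) by blast
  qed
  ultimately show ?thesis
    unfolding has_derivative_at_alt by (simp add: linear_conv_bounded_linear)
qed

lemma frechet_derivative_conv:
  fixes f \<rho> :: "'a::euclidean_space \<Rightarrow> real"
  assumes f: "integrable lborel f" and \<rho>: "C_k (Suc 0) \<rho>" "\<forall>x. R < norm x \<longrightarrow> \<rho> x = 0"
  shows "frechet_derivative (conv f \<rho>) (at x) h = conv f (\<lambda>x. frechet_derivative \<rho> (at x) h) x"
  by (rule frechet_derivative_eqI) (rule conv_has_derivative[OF assms])

lemma C_k_conv:
  fixes f \<rho> :: "'a::euclidean_space \<Rightarrow> real"
  assumes f: "integrable lborel f" and "C_k k \<rho>" "\<forall>x. R < norm x \<longrightarrow> \<rho> x = 0"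
  shows "C_k k (conv f \<rho>)"
  using assms(2,3)
proof (induction k arbitrary: \<rho>)
  case 0
  then show ?case using conv_continuous[OF f, of \<rho> R] by auto
next
  case (Suc k)
  have c1: "C_k (Suc 0) \<rho>"
    using Suc.prems(1) by (auto dest: C_k_continuous)
  show ?case
  proof (rule C_k_SucI[OF conv_has_derivative[OF f c1 Suc.prems(2)]])
    fix b :: 'a assume b: "b \<in> Basis"
    have "C_k k (\<lambda>x. frechet_derivative \<rho> (at x) b)" using Suc.prems(1) b by auto
    from Suc.IH[OF this frechet_derivative_vanish[OF Suc.prems(2)]]
    show "C_k k (\<lambda>x. conv f (\<lambda>x. frechet_derivative \<rho> (at x) b) x)" by simp
  qed
qed

lemma flat_nonneg: "0 \<le> flat j t" by (simp add: flat_def)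

text \<open>A bump supported in the ball of radius \<open>\<epsilon>\<close> around zero. Being a function
  of \<open>x \<bullet> x\<close>, the bump is even.\<close>

definition mollifier :: "real \<Rightarrow> 'a::euclidean_space \<Rightarrow> real" where
  "mollifier \<epsilon> x = flat 0 (\<epsilon>\<^sup>2 - x \<bullet> x) / (\<integral>y. flat 0 (\<epsilon>\<^sup>2 - (y::'a) \<bullet> y) \<partial>lborel)"

lemma mollifier_C_k: "C_k k (mollifier \<epsilon>)"
  unfolding mollifier_def divide_inverse by (intro C_k_mult C_k_flat_ball C_k_const)

lemma mollifier_nonneg: "0 \<le> mollifier \<epsilon> x"
  by (auto simp: mollifier_def intro!: divide_nonneg_nonneg Bochner_Integration.integral_nonneg flat_nonneg)

lemma mollifier_even: "mollifier \<epsilon> (- x) = mollifier \<epsilon> x"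
  by (simp add: mollifier_def)

lemma flat_ball_vanish: "\<epsilon> \<ge> 0 \<Longrightarrow> \<epsilon> \<le> norm x \<Longrightarrow> flat j (\<epsilon>\<^sup>2 - x \<bullet> x) = 0"
  by (auto simp: flat_def dot_square_norm power_mono not_le dest!: power_strict_mono[of _ _ 2] power_mono[of _ _ 2])

lemma mollifier_vanish: "\<epsilon> > 0 \<Longrightarrow> \<epsilon> \<le> norm x \<Longrightarrow> mollifier \<epsilon> x = 0"
  by (simp add: mollifier_def flat_ball_vanish)

lemma mollifier_vanish': "\<epsilon> > 0 \<Longrightarrow> \<forall>x. \<epsilon> < norm x \<longrightarrow> mollifier \<epsilon> x = 0"
  by (auto intro: mollifier_vanish)

lemma mollifier_continuous: "continuous_on UNIV (mollifier \<epsilon>)"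
  using mollifier_C_k[of 0] by auto

lemma mollifier_measurable [measurable]: "mollifier \<epsilon> \<in> borel_measurable borel"
  by (rule borel_measurable_continuous_onI[OF mollifier_continuous])

lemma mollifier_integrable: "\<epsilon> > 0 \<Longrightarrow> integrable lborel (mollifier \<epsilon>)"
  by (rule vanish_integrable[OF mollifier_continuous mollifier_vanish'])

text \<open>The normalising integral is not zero: a nonnegative function with integral zero vanishes almost
  everywhere, but this one is positive on a ball.\<close>

lemma mollifier_integral:
  assumes "\<epsilon> > 0"
  shows "(\<integral>x. mollifier \<epsilon> (x::'a::euclidean_space) \<partial>lborel) = 1"
proof -
  let ?g = "\<lambda>y::'a. flat 0 (\<epsilon>\<^sup>2 - y \<bullet> y)"
  have c: "continuous_on UNIV ?g" using C_k_flat_ball[of 0] by simp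
  have int: "integrable lborel ?g"
    by (rule vanish_integrable[OF c, of \<epsilon>]) (use assms in \<open>auto intro: flat_ball_vanish\<close>)
  have "(\<integral>y. ?g y \<partial>lborel) \<noteq> 0"
  proof
    assume "(\<integral>y. ?g y \<partial>lborel) = 0"
    then have "AE y in lborel. ?g y = 0"
      using integral_nonneg_eq_0_iff_AE[OF int] flat_nonneg by auto
    then have "AE y in lborel. y \<notin> ball (0::'a) \<epsilon>"
    proof (rule AE_mp, intro AE_I2 impI)
      fix y :: 'a assume "?g y = 0"
      then show "y \<notin> ball 0 \<epsilon>"
        using assms power_strict_mono[of "norm y" \<epsilon> 2] by (auto simp: flat_def dot_square_norm split: if_splits)
    qed
    then have "ball (0::'a) \<epsilon> \<in> null_sets lborel"
      by (subst AE_iff_null_sets) auto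
    then have "negligible (ball (0::'a) \<epsilon>)"
      by (simp add: negligible_iff_null_sets null_sets_completionI)
    then show False using assms open_not_negligible[of "ball (0::'a) \<epsilon>"] by auto
  qed
  then show ?thesis unfolding mollifier_def by simp
qed

text \<open>Squeeze the set between a compact \<open>K\<close> and an open \<open>T\<close> of almost the same measure. A translation so
  short that \<open>K\<close> stays inside \<open>T\<close> changes the indicator only on \<open>T - K\<close> and on its translate.\<close>

lemma set_translation_continuous:
  fixes A :: "'a::euclidean_space set"
  assumes A: "A \<in> sets lborel" "emeasure lborel A < \<infinity>" and "e > 0"
  shows "\<exists>d>0. \<forall>h. norm h < d \<longrightarrow> (\<integral>x. \<bar>indicator A (x + h) - indicator A x\<bar> \<partial>lborel) \<le> (e::real)"
proof -
  have Ab: "A \<in> sets borel" using A by simp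
  \<comment> \<open>Inner regularity needs a finite measure, hence the restriction to \<open>A\<close>.\<close>
  define M where "M = density lborel (indicator A)"
  have M: "sets M = sets borel" "emeasure M (space M) \<noteq> \<infinity>" "emeasure M A = emeasure lborel A"
    using A by (auto simp: M_def emeasure_restricted)
  have eMK: "emeasure M K = emeasure lborel K" if "K \<subseteq> A" "compact K" for K
  proof -
    have "K \<in> sets borel" using that by (auto intro: borel_compact)
    then show ?thesis using that Ab by (simp add: M_def emeasure_restricted Int_absorb1)
  qed
  obtain T where T: "open T" "A \<subseteq> T" "emeasure lborel (T - A) < ennreal (e / 4)"
    using outer_regular_lborel[OF Ab, of "e / 4"] \<open>e > 0\<close> by auto
  have "\<exists>K. compact K \<and> K \<subseteq> A \<and> emeasure lborel A < emeasure lborel K + ennreal (e / 4)"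
  proof (cases "emeasure lborel A = 0")
    case True
    then show ?thesis using \<open>e > 0\<close> by (intro exI[of _ "{}"]) auto
  next
    case False
    have "emeasure lborel A - ennreal (e / 4) < emeasure lborel A"
      using False A \<open>e > 0\<close> by (intro ennreal_between) (auto simp: top.not_eq_extremum zero_less_iff_neq_zero)
    also have "emeasure lborel A = (SUP K \<in> {K. K \<subseteq> A \<and> compact K}. emeasure M K)"
      using inner_regular[OF M(1,2) Ab] M(3) by simp
    finally obtain K where K: "K \<subseteq> A" "compact K" "emeasure lborel A - ennreal (e / 4) < emeasure M K"
      by (auto simp: less_SUP_iff)
    have "emeasure lborel A < emeasure lborel K + ennreal (e / 4)"
    proof (rule ccontr)
      assume "\<not> ?thesis"
      then have "(emeasure lborel K + ennreal (e / 4)) - ennreal (e / 4) \<le> emeasure lborel A - ennreal (e / 4)"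
        by (intro ennreal_minus_mono) auto
      then show False using K(3) eMK[OF K(1,2)] by simp
    qed
    then show ?thesis using K by blast
  qed
  then obtain K where K: "compact K" "K \<subseteq> A" "emeasure lborel A < emeasure lborel K + ennreal (e / 4)"
    by blast
  have Kb: "K \<in> sets borel" using K by (auto intro: borel_compact)
  have fK: "emeasure lborel K < \<infinity>" using K A by (meson emeasure_mono le_less_trans)
  have "emeasure lborel (A - K) < ennreal (e / 4)"
  proof -
    have "emeasure lborel (A - K) = emeasure lborel A - emeasure lborel K"
      using Kb Ab K fK by (intro emeasure_Diff) auto
    also have "\<dots> < ennreal (e / 4)"
      using K(3) fK emeasure_mono[OF K(2) A(1)] by (subst minus_less_iff_ennreal) (auto simp: add.commute)
    finally show ?thesis .
  qed
  have "T - K = (T - A) \<union> (A - K)" using T K by auto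
  then have "emeasure lborel (T - K) \<le> emeasure lborel (T - A) + emeasure lborel (A - K)"
    using emeasure_subadditive[of "T - A" lborel "A - K"] T Ab Kb by auto
  also have "\<dots> \<le> ennreal (e / 4) + ennreal (e / 4)"
    using T(3) \<open>emeasure lborel (A - K) < ennreal (e / 4)\<close> by (intro add_mono) auto
  also have "\<dots> = ennreal (e / 2)" using \<open>e > 0\<close> by (simp flip: ennreal_plus)
  finally have eTK: "emeasure lborel (T - K) \<le> ennreal (e / 2)" .
  have sTK: "T - K \<in> sets borel" using T Kb by auto
  have intTK: "integrable lborel (indicator (T - K) :: 'a \<Rightarrow> real)"
    using sTK eTK by (intro integrable_real_indicator) (auto intro: le_less_trans)
  have mTK: "(\<integral>x. indicator (T - K) x \<partial>lborel) \<le> e / 2"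
  proof -
    have "(\<integral>x. indicator (T - K) x \<partial>lborel) = measure lborel (T - K)" using sTK by simp
    also have "\<dots> \<le> e / 2" unfolding measure_def
      using eTK \<open>e > 0\<close> by (metis enn2real_ennreal enn2real_mono ennreal_less_top half_gt_zero less_eq_real_def)
    finally show ?thesis .
  qed
  obtain d where d: "d > 0" "(\<Union>x\<in>K. ball x d) \<subseteq> T"
    using compact_subset_open_imp_ball_epsilon_subset[OF K(1) T(1)] K T by blast
  have "(\<integral>x. \<bar>indicator A (x + h) - indicator A x\<bar> \<partial>lborel) \<le> e" if h: "norm h < d" for h
  proof -
    let ?I = "indicator (T - K) :: 'a \<Rightarrow> real"
    have *: "\<bar>indicator A (x + h) - indicator A x\<bar> \<le> ?I (x + h) + ?I x" for x
    proof -
      have "x + h \<in> K \<Longrightarrow> x \<in> T" "x \<in> K \<Longrightarrow> x + h \<in> T"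
        using d(2) h by (force simp: dist_norm subset_iff)+
      then show ?thesis using T(2) K(2) by (auto simp: indicator_def)
    qed
    have "(\<integral>x. \<bar>indicator A (x + h) - indicator A x\<bar> \<partial>lborel) \<le> (\<integral>x. ?I (x + h) + ?I x \<partial>lborel)"
    proof (rule integral_le_integral[OF _ _ *])
      have "integrable lborel (indicator A :: 'a \<Rightarrow> real)" using A by (intro integrable_real_indicator) auto
      then show "integrable lborel (\<lambda>x. \<bar>indicator A (x + h) - indicator A x\<bar> :: real)"
        by (intro integrable_abs Bochner_Integration.integrable_diff integrable_lborel_shift)
      show "integrable lborel (\<lambda>x. ?I (x + h) + ?I x)"
        by (intro Bochner_Integration.integrable_add integrable_lborel_shift intTK)
    qed
    also have "\<dots> = (\<integral>x. ?I x \<partial>lborel) + (\<integral>x. ?I x \<partial>lborel)"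
      using integral_lborel_shift[of ?I h] sTK
      by (subst Bochner_Integration.integral_add) (auto intro: integrable_lborel_shift intTK)
    also have "\<dots> \<le> e" using mTK by simp
    finally show ?thesis .
  qed
  then show ?thesis using d(1) by blast
qed

text \<open>The property holds for indicators and is preserved by sums and by limits in \<open>L1\<close>.\<close>

lemma integrable_translation_continuous:
  fixes f :: "'a::euclidean_space \<Rightarrow> real"
  assumes "integrable lborel f"
  shows "\<forall>e>0. \<exists>d>0. \<forall>h. norm h < d \<longrightarrow> (\<integral>x. \<bar>f (x + h) - f x\<bar> \<partial>lborel) \<le> e"
  using assms
proof (induction rule: integrable_induct)
  case (base A c)
  show ?case
  proof (intro allI impI)
    fix e :: real assume "e > 0"
    then obtain d where d: "d > 0" "\<And>h. norm h < d \<Longrightarrow>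
        (\<integral>x. \<bar>indicator A (x + h) - indicator A x\<bar> \<partial>lborel) \<le> e / (\<bar>c\<bar> + 1)"
      using set_translation_continuous[OF base, of "e / (\<bar>c\<bar> + 1)"] by (auto simp: add_nonneg_pos)
    have "(\<integral>x. \<bar>indicator A (x + h) *\<^sub>R c - indicator A x *\<^sub>R c\<bar> \<partial>lborel) \<le> e" if "norm h < d" for h
    proof -
      have "(\<integral>x. \<bar>indicator A (x + h) *\<^sub>R c - indicator A x *\<^sub>R c\<bar> \<partial>lborel)
          = (\<integral>x. \<bar>indicator A (x + h) - indicator A x\<bar> * \<bar>c\<bar> \<partial>lborel)"
        by (simp add: left_diff_distrib[symmetric] abs_mult)
      also have "\<dots> \<le> e / (\<bar>c\<bar> + 1) * \<bar>c\<bar>"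
        using mult_right_mono[OF d(2)[OF that], of "\<bar>c\<bar>"] by simp
      also have "\<dots> \<le> e" using \<open>e > 0\<close> by (simp add: divide_simps mult_left_mono)
      finally show ?thesis .
    qed
    then show "\<exists>d>0. \<forall>h. norm h < d \<longrightarrow> (\<integral>x. \<bar>indicator A (x + h) *\<^sub>R c - indicator A x *\<^sub>R c\<bar> \<partial>lborel) \<le> e"
      using d(1) by blast
  qed
next
  case (add f g)
  show ?case
  proof (intro allI impI)
    fix e :: real assume "e > 0"
    then have "e / 2 > 0" by simp
    then obtain d1 d2 where d: "d1 > 0" "d2 > 0"
      "\<And>h. norm h < d1 \<Longrightarrow> (\<integral>x. \<bar>f (x + h) - f x\<bar> \<partial>lborel) \<le> e / 2"
      "\<And>h. norm h < d2 \<Longrightarrow> (\<integral>x. \<bar>g (x + h) - g x\<bar> \<partial>lborel) \<le> e / 2"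
      using add.IH by blast
    have "(\<integral>x. \<bar>f (x + h) + g (x + h) - (f x + g x)\<bar> \<partial>lborel) \<le> e" if "norm h < min d1 d2" for h
    proof -
      have "(\<integral>x. \<bar>f (x + h) + g (x + h) - (f x + g x)\<bar> \<partial>lborel)
          \<le> (\<integral>x. \<bar>f (x + h) - f x\<bar> + \<bar>g (x + h) - g x\<bar> \<partial>lborel)"
        using add.hyps by (intro integral_le_integral) (auto intro!: integrable_lborel_shift integrable_abs)
      also have "\<dots> = (\<integral>x. \<bar>f (x + h) - f x\<bar> \<partial>lborel) + (\<integral>x. \<bar>g (x + h) - g x\<bar> \<partial>lborel)"
        using add.hyps by (intro Bochner_Integration.integral_add) (auto intro!: integrable_lborel_shift integrable_abs)
      also have "\<dots> \<le> e" using d(3)[of h] d(4)[of h] that by simp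
      finally show ?thesis .
    qed
    then show "\<exists>d>0. \<forall>h. norm h < d \<longrightarrow> (\<integral>x. \<bar>f (x + h) + g (x + h) - (f x + g x)\<bar> \<partial>lborel) \<le> e"
      using d(1,2) by (intro exI[of _ "min d1 d2"]) auto
  qed
next
  case (lim f s)
  have conv: "(\<lambda>i. \<integral>x. \<bar>s i x - f x\<bar> \<partial>lborel) \<longlonglongrightarrow> (\<integral>x. 0 \<partial>(lborel :: 'a measure))"
  proof (rule integral_dominated_convergence[where w = "\<lambda>x. 3 * \<bar>f x\<bar>"])
    show "AE x in lborel. (\<lambda>i. \<bar>s i x - f x\<bar>) \<longlonglongrightarrow> 0"
    proof (rule AE_I2)
      fix x
      have "(\<lambda>i. s i x - f x) \<longlonglongrightarrow> f x - f x" using lim.hyps(2)[of x] by (intro tendsto_intros) auto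
      then show "(\<lambda>i. \<bar>s i x - f x\<bar>) \<longlonglongrightarrow> 0" by (simp add: tendsto_rabs_zero)
    qed
    show "AE x in lborel. norm \<bar>s i x - f x\<bar> \<le> 3 * \<bar>f x\<bar>" for i
    proof (rule AE_I2)
      fix x show "norm \<bar>s i x - f x\<bar> \<le> 3 * \<bar>f x\<bar>" using lim.hyps(3)[of x i] by simp
    qed
  qed (use lim.hyps in auto)
  show ?case
  proof (intro allI impI)
    fix e :: real assume "e > 0"
    then have "e / 3 > 0" by simp
    then have "eventually (\<lambda>i. (\<integral>x. \<bar>s i x - f x\<bar> \<partial>lborel) < e / 3) sequentially"
      using order_tendstoD(2)[OF conv, of "e / 3"] by simp
    then obtain i where i: "(\<integral>x. \<bar>s i x - f x\<bar> \<partial>lborel) < e / 3"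
      using eventually_happens'[OF sequentially_bot] by blast
    obtain d where d: "d > 0" "\<And>h. norm h < d \<Longrightarrow> (\<integral>x. \<bar>s i (x + h) - s i x\<bar> \<partial>lborel) \<le> e / 3"
      using lim.IH[of i] \<open>e / 3 > 0\<close> by blast
    have int: "integrable lborel (\<lambda>x. \<bar>s i x - f x\<bar>)" using lim.hyps by auto
    have "(\<integral>x. \<bar>f (x + h) - f x\<bar> \<partial>lborel) \<le> e" if "norm h < d" for h
    proof -
      have int2: "integrable lborel (\<lambda>x. \<bar>s i (x + h) - f (x + h)\<bar>)"
        using integrable_lborel_shift[OF int] by simp
      have int3: "integrable lborel (\<lambda>x. \<bar>s i (x + h) - s i x\<bar>)" "integrable lborel (\<lambda>x. \<bar>f (x + h) - f x\<bar>)"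
        using lim.hyps by (auto intro!: integrable_abs integrable_lborel_shift)
      have "(\<integral>x. \<bar>f (x + h) - f x\<bar> \<partial>lborel)
          \<le> (\<integral>x. (\<bar>s i (x + h) - f (x + h)\<bar> + \<bar>s i (x + h) - s i x\<bar>) + \<bar>s i x - f x\<bar> \<partial>lborel)"
        by (intro integral_le_integral Bochner_Integration.integrable_add int int2 int3) arith
      also have "\<dots> = (\<integral>x. \<bar>s i (x + h) - f (x + h)\<bar> \<partial>lborel) + (\<integral>x. \<bar>s i (x + h) - s i x\<bar> \<partial>lborel) + (\<integral>x. \<bar>s i x - f x\<bar> \<partial>lborel)"
        by (simp add: int int2 int3)
      also have "(\<integral>x. \<bar>s i (x + h) - f (x + h)\<bar> \<partial>lborel) = (\<integral>x. \<bar>s i x - f x\<bar> \<partial>lborel)"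
        using int by (intro integral_lborel_shift[of "\<lambda>x. \<bar>s i x - f x\<bar>"]) auto
      finally show ?thesis using i d(2)[OF that] by simp
    qed
    then show "\<exists>d>0. \<forall>h. norm h < d \<longrightarrow> (\<integral>x. \<bar>f (x + h) - f x\<bar> \<partial>lborel) \<le> e"
      using d(1) by blast
  qed
qed

lemma conv_commute:
  fixes f \<rho> :: "'a::euclidean_space \<Rightarrow> real"
  assumes [measurable]: "f \<in> borel_measurable borel" "\<rho> \<in> borel_measurable borel"
  shows "conv f \<rho> x = (\<integral>z. \<rho> z * f (x - z) \<partial>lborel)"
  using integral_lborel_reflect[of "\<lambda>z. \<rho> z * f (x - z)" x] by (simp add: conv_def mult.commute)

text \<open>The mollification is an average of translates by less than \<open>\<epsilon>\<close>, so by Tonelli its distance from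
  \<open>f\<close> is at most the largest distance of such a translate.\<close>

lemma mollification_L1:
  fixes f :: "'a::euclidean_space \<Rightarrow> real"
  assumes f: "integrable lborel f" and "\<epsilon> > 0" "e > 0"
    and close: "\<And>h. norm h < \<epsilon> \<Longrightarrow> (\<integral>x. \<bar>f (x + h) - f x\<bar> \<partial>lborel) \<le> e"
  shows "integrable lborel (conv f (mollifier \<epsilon>))"
    and "(\<integral>x. \<bar>conv f (mollifier \<epsilon>) x - f x\<bar> \<partial>lborel) \<le> e"
proof -
  let ?\<rho> = "mollifier \<epsilon> :: 'a \<Rightarrow> real"
  have mf[measurable]: "f \<in> borel_measurable borel" using f by auto
  have cc: "continuous_on UNIV (conv f ?\<rho>)"
    by (rule conv_continuous[OF f mollifier_continuous mollifier_vanish'[OF \<open>\<epsilon> > 0\<close>]])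
  have mc[measurable]: "conv f ?\<rho> \<in> borel_measurable borel" by (rule borel_measurable_continuous_onI[OF cc])
  have bound: "ennreal \<bar>conv f ?\<rho> x - f x\<bar> \<le> (\<integral>\<^sup>+z. ennreal (?\<rho> z) * ennreal \<bar>f (x - z) - f x\<bar> \<partial>lborel)" for x
  proof -
    have i1: "integrable lborel (\<lambda>z. ?\<rho> z * f (x - z))"
    proof -
      have "integrable lborel (\<lambda>z. f (z + x))" using f by (rule integrable_lborel_shift)
      then have "integrable (distr lborel borel (\<lambda>z. 0 - z)) (\<lambda>z. f (z + x))" by (simp only: lborel_eq_distr_reflect)
      then have "integrable lborel (\<lambda>z. f (x - z))"
        by (subst (asm) integrable_distr_eq) (auto simp: algebra_simps)
      from integrable_mult_vanish[OF this mollifier_continuous mollifier_vanish'[OF \<open>\<epsilon> > 0\<close>]]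
      show ?thesis by (simp add: mult.commute)
    qed
    have i2: "integrable lborel (\<lambda>z. ?\<rho> z * f x)"
      using mollifier_integrable[OF \<open>\<epsilon> > 0\<close>] by auto
    have eq: "conv f ?\<rho> x - f x = (\<integral>z. ?\<rho> z * (f (x - z) - f x) \<partial>lborel)"
    proof -
      have "(\<integral>z. ?\<rho> z * (f (x - z) - f x) \<partial>lborel) = (\<integral>z. ?\<rho> z * f (x - z) - ?\<rho> z * f x \<partial>lborel)"
        by (simp add: right_diff_distrib)
      also have "\<dots> = (\<integral>z. ?\<rho> z * f (x - z) \<partial>lborel) - (\<integral>z. ?\<rho> z * f x \<partial>lborel)"
        by (intro Bochner_Integration.integral_diff i1 i2)
      also have "\<dots> = conv f ?\<rho> x - f x"
        using mollifier_integral[OF \<open>\<epsilon> > 0\<close>, where 'a = 'a] by (simp add: conv_commute)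
      finally show ?thesis by simp
    qed
    have "integrable lborel (\<lambda>z. ?\<rho> z * (f (x - z) - f x))"
      using Bochner_Integration.integrable_diff[OF i1 i2] by (simp add: right_diff_distrib)
    from integral_norm_bound_ennreal[OF this] show ?thesis
      unfolding eq by (simp add: abs_mult mollifier_nonneg ennreal_mult')
  qed
  have "(\<integral>\<^sup>+x. ennreal \<bar>conv f ?\<rho> x - f x\<bar> \<partial>lborel)
      \<le> (\<integral>\<^sup>+x. (\<integral>\<^sup>+z. ennreal (?\<rho> z) * ennreal \<bar>f (x - z) - f x\<bar> \<partial>lborel) \<partial>lborel)"
    by (intro nn_integral_mono bound)
  also have "\<dots> = (\<integral>\<^sup>+z. (\<integral>\<^sup>+x. ennreal (?\<rho> z) * ennreal \<bar>f (x - z) - f x\<bar> \<partial>lborel) \<partial>lborel)"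
    by (rule lborel_pair.Fubini') measurable
  also have "\<dots> \<le> (\<integral>\<^sup>+z. ennreal (?\<rho> z) * ennreal e \<partial>lborel)"
  proof (rule nn_integral_mono)
    fix z :: 'a
    show "(\<integral>\<^sup>+x. ennreal (?\<rho> z) * ennreal \<bar>f (x - z) - f x\<bar> \<partial>lborel) \<le> ennreal (?\<rho> z) * ennreal e"
    proof (cases "norm z < \<epsilon>")
      case True
      have "integrable lborel (\<lambda>x. \<bar>f (x + - z) - f x\<bar>)"
        using f by (intro integrable_abs Bochner_Integration.integrable_diff integrable_lborel_shift)
      then have "(\<integral>\<^sup>+x. ennreal \<bar>f (x + - z) - f x\<bar> \<partial>lborel) = ennreal (\<integral>x. \<bar>f (x + - z) - f x\<bar> \<partial>lborel)"
        by (intro nn_integral_eq_integral) auto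
      also have "\<dots> \<le> ennreal e" using close[of "- z"] True by (intro ennreal_leI) simp
      finally show ?thesis by (simp add: nn_integral_cmult mult_left_mono)
    next
      case False
      then show ?thesis using mollifier_vanish[OF \<open>\<epsilon> > 0\<close>, of z] by simp
    qed
  qed
  also have "\<dots> = (\<integral>\<^sup>+z. ennreal (?\<rho> z) \<partial>lborel) * ennreal e"
    by (rule nn_integral_multc) measurable
  also have "(\<integral>\<^sup>+z. ennreal (?\<rho> z) \<partial>lborel) = 1"
    using nn_integral_eq_integral[OF mollifier_integrable[OF \<open>\<epsilon> > 0\<close>, where 'a = 'a]] mollifier_integral[OF \<open>\<epsilon> > 0\<close>, where 'a = 'a]
    by (simp add: mollifier_nonneg)
  finally have le: "(\<integral>\<^sup>+x. ennreal \<bar>conv f ?\<rho> x - f x\<bar> \<partial>lborel) \<le> ennreal e" by simp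
  have int: "integrable lborel (\<lambda>x. conv f ?\<rho> x - f x)"
    unfolding integrable_iff_bounded using le by (auto intro: le_less_trans)
  from Bochner_Integration.integrable_add[OF this f] show "integrable lborel (conv f ?\<rho>)" by simp
  have "(\<integral>\<^sup>+x. ennreal \<bar>conv f ?\<rho> x - f x\<bar> \<partial>lborel) = ennreal (\<integral>x. \<bar>conv f ?\<rho> x - f x\<bar> \<partial>lborel)"
    using int by (intro nn_integral_eq_integral) auto
  with le show "(\<integral>x. \<bar>conv f ?\<rho> x - f x\<bar> \<partial>lborel) \<le> e" using \<open>e > 0\<close> by simp
qed

section \<open>Test functions and the gradient of a mollified function\<close>

lemma integrable_product_bound:
  fixes F :: "'a::euclidean_space \<Rightarrow> 'b::euclidean_space \<Rightarrow> real"
  assumes [measurable]: "case_prod F \<in> borel_measurable (lborel \<Otimes>\<^sub>M lborel)"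
    and a: "integrable lborel a" and c: "integrable lborel c"
    and le: "\<And>x z. \<bar>F x z\<bar> \<le> \<bar>a x\<bar> * \<bar>c z\<bar>"
  shows "integrable (lborel \<Otimes>\<^sub>M lborel) (case_prod F)"
  unfolding integrable_iff_bounded
proof
  have [measurable]: "a \<in> borel_measurable borel" "c \<in> borel_measurable borel" using a c by auto
  have fin: "(\<integral>\<^sup>+x. ennreal \<bar>a x\<bar> \<partial>lborel) < \<infinity>" "(\<integral>\<^sup>+z. ennreal \<bar>c z\<bar> \<partial>lborel) < \<infinity>"
    using a c by (auto simp: integrable_iff_bounded)
  have "(\<integral>\<^sup>+p. ennreal (norm (case_prod F p)) \<partial>(lborel \<Otimes>\<^sub>M lborel)) = (\<integral>\<^sup>+x. (\<integral>\<^sup>+z. ennreal \<bar>F x z\<bar> \<partial>lborel) \<partial>lborel)"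
    by (subst lborel.nn_integral_fst[symmetric]) auto
  also have "\<dots> \<le> (\<integral>\<^sup>+x. (\<integral>\<^sup>+z. ennreal \<bar>a x\<bar> * ennreal \<bar>c z\<bar> \<partial>lborel) \<partial>lborel)"
    by (intro nn_integral_mono) (auto simp: ennreal_mult'[symmetric] intro!: ennreal_leI le)
  also have "\<dots> = (\<integral>\<^sup>+x. ennreal \<bar>a x\<bar> \<partial>lborel) * (\<integral>\<^sup>+z. ennreal \<bar>c z\<bar> \<partial>lborel)"
    by (simp add: nn_integral_cmult nn_integral_multc)
  also have "\<dots> < \<infinity>" using fin by (simp add: ennreal_mult_less_top)
  finally show "(\<integral>\<^sup>+p. ennreal (norm (case_prod F p)) \<partial>(lborel \<Otimes>\<^sub>M lborel)) < \<infinity>" .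
qed (use assms in auto)

lemma test_functionsI:
  assumes "\<And>k. C_k k v" "compact K" "K \<subseteq> U" "\<And>x. x \<notin> K \<Longrightarrow> v x = 0"
  shows "v \<in> test_functions U"
proof -
  have sub: "closure {x. v x \<noteq> 0} \<subseteq> K"
    using assms(2,4) by (intro closure_minimal) (auto intro: compact_imp_closed)
  then have "compact (closure {x. v x \<noteq> 0})"
    using assms(2) by (metis closed_closure compact_Int_closed inf.absorb_iff2)
  then show ?thesis using sub assms by (auto simp: test_functions_def)
qed

lemma test_functionsD:
  assumes "v \<in> test_functions U"
  shows "C_k k v" "\<exists>K. compact K \<and> K \<subseteq> U \<and> (\<forall>x. x \<notin> K \<longrightarrow> v x = 0)" "x \<notin> U \<Longrightarrow> v x = 0"
    "\<exists>R. \<forall>x. R < norm x \<longrightarrow> v x = 0"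
proof -
  show "C_k k v" using assms by (auto simp: test_functions_def)
  show K: "\<exists>K. compact K \<and> K \<subseteq> U \<and> (\<forall>x. x \<notin> K \<longrightarrow> v x = 0)"
    using assms closure_subset[of "{x. v x \<noteq> 0}"]
    by (intro exI[of _ "closure {x. v x \<noteq> 0}"]) (auto simp: test_functions_def)
  then obtain K where K: "compact K" "K \<subseteq> U" "\<forall>x. x \<notin> K \<longrightarrow> v x = 0" by blast
  then show "x \<notin> U \<Longrightarrow> v x = 0" by blast
  obtain R where "\<forall>x\<in>K. norm x \<le> R" using compact_imp_bounded[OF K(1)] by (auto simp: bounded_iff)
  then show "\<exists>R. \<forall>x. R < norm x \<longrightarrow> v x = 0" using K(3) by (intro exI[of _ R]) force
qed

lemma test_functions_deriv_vanish:
  assumes "v \<in> test_functions U" "x \<notin> U"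
  shows "frechet_derivative v (at x) h = 0"
proof -
  obtain K where K: "compact K" "K \<subseteq> U" "\<forall>x. x \<notin> K \<longrightarrow> v x = 0" using test_functionsD(2)[OF assms(1)] by blast
  show ?thesis
    by (rule frechet_derivative_eq_0_open[of "- K"]) (use K assms(2) compact_imp_closed in auto)
qed

text \<open>The support of the product lies in the compact support of \<open>v\<close> intersected with \<open>F\<close>; in this way a
  cutoff turns a test function of one open set into one of another.\<close>

lemma test_functions_mult:
  fixes v w :: "'a::euclidean_space \<Rightarrow> real"
  assumes "\<And>k. C_k k w" "v \<in> test_functions U" "closed F" "\<And>x. x \<notin> F \<Longrightarrow> w x = 0" "U \<inter> F \<subseteq> V"
  shows "(\<lambda>x. w x * v x) \<in> test_functions V"
proof -
  obtain K where K: "compact K" "K \<subseteq> U" "\<forall>x. x \<notin> K \<longrightarrow> v x = 0" using test_functionsD(2)[OF assms(2)] by blast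
  show ?thesis
    by (rule test_functionsI[of _ "K \<inter> F"])
       (use assms K test_functionsD(1)[OF assms(2)] in \<open>auto intro!: C_k_mult compact_Int_closed\<close>)
qed

lemma compact_neighbourhood:
  fixes K :: "'a::euclidean_space set"
  assumes "compact K"
  shows "compact (\<Union>z\<in>K. cball z \<epsilon>)"
proof -
  have "(\<Union>z\<in>K. cball z \<epsilon>) = {x + y |x y. x \<in> K \<and> y \<in> cball 0 \<epsilon>}"
  proof safe
    fix x z assume "z \<in> K" "x \<in> cball z \<epsilon>"
    then show "\<exists>a b. x = a + b \<and> a \<in> K \<and> b \<in> cball 0 \<epsilon>"
      by (intro exI[of _ z] exI[of _ "x - z"]) (auto simp: dist_norm norm_minus_commute)
  next
    fix x y :: 'a assume "x \<in> K" "y \<in> cball 0 \<epsilon>"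
    then show "x + y \<in> (\<Union>z\<in>K. cball z \<epsilon>)" by (intro UN_I[of x]) (auto simp: dist_norm)
  qed
  then show ?thesis using compact_sums[OF assms compact_cball[of 0 \<epsilon>]] by simp
qed

lemma conv_mollifier_test:
  fixes s :: "'a::euclidean_space \<Rightarrow> real"
  assumes s: "integrable lborel s" and K: "compact K" "\<And>x. x \<notin> K \<Longrightarrow> s x = 0"
    and \<epsilon>: "\<epsilon> > 0" "(\<Union>z\<in>K. cball z \<epsilon>) \<subseteq> V"
  shows "conv s (mollifier \<epsilon>) \<in> test_functions V"
proof (rule test_functionsI[OF C_k_conv[OF s mollifier_C_k mollifier_vanish'[OF \<epsilon>(1)]] compact_neighbourhood[OF K(1)] \<epsilon>(2)])
  fix x assume x: "x \<notin> (\<Union>z\<in>K. cball z \<epsilon>)"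
  have "s z * mollifier \<epsilon> (x - z) = 0" for z
  proof (cases "z \<in> K")
    case True
    then have "\<epsilon> \<le> norm (x - z)" using x by (force simp: dist_norm norm_minus_commute)
    then show ?thesis by (simp add: mollifier_vanish[OF \<epsilon>(1)])
  qed (use K in auto)
  then have "(\<lambda>z. s z * mollifier \<epsilon> (x - z)) = (\<lambda>z. 0)" by (rule ext)
  then show "conv s (mollifier \<epsilon>) x = 0" unfolding conv_def by (simp only: Bochner_Integration.integral_zero)
qed

lemma conv_mollifier_le_1:
  fixes s :: "'a::euclidean_space \<Rightarrow> real"
  assumes s: "integrable lborel s" "\<And>x. \<bar>s x\<bar> \<le> 1" and "\<epsilon> > 0"
  shows "\<bar>conv s (mollifier \<epsilon>) x\<bar> \<le> 1"
proof -
  have i: "integrable lborel (\<lambda>z. mollifier \<epsilon> (x - z))"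
  proof -
    have "integrable (distr lborel borel (\<lambda>z. x - z)) (mollifier \<epsilon>)"
      using mollifier_integrable[OF \<open>\<epsilon> > 0\<close>] by (simp add: lborel_eq_distr_reflect)
    then show ?thesis by (subst (asm) integrable_distr_eq) auto
  qed
  have "\<bar>conv s (mollifier \<epsilon>) x\<bar> \<le> (\<integral>z. \<bar>s z * mollifier \<epsilon> (x - z)\<bar> \<partial>lborel)"
    unfolding conv_def by (rule integral_abs_bound)
  also have "\<dots> \<le> (\<integral>z. mollifier \<epsilon> (x - z) \<partial>lborel)"
  proof (rule integral_le_integral)
    show "integrable lborel (\<lambda>z. \<bar>s z * mollifier \<epsilon> (x - z)\<bar>)"
      by (intro integrable_abs conv_integrable_integrand[OF s(1) mollifier_continuous mollifier_vanish'[OF \<open>\<epsilon> > 0\<close>]])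
    show "\<bar>s z * mollifier \<epsilon> (x - z)\<bar> \<le> mollifier \<epsilon> (x - z)" for z
      using s(2)[of z] mollifier_nonneg[of \<epsilon> "x - z"] by (simp add: abs_mult mult_left_le_one_le)
  qed (rule i)
  also have "\<dots> = 1" using integral_lborel_reflect[of "mollifier \<epsilon>" x] mollifier_integral[OF \<open>\<epsilon> > 0\<close>] by simp
  finally show ?thesis .
qed

text \<open>The derivative of an even kernel is odd, which produces the minus sign when convolution with the
  derivative is moved from one factor of an integral to the other.\<close>

lemma frechet_derivative_even:
  fixes f :: "'a::euclidean_space \<Rightarrow> real"
  assumes "\<And>x. f (- x) = f x" "\<And>x. f differentiable (at x)"
  shows "frechet_derivative f (at (- x)) h = - frechet_derivative f (at x) h"
proof -
  have "((\<lambda>x. f (- x)) has_derivative (\<lambda>h. frechet_derivative f (at (- x)) (- h))) (at x)"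
    by (rule has_derivative_compose[of uminus uminus x UNIV f])
       (use assms in \<open>auto intro!: derivative_eq_intros simp: frechet_derivative_works[symmetric]\<close>)
  then have "(f has_derivative (\<lambda>h. frechet_derivative f (at (- x)) (- h))) (at x)"
    using assms(1) by simp
  from frechet_derivative_eqI[OF this] have "frechet_derivative f (at x) h = frechet_derivative f (at (- x)) (- h)" .
  then show ?thesis using linear_neg[OF linear_frechet_derivative[OF assms(2)]] by simp
qed

lemma integral_lebesgue_lborel:
  fixes f :: "'a::euclidean_space \<Rightarrow> real"
  assumes "f \<in> borel_measurable borel"
  shows "(\<integral>x. f x \<partial>lebesgue) = (\<integral>x. f x \<partial>lborel)"
  using assms by (intro integral_completion) simp

text \<open>The integral of \<open>\<bar>\<nabla>f\<bar>\<close> is the integral of the derivative against its sign \<open>s\<close>, restricted to \<open>K\<close>. By Fubini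
  the convolution moves from \<open>f\<close> to \<open>s\<close>, and the mollified sign times the basis vector \<open>b\<close> is a
  smooth field of norm at most one with compact support in \<open>V\<close>.\<close>

lemma mollified_gradient_bound:
  fixes f :: "'a::euclidean_space \<Rightarrow> real"
  assumes f: "integrable lborel f" and K: "compact K" and \<epsilon>: "\<epsilon> > 0" "(\<Union>z\<in>K. cball z \<epsilon>) \<subseteq> V"
    and b: "b \<in> Basis"
  shows "ereal (\<integral>x. indicator K x * \<bar>frechet_derivative (conv f (mollifier \<epsilon>)) (at x) b\<bar> \<partial>lborel) \<le> variation f V"
proof -
  let ?\<rho> = "mollifier \<epsilon> :: 'a \<Rightarrow> real"
  define \<rho>' where "\<rho>' = (\<lambda>x. frechet_derivative ?\<rho> (at x) b)"
  have van: "\<forall>x. \<epsilon> < norm x \<longrightarrow> ?\<rho> x = 0" "\<forall>x. \<epsilon> < norm x \<longrightarrow> \<rho>' x = 0"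
    unfolding \<rho>'_def using mollifier_vanish'[OF \<epsilon>(1)] frechet_derivative_vanish[OF mollifier_vanish'[OF \<epsilon>(1)]] by blast+
  have c': "continuous_on UNIV \<rho>'"
    unfolding \<rho>'_def by (rule C_1_continuous_derivative[OF mollifier_C_k[of "Suc 0"]]) auto
  have [measurable]: "\<rho>' \<in> borel_measurable borel" "f \<in> borel_measurable borel"
    using c' f by (auto intro: borel_measurable_continuous_onI)
  obtain B where B: "B > 0" "\<And>x. norm (\<rho>' x) \<le> B"
    using vanish_bounded[OF c' van(2)] by blast
  have odd: "\<rho>' (- x) = - \<rho>' x" for x
    unfolding \<rho>'_def using mollifier_C_k[of "Suc 0" \<epsilon>] by (intro frechet_derivative_even mollifier_even) auto
  have D: "frechet_derivative (conv g ?\<rho>) (at x) b = conv g \<rho>' x" if "integrable lborel g" for g x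
    unfolding \<rho>'_def by (rule frechet_derivative_conv[OF that mollifier_C_k van(1)])
  have Kb[measurable]: "K \<in> sets borel" using K by (rule borel_compact)
  have cD: "continuous_on UNIV (conv f \<rho>')" by (rule conv_continuous[OF f c' van(2)])
  have [measurable]: "conv f \<rho>' \<in> borel_measurable borel" by (rule borel_measurable_continuous_onI[OF cD])
  define s where "s = (\<lambda>x. indicator K x * (if conv f \<rho>' x > 0 then 1 else if conv f \<rho>' x < 0 then -1 else (0::real)))"
  have [measurable]: "s \<in> borel_measurable borel" unfolding s_def by measurable
  have s1: "\<bar>s x\<bar> \<le> indicator K x" and s2: "s x * conv f \<rho>' x = indicator K x * \<bar>conv f \<rho>' x\<bar>" for x
    by (auto simp: s_def indicator_def)
  have s3: "\<bar>s x\<bar> \<le> 1" for x using s1[of x] by (cases "x \<in> K") auto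
  have s4: "s x = 0" if "x \<notin> K" for x using that by (simp add: s_def)
  have ints: "integrable lborel s"
    by (rule Bochner_Integration.integrable_bound[OF integrable_indicator_bounded[OF compact_imp_bounded[OF K] Kb]])
       (use s1 in \<open>auto intro!: AE_I2\<close>)
  \<comment> \<open>The admissible field; the minus sign is absorbed by the oddness of the derivative of the mollifier.\<close>
  define v where "v = (\<lambda>x. (- conv s ?\<rho> x) *\<^sub>R b)"
  have test: "conv s ?\<rho> \<in> test_functions V" by (rule conv_mollifier_test[OF ints K s4 \<epsilon>])
  have Cv: "C_k k v" for k
    unfolding v_def scaleR_minus_left
    by (intro C_k_bounded_linear[where f = "conv s ?\<rho>" and L = "\<lambda>t. - (t *\<^sub>R b)"]
        bounded_linear_minus bounded_linear_scaleR_left test_functionsD(1)[OF test])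
  obtain K' where K': "compact K'" "K' \<subseteq> V" "\<forall>x. x \<notin> K' \<longrightarrow> conv s ?\<rho> x = 0"
    using test_functionsD(2)[OF test] by blast
  have vtest: "v \<in> test_functions V"
    by (rule test_functionsI[OF Cv K'(1,2)]) (use K'(3) in \<open>auto simp: v_def\<close>)
  have vle: "norm (v x) \<le> 1" for x
    using conv_mollifier_le_1[OF ints s3 \<epsilon>(1)] b by (simp add: v_def)
  have div: "divergence v x = - conv s \<rho>' x" for x
  proof -
    have "(v has_derivative (\<lambda>h. (- frechet_derivative (conv s ?\<rho>) (at x) h) *\<^sub>R b)) (at x)"
      unfolding v_def using C_k_SucD(1)[OF test_functionsD(1)[OF test, of "Suc 0"]]
      by (auto intro!: derivative_eq_intros)
    then have "frechet_derivative v (at x) b' = (- frechet_derivative (conv s ?\<rho>) (at x) b') *\<^sub>R b" for b'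
      by (rule frechet_derivative_eqI)
    then have "divergence v x = (\<Sum>b'\<in>Basis. (- frechet_derivative (conv s ?\<rho>) (at x) b') * (b \<bullet> b'))"
      by (simp add: divergence_def)
    also have "\<dots> = (\<Sum>b'\<in>Basis. if b' = b then - frechet_derivative (conv s ?\<rho>) (at x) b else 0)"
      using b by (intro sum.cong) (auto simp: inner_Basis)
    also have "\<dots> = - frechet_derivative (conv s ?\<rho>) (at x) b" using b by simp
    finally show ?thesis using D[OF ints] by simp
  qed
  have "(\<integral>x. indicator K x * \<bar>frechet_derivative (conv f ?\<rho>) (at x) b\<bar> \<partial>lborel) = (\<integral>x. s x * conv f \<rho>' x \<partial>lborel)"
    by (simp add: D[OF f] s2)
  also have "\<dots> = (\<integral>x. (\<integral>z. s x * (f z * \<rho>' (x - z)) \<partial>lborel) \<partial>lborel)"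
    by (simp add: conv_def)
  also have "\<dots> = (\<integral>z. (\<integral>x. s x * (f z * \<rho>' (x - z)) \<partial>lborel) \<partial>lborel)"
  proof (rule lborel_pair.Fubini_integral[symmetric])
    show "integrable (lborel \<Otimes>\<^sub>M lborel) (\<lambda>(x, z). s x * (f z * \<rho>' (x - z)))"
    proof (rule integrable_product_bound[of _ s "\<lambda>z. B * f z"])
      show "\<bar>s x * (f z * \<rho>' (x - z))\<bar> \<le> \<bar>s x\<bar> * \<bar>B * f z\<bar>" for x z
      proof -
        have "\<bar>\<rho>' (x - z)\<bar> * \<bar>f z\<bar> \<le> B * \<bar>f z\<bar>" using B(2)[of "x - z"] by (intro mult_right_mono) auto
        then show ?thesis unfolding abs_mult using B(1) by (intro mult_left_mono) (auto simp: mult.commute)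
      qed
    qed (use ints f in auto)
  qed
  also have "\<dots> = (\<integral>z. f z * (- conv s \<rho>' z) \<partial>lborel)"
  proof (intro Bochner_Integration.integral_cong refl)
    fix z
    have "(\<integral>x. s x * (f z * \<rho>' (x - z)) \<partial>lborel) = (\<integral>x. (- f z) * (s x * \<rho>' (z - x)) \<partial>lborel)"
    proof (intro Bochner_Integration.integral_cong refl)
      fix x show "s x * (f z * \<rho>' (x - z)) = (- f z) * (s x * \<rho>' (z - x))" using odd[of "x - z"] by simp
    qed
    then show "(\<integral>x. s x * (f z * \<rho>' (x - z)) \<partial>lborel) = f z * (- conv s \<rho>' z)" by (simp add: conv_def)
  qed
  also have "\<dots> = (\<integral>z. f z * divergence v z \<partial>lborel)" by (simp add: div)
  also have "\<dots> = (LINT x:V|lebesgue. f x * divergence v x)"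
  proof -
    have "continuous_on UNIV (conv s \<rho>')" by (rule conv_continuous[OF ints c' van(2)])
    then have [measurable]: "divergence v \<in> borel_measurable borel"
      using borel_measurable_continuous_onI[of "conv s \<rho>'"] by (subst div[abs_def]) auto
    have "divergence v x = 0" if "x \<notin> V" for x
      unfolding divergence_def using test_functions_deriv_vanish[OF vtest that] by simp
    then have "(LINT x:V|lebesgue. f x * divergence v x) = (\<integral>x. f x * divergence v x \<partial>lebesgue)"
      unfolding set_lebesgue_integral_def by (intro Bochner_Integration.integral_cong) (auto simp: indicator_def)
    then show ?thesis by (simp add: integral_lebesgue_lborel)
  qed
  finally have "ereal (\<integral>x. indicator K x * \<bar>frechet_derivative (conv f ?\<rho>) (at x) b\<bar> \<partial>lborel)
      = ereal (LINT x:V|lebesgue. f x * divergence v x)" by simp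
  also have "\<dots> \<le> variation f V"
    unfolding variation_def by (intro SUP_upper) (use vtest vle in auto)
  finally show ?thesis .
qed

section \<open>Uniqueness of weak gradients\<close>

lemma C_k_shift:
  fixes f :: "'a::euclidean_space \<Rightarrow> 'b::real_normed_vector"
  assumes "C_k k f"
  shows "C_k k (\<lambda>x. f (x + c))"
  using assms
proof (induction k arbitrary: f)
  case 0
  then show ?case by (auto intro!: continuous_on_compose2[of UNIV f] continuous_intros)
next
  case (Suc k)
  show ?case
  proof (rule C_k_SucI[where D = "\<lambda>x. frechet_derivative f (at (x + c))"])
    show "((\<lambda>x. f (x + c)) has_derivative frechet_derivative f (at (x + c))) (at x)" for x
      by (rule has_derivative_compose[of "\<lambda>x. x + c" "\<lambda>h. h" x UNIV f, simplified])
         (use C_k_SucD(1)[OF Suc.prems] in \<open>auto intro!: derivative_eq_intros\<close>)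
    show "C_k k (\<lambda>x. frechet_derivative f (at (x + c)) b)" if "b \<in> Basis" for b
      using Suc.IH[OF C_k_SucD(2)[OF Suc.prems that]] .
  qed
qed

lemma borel_representative:
  fixes f :: "'a::euclidean_space \<Rightarrow> real"
  assumes "integrable lebesgue f"
  shows "\<exists>g. integrable lborel g \<and> (AE x in lebesgue. f x = g x)"
proof -
  obtain g where g: "g \<in> borel_measurable lborel" "AE x in lborel. f x = g x"
    using completion_ex_borel_measurable_real[of f lborel] assms by auto
  have ae: "AE x in lebesgue. f x = g x" using g(2) by (rule AE_completion)
  then have "integrable lebesgue g"
    using assms g(1) by (subst integrable_cong_AE[of g lebesgue f]) (auto simp: measurable_completion)
  then show ?thesis using ae g(1) by (auto simp: integrable_completion)
qed

text \<open>Translates of the mollifier are test functions, so the mollifications of \<open>g\<close> vanish on each compact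
  subset of \<open>U\<close> at small scale; they converge to \<open>g\<close> in \<open>L1\<close> there.\<close>

lemma weak_zero_imp_zero:
  fixes g :: "'a::euclidean_space \<Rightarrow> real"
  assumes U: "open U" and loc: "\<And>K. compact K \<Longrightarrow> K \<subseteq> U \<Longrightarrow> set_integrable lebesgue K g"
    and zero: "\<And>\<phi>. \<phi> \<in> test_functions U \<Longrightarrow> (LINT x:U|lebesgue. g x * \<phi> x) = 0"
  shows "AE x in lebesgue. x \<in> U \<longrightarrow> g x = 0"
proof -
  obtain C where C: "\<And>n. compact (C n)" "\<And>n. C n \<subseteq> U" "\<And>n. C n \<subseteq> interior (C (Suc n))" "\<Union>(range C) = U"
    using open_Union_compact_subsets[OF U] by metis
  have "AE x in lebesgue. x \<in> C n \<longrightarrow> g x = 0" for n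
  proof -
    define K where "K = C (Suc n)"
    have K: "compact K" "K \<subseteq> U" "C n \<subseteq> interior K" using C by (auto simp: K_def)
    have CK: "C n \<subseteq> K" using K(3) interior_subset by blast
    obtain d0 where d0: "d0 > 0" "(\<Union>x\<in>C n. ball x d0) \<subseteq> interior K"
      using compact_subset_open_imp_ball_epsilon_subset[OF C(1) open_interior K(3)] by blast
    have "integrable lebesgue (\<lambda>x. indicator K x * g x)"
      using loc[OF K(1,2)] by (simp add: set_integrable_def)
    then obtain G where G: "integrable lborel G" and GK: "AE x in lebesgue. indicator K x * g x = G x"
      using borel_representative by blast
    have [measurable]: "C n \<in> sets borel" "G \<in> borel_measurable borel"
      using C(1) G by (auto intro: borel_compact)
    have conv0: "conv G (mollifier \<epsilon>) x = 0" if x: "x \<in> C n" and \<epsilon>: "0 < \<epsilon>" "\<epsilon> < d0" for x \<epsilon>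
    proof -
      define \<phi> where "\<phi> = (\<lambda>z. mollifier \<epsilon> (z + - x))"
      have \<phi>: "mollifier \<epsilon> (x - z) = \<phi> z" for z
        using mollifier_even[of \<epsilon> "x - z"] by (simp add: \<phi>_def)
      have "cball x \<epsilon> \<subseteq> K" using x \<epsilon> d0(2) interior_subset[of K] by force
      have van: "\<phi> z = 0" if "z \<notin> cball x \<epsilon>" for z
        using that mollifier_vanish[OF \<epsilon>(1), of "z - x"] by (simp add: \<phi>_def dist_norm norm_minus_commute)
      have "C_k k \<phi>" for k unfolding \<phi>_def by (intro C_k_shift mollifier_C_k)
      then have "\<phi> \<in> test_functions U"
        by (rule test_functionsI[of _ "cball x \<epsilon>"])
           (use van \<open>cball x \<epsilon> \<subseteq> K\<close> K(2) in auto)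
      then have "0 = (LINT x:U|lebesgue. g x * \<phi> x)" using zero by simp
      also have "\<dots> = (\<integral>z. (indicator K z * g z) * \<phi> z \<partial>lebesgue)"
        unfolding set_lebesgue_integral_def
      proof (intro Bochner_Integration.integral_cong refl)
        fix z
        show "indicator U z *\<^sub>R (g z * \<phi> z) = indicator K z * g z * \<phi> z"
          using van[of z] \<open>cball x \<epsilon> \<subseteq> K\<close> K(2) by (cases "z \<in> cball x \<epsilon>") (auto simp: indicator_def)
      qed
      also have "\<dots> = (\<integral>z. G z * \<phi> z \<partial>lebesgue)"
      proof (rule integral_cong_AE)
        have [measurable]: "\<phi> \<in> borel_measurable borel" unfolding \<phi>_def by measurable
        then have m: "\<phi> \<in> borel_measurable lebesgue" by (intro measurable_completion) simp
        show "(\<lambda>z. indicator K z * g z * \<phi> z) \<in> borel_measurable lebesgue"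
          using loc[OF K(1,2)] m by (auto simp: set_integrable_def)
        show "(\<lambda>z. G z * \<phi> z) \<in> borel_measurable lebesgue"
          by (intro measurable_completion) simp
        show "AE z in lebesgue. indicator K z * g z * \<phi> z = G z * \<phi> z" using GK by auto
      qed
      also have "\<dots> = (\<integral>z. G z * \<phi> z \<partial>lborel)"
        by (rule integral_lebesgue_lborel) (simp add: \<phi>_def)
      finally show ?thesis by (simp add: conv_def \<phi>)
    qed
    have iG: "integrable lborel (\<lambda>x. indicator (C n) x * \<bar>G x\<bar>)"
      by (rule Bochner_Integration.integrable_bound[OF G]) (auto simp: indicator_def)
    have "(\<integral>x. indicator (C n) x * \<bar>G x\<bar> \<partial>lborel) \<le> 0"
    proof (rule field_le_epsilon)
      fix e :: real assume "e > 0"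
      then obtain d where d: "d > 0" "\<And>h. norm h < d \<Longrightarrow> (\<integral>x. \<bar>G (x + h) - G x\<bar> \<partial>lborel) \<le> e"
        using integrable_translation_continuous[OF G] by blast
      define \<epsilon> where "\<epsilon> = min d d0 / 2"
      have \<epsilon>: "0 < \<epsilon>" "\<epsilon> < d" "\<epsilon> < d0" using d(1) d0(1) by (auto simp: \<epsilon>_def)
      note m = mollification_L1[OF G \<epsilon>(1) \<open>e > 0\<close> d(2)]
      have "(\<integral>x. indicator (C n) x * \<bar>G x\<bar> \<partial>lborel) \<le> (\<integral>x. \<bar>conv G (mollifier \<epsilon>) x - G x\<bar> \<partial>lborel)"
        using m(1) \<epsilon> G conv0[OF _ \<epsilon>(1,3)] by (intro integral_le_integral iG) (auto simp: indicator_def)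
      also have "\<dots> \<le> e" using m(2) \<epsilon>(2) by simp
      finally show "(\<integral>x. indicator (C n) x * \<bar>G x\<bar> \<partial>lborel) \<le> 0 + e" by simp
    qed
    then have "(\<integral>x. indicator (C n) x * \<bar>G x\<bar> \<partial>lborel) = 0"
      by (intro antisym Bochner_Integration.integral_nonneg) auto
    then have "AE x in lborel. indicator (C n) x * \<bar>G x\<bar> = 0"
      using integral_nonneg_eq_0_iff_AE[OF iG] by auto
    then have "AE x in lebesgue. indicator (C n) x * \<bar>G x\<bar> = 0" by (rule AE_completion)
    with GK show ?thesis
    proof eventually_elim
      case (elim x)
      show ?case
      proof
        assume "x \<in> C n"
        then have "x \<in> K" using CK by blast
        with elim \<open>x \<in> C n\<close> show "g x = 0" by simp
      qed
    qed
  qed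
  then have "AE x in lebesgue. \<forall>n. x \<in> C n \<longrightarrow> g x = 0" unfolding AE_all_countable by blast
  then show ?thesis by eventually_elim (use C(4) in blast)
qed

lemma L1_loc_mult_test:
  fixes g \<phi> :: "'a::euclidean_space \<Rightarrow> real"
  assumes "g \<in> L1_loc U" "continuous_on UNIV \<phi>" "compact K" "K \<subseteq> U" "\<And>x. x \<notin> K \<Longrightarrow> \<phi> x = 0"
  shows "set_integrable lebesgue U (\<lambda>x. g x * \<phi> x)"
proof -
  have g: "integrable lebesgue (\<lambda>x. indicator K x * g x)"
    using assms by (simp add: L1_loc_def set_integrable_def)
  have "compact (\<phi> ` K)" using assms by (intro compact_continuous_image) (auto intro: continuous_on_subset)
  then obtain B where B: "\<forall>y\<in>\<phi> ` K. norm y \<le> B" using compact_imp_bounded bounded_iff by metis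
  have m: "\<phi> \<in> borel_measurable lebesgue"
    using assms(2) by (intro measurable_completion) (simp add: borel_measurable_continuous_onI)
  have "integrable lebesgue (\<lambda>x. (indicator K x * g x) * \<phi> x)"
  proof (rule Bochner_Integration.integrable_bound[of _ "\<lambda>x. B * (indicator K x * g x)"])
    show "AE x in lebesgue. norm ((indicator K x * g x) * \<phi> x) \<le> norm (B * (indicator K x * g x))"
    proof (rule AE_I2)
      fix x
      show "norm ((indicator K x * g x) * \<phi> x) \<le> norm (B * (indicator K x * g x))"
      proof (cases "x \<in> K")
        case True
        then have "\<bar>\<phi> x\<bar> \<le> \<bar>B\<bar>" using B by force
        then show ?thesis using True by (simp add: abs_mult mult.commute mult_right_mono)
      qed simp
    qed
  qed (use g m in auto)
  moreover have "(\<lambda>x. (indicator K x * g x) * \<phi> x) = (\<lambda>x. indicator U x *\<^sub>R (g x * \<phi> x))"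
    using assms(4,5) by (auto simp: fun_eq_iff indicator_def)
  ultimately show ?thesis by (simp add: set_integrable_def)
qed

lemma L1_loc_inner:
  assumes "g \<in> L1_loc U"
  shows "(\<lambda>x. g x \<bullet> b) \<in> L1_loc U"
  using assms integrable_inner_left[where c = b and M = lebesgue]
  by (auto simp: L1_loc_def set_integrable_def simp flip: inner_scaleR_left)

text \<open>Hence a weak gradient selected by choice has the same integrability and the same norm as any
  other one.\<close>

lemma weak_gradient_unique:
  assumes U: "open U" and g: "has_weak_gradient U u g" and h: "has_weak_gradient U u h"
  shows "AE x in lebesgue. x \<in> U \<longrightarrow> g x = h x"
proof -
  have loc: "(\<lambda>x. g x \<bullet> b) \<in> L1_loc U" "(\<lambda>x. h x \<bullet> b) \<in> L1_loc U" for b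
    using g h by (auto simp: has_weak_gradient_def intro: L1_loc_inner)
  have "AE x in lebesgue. x \<in> U \<longrightarrow> g x \<bullet> b - h x \<bullet> b = 0" if b: "b \<in> Basis" for b
  proof (rule weak_zero_imp_zero[OF U])
    show "set_integrable lebesgue K (\<lambda>x. g x \<bullet> b - h x \<bullet> b)" if "compact K" "K \<subseteq> U" for K
      using loc[of b] that by (intro set_integral_diff) (auto simp: L1_loc_def)
    fix \<phi> :: "'a \<Rightarrow> real" assume \<phi>: "\<phi> \<in> test_functions U"
    obtain K where K: "compact K" "K \<subseteq> U" "\<forall>x. x \<notin> K \<longrightarrow> \<phi> x = 0" using test_functionsD(2)[OF \<phi>] by blast
    have c: "continuous_on UNIV \<phi>" using test_functionsD(1)[OF \<phi>, of 0] by simp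
    have "(LINT x:U|lebesgue. (g x \<bullet> b) * \<phi> x - (h x \<bullet> b) * \<phi> x)
        = (LINT x:U|lebesgue. (g x \<bullet> b) * \<phi> x) - (LINT x:U|lebesgue. (h x \<bullet> b) * \<phi> x)"
      by (intro set_integral_diff(2) L1_loc_mult_test[OF _ c K(1,2)] loc) (use K(3) in auto)
    also have "\<dots> = 0"
    proof -
      have "(LINT x:U|lebesgue. u x * frechet_derivative \<phi> (at x) b) = - (LINT x:U|lebesgue. (g x \<bullet> b) * \<phi> x)"
        "(LINT x:U|lebesgue. u x * frechet_derivative \<phi> (at x) b) = - (LINT x:U|lebesgue. (h x \<bullet> b) * \<phi> x)"
        using g h \<phi> b unfolding has_weak_gradient_def by blast+
      then show ?thesis by linarith
    qed
    finally show "(LINT x:U|lebesgue. (g x \<bullet> b - h x \<bullet> b) * \<phi> x) = 0" by (simp add: left_diff_distrib)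
  qed
  then have "AE x in lebesgue. \<forall>b\<in>Basis. x \<in> U \<longrightarrow> g x \<bullet> b - h x \<bullet> b = 0"
    by (intro AE_finite_allI) auto
  then show ?thesis by eventually_elim (auto intro: euclidean_eqI)
qed

section \<open>Scale functions of an open set\<close>

text \<open>Explicit bounds for the function and its derivative, needed for the Lipschitz constant of the
  scale function.\<close>

lemma flat_le: "flat 0 t \<le> 1" "flat (Suc (Suc 0)) t \<le> 2"
proof -
  show "flat 0 t \<le> 1" by (auto simp: flat_def divide_simps)
  show "flat (Suc (Suc 0)) t \<le> 2"
  proof (cases "t > 0")
    case True
    define s where "s = 1 / t"
    have s: "s > 0" using True by (simp add: s_def)
    have "s\<^sup>2 / 2 \<le> exp s" using exp_lower_Taylor_quadratic[of s] s by simp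
    then have "exp (- s) * s\<^sup>2 \<le> 2" by (simp add: exp_minus divide_simps)
    then show ?thesis using True by (simp add: flat_def s_def power2_eq_square divide_simps)
  qed (simp add: flat_def)
qed

lemma open_countable_Union_balls:
  fixes U :: "'a::euclidean_space set"
  assumes "open U"
  shows "\<exists>(a :: nat \<Rightarrow> 'a) s. (\<forall>n. 0 \<le> s n \<and> s n \<le> 1) \<and> U = (\<Union>n. ball (a n) (s n))"
proof -
  define F where "F = {ball a s |a s. 0 \<le> s \<and> s \<le> 1 \<and> ball a s \<subseteq> U}"
  have "\<Union>F = U"
  proof
    show "U \<subseteq> \<Union>F"
    proof
      fix x assume "x \<in> U"
      then obtain e where e: "e > 0" "ball x e \<subseteq> U" using assms openE by blast
      have "ball x (min e 1) \<in> F"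
        unfolding F_def using e by (intro CollectI exI[of _ x] exI[of _ "min e 1"]) auto
      moreover have "x \<in> ball x (min e 1)" using e by simp
      ultimately show "x \<in> \<Union>F" by blast
    qed
  qed (auto simp: F_def)
  moreover obtain F' where F': "F' \<subseteq> F" "countable F'" "\<Union>F' = \<Union>F"
    by (rule Lindelof[of F]) (auto simp: F_def)
  \<comment> \<open>The empty set is a ball of radius zero; adding it allows an enumeration even if \<open>U\<close> is empty.\<close>
  define E where "E = insert {} F'"
  have "{} \<in> F" unfolding F_def by (intro CollectI exI[of _ 0]) simp
  have E: "E \<subseteq> F" "countable E" "E \<noteq> {}" "\<Union>E = \<Union>F" using F' \<open>{} \<in> F\<close> by (auto simp: E_def)
  have "from_nat_into E n \<in> F" for n using from_nat_into[OF E(3)] E(1) by blast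
  then have "\<forall>n. \<exists>p. from_nat_into E n = ball (fst p) (snd p) \<and> 0 \<le> snd p \<and> snd p \<le> 1"
    unfolding F_def by (simp add: split_paired_Ex) blast
  from choice[OF this] obtain p where p: "\<And>n. from_nat_into E n = ball (fst (p n)) (snd (p n))"
    "\<And>n. 0 \<le> snd (p n)" "\<And>n. snd (p n) \<le> (1::real)"
    by blast
  have "U = (\<Union>n. from_nat_into E n)" using range_from_nat_into[OF E(3,2)] E(4) \<open>\<Union>F = U\<close> by simp
  then show ?thesis using p by (intro exI[of _ "\<lambda>n. fst (p n)"] exI[of _ "\<lambda>n. snd (p n)"]) auto
qed

text \<open>Cover \<open>U\<close> by countably many balls of radius at most one and add bumps on these balls with
  weights \<open>(1 / 2) ^ n / 16\<close>. A bump has gradient at most 4 and the weights have sum 1/8, which gives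
  the bound 1/2 for the gradient of the sum.\<close>

lemma exists_scale_function:
  fixes U :: "'a::euclidean_space set"
  assumes "open U"
  shows "\<exists>r Dr. (\<forall>x. (r has_derivative (\<lambda>h. Dr x \<bullet> h)) (at x)) \<and> continuous_on UNIV Dr \<and>
     (\<forall>x. norm (Dr x) \<le> 1 / 2) \<and> (\<forall>x. 0 \<le> r x \<and> r x \<le> (1::real)) \<and> (\<forall>x. 0 < r x \<longleftrightarrow> x \<in> U)"
proof -
  obtain a :: "nat \<Rightarrow> 'a" and s where as: "\<And>n. 0 \<le> s n" "\<And>n. s n \<le> 1" "U = (\<Union>n. ball (a n) (s n))"
    using open_countable_Union_balls[OF assms] by blast
  define t where "t = (\<lambda>n x. (s n)\<^sup>2 - (x - a n) \<bullet> (x - a n))"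
  define w where "w = (\<lambda>n::nat. (1 / 2) ^ n / 16 :: real)"
  define f where "f = (\<lambda>n x. w n * flat 0 (t n x))"
  define D where "D = (\<lambda>n x. (w n * flat (Suc (Suc 0)) (t n x)) *\<^sub>R (- 2 *\<^sub>R (x - a n)))"
  have wpos: "w n > 0" for n by (simp add: w_def)
  have wsum: "summable w" unfolding w_def by (intro summable_divide summable_geometric) simp
  have wval: "suminf w = 1 / 8"
    unfolding w_def by (subst suminf_divide) (auto simp: suminf_geometric intro!: summable_geometric)
  have tpos: "t n x > 0 \<longleftrightarrow> x \<in> ball (a n) (s n)" for n x
    using as(1)[of n] by (auto simp: t_def dot_square_norm dist_norm norm_minus_commute abs_le_square_iff[symmetric] not_less[symmetric] simp flip: abs_less_iff)
       (smt (verit) norm_ge_zero power2_le_imp_le power_mono)+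
  have fder: "(f n has_derivative (\<lambda>h. D n x \<bullet> h)) (at x)" for n x
  proof -
    have "(t n has_derivative (\<lambda>h. - 2 * ((x - a n) \<bullet> h))) (at x)"
      unfolding t_def by (auto intro!: derivative_eq_intros simp: inner_commute inner_diff_right)
    from has_derivative_compose[OF this flat_DERIV[of 0, unfolded has_field_derivative_def]]
    have "((\<lambda>x. flat 0 (t n x)) has_derivative (\<lambda>h. flat (Suc (Suc 0)) (t n x) * (- 2 * ((x - a n) \<bullet> h)))) (at x)"
      by simp
    from has_derivative_mult_right[OF this, of "w n"] show ?thesis
      unfolding f_def D_def by (simp add: mult.assoc inner_diff_left algebra_simps)
  qed
  have Dle: "norm (D n x) \<le> 4 * w n" for n x
  proof (cases "x \<in> ball (a n) (s n)")
    case True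
    then have "norm (x - a n) \<le> 1" using as(2)[of n] by (simp add: dist_norm norm_minus_commute)
    have "norm (D n x) = w n * flat (Suc (Suc 0)) (t n x) * (2 * norm (x - a n))"
      using wpos[of n] flat_nonneg[of "Suc (Suc 0)" "t n x"] by (simp add: D_def)
    also have "\<dots> \<le> w n * 2 * (2 * 1)"
      using wpos[of n] flat_nonneg[of "Suc (Suc 0)" "t n x"] flat_le(2) \<open>norm (x - a n) \<le> 1\<close>
      by (intro mult_mono) auto
    finally show ?thesis by simp
  next
    case False
    then have "t n x \<le> 0" using tpos[of n x] by simp
    then show ?thesis using wpos[of n] by (simp add: D_def flat_def)
  qed
  have fle: "0 \<le> f n x" "f n x \<le> w n" for n x
    using wpos[of n] flat_nonneg[of 0 "t n x"] flat_le(1)[of "t n x"] by (auto simp: f_def mult_left_le)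
  have fsum: "summable (\<lambda>n. f n x)" for x
    by (rule summable_comparison_test'[OF wsum, of 0]) (use fle in auto)
  define r where "r = (\<lambda>x. \<Sum>n. f n x)"
  define Dr where "Dr = (\<lambda>x. \<Sum>n. D n x)"
  have w4: "summable (\<lambda>n. 4 * w n)" using wsum by (rule summable_mult)
  have ul: "uniform_limit UNIV (\<lambda>n x. \<Sum>i<n. D i x) Dr sequentially"
    unfolding Dr_def by (rule Weierstrass_m_test[OF _ w4]) (use Dle in auto)
  have rder: "(r has_derivative (\<lambda>h. Dr x \<bullet> h)) (at x)" for x
  proof -
    have "\<exists>g. \<forall>x\<in>UNIV. (\<lambda>n. f n x) sums g x \<and> (g has_derivative (\<lambda>h. Dr x \<bullet> h)) (at x within UNIV)"
    proof (rule has_derivative_series[where f' = "\<lambda>n x h. D n x \<bullet> h"])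
      fix e :: real assume "e > 0"
      have "\<forall>\<^sub>F n in sequentially. \<forall>x\<in>UNIV. dist (\<Sum>i<n. D i x) (Dr x) < e"
        using ul \<open>e > 0\<close> by (auto simp: uniform_limit_iff)
      then show "\<forall>\<^sub>F n in sequentially. \<forall>x\<in>UNIV. \<forall>h. norm ((\<Sum>i<n. D i x \<bullet> h) - Dr x \<bullet> h) \<le> e * norm h"
      proof eventually_elim
        case (elim n)
        show ?case
        proof (intro ballI allI)
          fix x h
          have "norm ((\<Sum>i<n. D i x \<bullet> h) - Dr x \<bullet> h) = \<bar>((\<Sum>i<n. D i x) - Dr x) \<bullet> h\<bar>"
            by (simp add: inner_diff_left inner_sum_left)
          also have "\<dots> \<le> norm ((\<Sum>i<n. D i x) - Dr x) * norm h" by (rule Cauchy_Schwarz_ineq2)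
          also have "\<dots> \<le> e * norm h" using elim by (intro mult_right_mono) (auto simp: dist_norm less_imp_le)
          finally show "norm ((\<Sum>i<n. D i x \<bullet> h) - Dr x \<bullet> h) \<le> e * norm h" .
        qed
      qed
    qed (use fder summable_sums[OF fsum] in auto)
    then obtain g where g: "\<And>x. (\<lambda>n. f n x) sums g x" "\<And>x. (g has_derivative (\<lambda>h. Dr x \<bullet> h)) (at x)" by auto
    have "g = r" unfolding r_def using g(1) sums_unique by blast
    then show ?thesis using g(2) by simp
  qed
  have cont: "continuous_on UNIV Dr"
  proof (rule uniform_limit_theorem[OF _ ul])
    have cflat: "continuous_on UNIV (flat (Suc (Suc 0)))"
      using flat_DERIV by (auto intro!: continuous_at_imp_continuous_on DERIV_isCont)
    have "continuous_on UNIV (D i)" for i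
      unfolding D_def t_def by (intro continuous_intros continuous_on_compose2[OF cflat]) auto
    then show "\<forall>\<^sub>F n in sequentially. continuous_on UNIV (\<lambda>x. \<Sum>i<n. D i x)"
      by (intro always_eventually allI continuous_on_sum) auto
  qed simp
  have Drle: "norm (Dr x) \<le> 1 / 2" for x
  proof -
    have "norm (Dr x) \<le> (\<Sum>n. 4 * w n)"
      unfolding Dr_def by (rule norm_suminf_le[OF _ w4]) (use Dle in auto)
    also have "\<dots> = 1 / 2" using suminf_mult[OF wsum, of 4] wval by simp
    finally show ?thesis .
  qed
  have rle: "0 \<le> r x" "r x \<le> 1" for x
  proof -
    show "0 \<le> r x" unfolding r_def by (rule suminf_nonneg[OF fsum fle(1)])
    have "r x \<le> suminf w" unfolding r_def by (rule suminf_le[OF fle(2) fsum wsum])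
    then show "r x \<le> 1" using wval by simp
  qed
  have rpos: "0 < r x \<longleftrightarrow> x \<in> U" for x
  proof -
    have fp: "0 < f n x \<longleftrightarrow> x \<in> ball (a n) (s n)" for n
      using wpos[of n] tpos[of n x] by (auto simp: f_def flat_def zero_less_mult_iff)
    have "0 < r x \<longleftrightarrow> (\<exists>n. 0 < f n x)" unfolding r_def by (rule suminf_pos_iff[OF fsum fle(1)])
    then show ?thesis using fp as(3) by auto
  qed
  show ?thesis using rder cont Drle rle rpos by blast
qed

section \<open>Averages at variable scale\<close>

lemma continuous_on_frechet_derivative:
  fixes f :: "'a::euclidean_space \<Rightarrow> 'b::real_normed_vector"
  assumes "C_k (Suc 0) f" "continuous_on S g" "continuous_on S h"
  shows "continuous_on S (\<lambda>p. frechet_derivative f (at (g p)) (h p))"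
proof -
  have "continuous_on S (\<lambda>p. \<Sum>b\<in>Basis. (h p \<bullet> b) *\<^sub>R frechet_derivative f (at (g p)) b)"
  proof (intro continuous_intros assms)
    fix b :: 'a assume "b \<in> Basis"
    then have "continuous_on UNIV (\<lambda>x. frechet_derivative f (at x) b)" using assms(1) by auto
    from continuous_on_compose2[OF this assms(2)]
    show "continuous_on S (\<lambda>p. frechet_derivative f (at (g p)) b)" by auto
  qed
  then show ?thesis
    using assms(1) by (simp add: frechet_derivative_expand[symmetric])
qed

lemma frechet_derivative_bound:
  fixes f :: "'a::euclidean_space \<Rightarrow> real"
  assumes "f differentiable (at x)"
  shows "\<bar>frechet_derivative f (at x) v\<bar> \<le> norm v * (\<Sum>e\<in>Basis. \<bar>frechet_derivative f (at x) e\<bar>)"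
proof -
  have "\<bar>frechet_derivative f (at x) v\<bar> = \<bar>\<Sum>e\<in>Basis. (v \<bullet> e) * frechet_derivative f (at x) e\<bar>"
    using frechet_derivative_expand[OF assms, of v] by simp
  also have "\<dots> \<le> (\<Sum>e\<in>Basis. \<bar>(v \<bullet> e) * frechet_derivative f (at x) e\<bar>)" by (rule sum_abs)
  also have "\<dots> \<le> (\<Sum>e\<in>Basis. norm v * \<bar>frechet_derivative f (at x) e\<bar>)"
    unfolding abs_mult using Basis_le_norm by (intro sum_mono mult_right_mono) auto
  finally show ?thesis by (simp add: sum_distrib_left)
qed

lemma C_k_inner: "C_k k (\<lambda>x::'a::euclidean_space. x \<bullet> e)"
proof (cases k)
  case (Suc k')
  show ?thesis unfolding Suc
    by (rule C_k_SucI[where D = "\<lambda>x h. h \<bullet> e"]) (auto intro!: derivative_eq_intros C_k_const)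
qed (auto intro: continuous_intros)

lemma vanish_integrable_prod:
  fixes F :: "'a::euclidean_space \<times> 'a \<Rightarrow> real"
  assumes "continuous_on UNIV F" "\<And>x y. R < norm x \<or> R < norm y \<Longrightarrow> F (x, y) = 0"
  shows "integrable (lborel \<Otimes>\<^sub>M lborel) F"
proof -
  have "F p = 0" if "2 * R < norm p" for p
  proof (cases p)
    case (Pair x y)
    have "norm p \<le> norm x + norm y" unfolding Pair by (rule norm_Pair_le)
    then have "R < norm x \<or> R < norm y" using that by linarith
    then show ?thesis using assms(2) Pair by simp
  qed
  then show ?thesis unfolding lborel_prod by (intro vanish_integrable[OF assms(1), of "2 * R"]) auto
qed

lemma cball_borel [measurable]: "cball (a::'a::euclidean_space) s \<in> sets borel"
  by simp

text \<open>A local radius for averaging. The bound 1/2 keeps radii at points within one radius of each other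
  comparable, and the bound 1 keeps averages over a compact set inside a compact set.\<close>

locale scale_function =
  fixes U :: "'a::euclidean_space set" and r :: "'a \<Rightarrow> real" and Dr :: "'a \<Rightarrow> 'a"
  assumes r_deriv: "\<And>x. (r has_derivative (\<lambda>h. Dr x \<bullet> h)) (at x)"
    and Dr_cont: "continuous_on UNIV Dr"
    and Dr_le: "\<And>x. norm (Dr x) \<le> 1 / 2"
    and r_nonneg: "\<And>x. 0 \<le> r x" and r_le_1: "\<And>x. r x \<le> 1"
    and r_pos: "\<And>x. 0 < r x \<longleftrightarrow> x \<in> U"
begin

lemma r_cont: "continuous_on UNIV r"
  using r_deriv by (intro continuous_at_imp_continuous_on ballI has_derivative_continuous)

lemma r_measurable [measurable]: "r \<in> borel_measurable borel"
  by (rule borel_measurable_continuous_onI[OF r_cont])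

lemma r_lipschitz: "\<bar>r x - r y\<bar> \<le> norm (x - y) / 2"
proof -
  have "norm (r x - r y) \<le> 1 / 2 * norm (x - y)"
  proof (rule differentiable_bound[where S = UNIV and f' = "\<lambda>x h. Dr x \<bullet> h"])
    fix x show "onorm (\<lambda>h. Dr x \<bullet> h) \<le> 1 / 2"
    proof (rule onorm_le)
      fix h
      have "norm (Dr x \<bullet> h) \<le> norm (Dr x) * norm h" using Cauchy_Schwarz_ineq2 by simp
      also have "\<dots> \<le> 1 / 2 * norm h" by (intro mult_right_mono Dr_le) simp
      finally show "norm (Dr x \<bullet> h) \<le> 1 / 2 * norm h" .
    qed
  qed (use r_deriv in \<open>auto intro: has_derivative_at_withinI\<close>)
  then show ?thesis by simp
qed

text \<open>The summand 1 stands for the points of radius zero, where averaging multiplies by the volume of the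
  unit ball; the power of 4 comes from comparing radii on \<open>U\<close>.\<close>

definition avg_const :: real where
  "avg_const = (1 + 4 ^ DIM('a)) * unit_ball_vol (DIM('a))"

lemma avg_const_nonneg: "0 \<le> avg_const"
  by (simp add: avg_const_def)

lemma inner_average_eq:
  fixes p :: "'a \<Rightarrow> ennreal"
  assumes [measurable]: "p \<in> borel_measurable borel" and "r x > 0"
  shows "(\<integral>\<^sup>+y. indicator (cball 0 1) y * p (x + r x *\<^sub>R y) \<partial>lborel)
    = (\<integral>\<^sup>+z. ennreal (1 / r x ^ DIM('a)) * (indicator (cball x (r x)) z * p z) \<partial>lborel)"
proof -
  define g where "g = (\<lambda>z. indicator (cball x (r x)) z * p z)"
  have [measurable]: "g \<in> borel_measurable borel" unfolding g_def by measurable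
  have eq: "g (x + r x *\<^sub>R y) = indicator (cball 0 1) y * p (x + r x *\<^sub>R y)" for y
    using assms(2) by (auto simp: g_def indicator_def dist_norm mult_le_cancel_left1)
  have "(\<integral>\<^sup>+z. g z \<partial>lborel) = (\<integral>\<^sup>+z. g z \<partial>density (distr lborel borel (\<lambda>y. x + r x *\<^sub>R y)) (\<lambda>_. \<bar>r x\<bar> ^ DIM('a)))"
    using assms(2) by (subst lborel_affine[of "r x" x]) auto
  also have "\<dots> = (\<integral>\<^sup>+y. ennreal (r x ^ DIM('a)) * g (x + r x *\<^sub>R y) \<partial>lborel)"
    using assms(2) by (simp add: nn_integral_density nn_integral_distr)
  also have "\<dots> = ennreal (r x ^ DIM('a)) * (\<integral>\<^sup>+y. g (x + r x *\<^sub>R y) \<partial>lborel)"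
    by (rule nn_integral_cmult) measurable
  finally have *: "(\<integral>\<^sup>+z. g z \<partial>lborel) = ennreal (r x ^ DIM('a)) * (\<integral>\<^sup>+y. g (x + r x *\<^sub>R y) \<partial>lborel)" .
  have "(\<integral>\<^sup>+z. ennreal (1 / r x ^ DIM('a)) * g z \<partial>lborel) = ennreal (1 / r x ^ DIM('a)) * (\<integral>\<^sup>+z. g z \<partial>lborel)"
    by (rule nn_integral_cmult) measurable
  also have "\<dots> = (ennreal (1 / r x ^ DIM('a)) * ennreal (r x ^ DIM('a))) * (\<integral>\<^sup>+y. g (x + r x *\<^sub>R y) \<partial>lborel)"
    unfolding * by (simp only: mult.assoc)
  also have "ennreal (1 / r x ^ DIM('a)) * ennreal (r x ^ DIM('a)) = 1"
    using assms(2) by (simp add: ennreal_mult'[symmetric])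
  finally show ?thesis by (simp add: eq) (simp add: g_def)
qed

text \<open>For a point \<open>x\<close> of positive radius the inner integral is an integral of \<open>p\<close> against a kernel
  supported where \<open>\<bar>x - z\<bar> \<le> r x\<close>. By Tonelli only the total mass of the kernel in \<open>x\<close> matters. On its
  support \<open>r x\<close> and \<open>r z\<close> differ at most by a factor 2, so that mass is at most \<open>(2 / r z)^n\<close> times the
  volume of a ball of radius \<open>2 * r z\<close>, which does not depend on \<open>z\<close>.\<close>

lemma average_le:
  fixes p :: "'a \<Rightarrow> ennreal"
  assumes [measurable]: "p \<in> borel_measurable borel"
  shows "(\<integral>\<^sup>+x. (\<integral>\<^sup>+y. indicator (cball 0 1) y * p (x + r x *\<^sub>R y) \<partial>lborel) \<partial>lborel)
    \<le> ennreal avg_const * (\<integral>\<^sup>+x. p x \<partial>lborel)"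
proof -
  let ?V = "unit_ball_vol (DIM('a))"
  \<comment> \<open>The kernel of the averaging operator in the variables \<open>x\<close> and \<open>z = x + r x *\<^sub>R y\<close>.\<close>
  define k where "k = (\<lambda>x z. (if r x > 0 then ennreal (1 / r x ^ DIM('a)) * (if dist x z \<le> r x then 1 else 0) else 0))"
  have k_meas: "(\<lambda>(x, z). k x z) \<in> borel_measurable (borel \<Otimes>\<^sub>M borel)" unfolding k_def by measurable
  have [measurable]: "(\<lambda>(x, z). k x z * p z) \<in> borel_measurable (lborel \<Otimes>\<^sub>M lborel)" unfolding k_def by measurable
  have inner: "(\<integral>\<^sup>+y. indicator (cball 0 1) y * p (x + r x *\<^sub>R y) \<partial>lborel) \<le> ennreal ?V * p x + (\<integral>\<^sup>+z. k x z * p z \<partial>lborel)" for x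
  proof (cases "r x > 0")
    case True
    have "(\<integral>\<^sup>+y. indicator (cball 0 1) y * p (x + r x *\<^sub>R y) \<partial>lborel) = (\<integral>\<^sup>+z. k x z * p z \<partial>lborel)"
      unfolding inner_average_eq[OF assms True]
      using True by (intro nn_integral_cong) (auto simp: k_def indicator_def)
    then show ?thesis by simp
  next
    case False
    then have "r x = 0" using r_nonneg[of x] by simp
    then have "(\<integral>\<^sup>+y. indicator (cball 0 1) y * p (x + r x *\<^sub>R y) \<partial>lborel) = (\<integral>\<^sup>+y. indicator (cball (0::'a) 1) y * p x \<partial>lborel)"
      by simp
    also have "\<dots> = ennreal ?V * p x"
      by (subst nn_integral_multc) (auto simp: emeasure_cball)
    finally show ?thesis by simp
  qed
  have kint: "(\<integral>\<^sup>+x. k x z \<partial>lborel) \<le> ennreal (4 ^ DIM('a) * ?V)" for z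
  proof (cases "r z > 0")
    case True
    have le: "k x z \<le> ennreal ((2 / r z) ^ DIM('a)) * indicator (cball z (2 * r z)) x" for x
    proof (cases "r x > 0 \<and> dist x z \<le> r x")
      case T: True
      have "\<bar>r x - r z\<bar> \<le> r x / 2" using r_lipschitz[of x z] T by (simp add: dist_norm)
      then have a: "r x \<le> 2 * r z" "r z \<le> 2 * r x" using T by linarith+
      have "1 / r x \<le> 2 / r z" using a T True by (simp add: field_simps)
      then have "(1 / r x) ^ DIM('a) \<le> (2 / r z) ^ DIM('a)" using T by (intro power_mono) auto
      moreover have "x \<in> cball z (2 * r z)" using T a(1) by (simp add: dist_commute)
      ultimately show ?thesis using T by (simp add: k_def power_divide ennreal_leI)
    qed (auto simp: k_def)
    have "(\<integral>\<^sup>+x. k x z \<partial>lborel) \<le> (\<integral>\<^sup>+x. ennreal ((2 / r z) ^ DIM('a)) * indicator (cball z (2 * r z)) x \<partial>lborel)"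
      by (intro nn_integral_mono le)
    also have "\<dots> = ennreal ((2 / r z) ^ DIM('a)) * ennreal (?V * (2 * r z) ^ DIM('a))"
      using True by (subst nn_integral_cmult) (auto simp: emeasure_cball)
    also have "\<dots> = ennreal ((2 / r z) ^ DIM('a) * (?V * (2 * r z) ^ DIM('a)))"
      using True by (simp add: ennreal_mult')
    also have "(2 / r z) ^ DIM('a) * (?V * (2 * r z) ^ DIM('a)) = ?V * ((2 / r z) * (2 * r z)) ^ DIM('a)"
      by (simp only: power_mult_distrib mult_ac)
    also have "(2 / r z) * (2 * r z) = 4" using True by simp
    finally show ?thesis by (simp add: mult.commute)
  next
    case False
    have "k x z = 0" for x
    proof (cases "r x > 0 \<and> dist x z \<le> r x")
      case T: True
      have "\<bar>r x - r z\<bar> \<le> r x / 2" using r_lipschitz[of x z] T by (simp add: dist_norm)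
      then show ?thesis using T False by linarith
    qed (auto simp: k_def)
    then show ?thesis by simp
  qed
  have "(\<integral>\<^sup>+x. (\<integral>\<^sup>+y. indicator (cball 0 1) y * p (x + r x *\<^sub>R y) \<partial>lborel) \<partial>lborel)
      \<le> (\<integral>\<^sup>+x. ennreal ?V * p x + (\<integral>\<^sup>+z. k x z * p z \<partial>lborel) \<partial>lborel)"
    by (intro nn_integral_mono inner)
  also have "\<dots> = ennreal ?V * (\<integral>\<^sup>+x. p x \<partial>lborel) + (\<integral>\<^sup>+x. (\<integral>\<^sup>+z. k x z * p z \<partial>lborel) \<partial>lborel)"
    by (subst nn_integral_add) (auto simp: nn_integral_cmult)
  also have "(\<integral>\<^sup>+x. (\<integral>\<^sup>+z. k x z * p z \<partial>lborel) \<partial>lborel) = (\<integral>\<^sup>+z. (\<integral>\<^sup>+x. k x z * p z \<partial>lborel) \<partial>lborel)"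
    by (rule lborel_pair.Fubini'[symmetric]) measurable
  also have "\<dots> = (\<integral>\<^sup>+z. (\<integral>\<^sup>+x. k x z \<partial>lborel) * p z \<partial>lborel)"
    by (intro nn_integral_cong nn_integral_multc) (unfold k_def, measurable)
  also have "\<dots> \<le> (\<integral>\<^sup>+z. ennreal (4 ^ DIM('a) * ?V) * p z \<partial>lborel)"
    by (intro nn_integral_mono mult_right_mono kint) auto
  also have "\<dots> = ennreal (4 ^ DIM('a) * ?V) * (\<integral>\<^sup>+z. p z \<partial>lborel)" by (rule nn_integral_cmult) measurable
  finally have "(\<integral>\<^sup>+x. (\<integral>\<^sup>+y. indicator (cball 0 1) y * p (x + r x *\<^sub>R y) \<partial>lborel) \<partial>lborel)
      \<le> (ennreal ?V + ennreal (4 ^ DIM('a) * ?V)) * (\<integral>\<^sup>+x. p x \<partial>lborel)"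
    by (simp add: distrib_right)
  also have "ennreal ?V + ennreal (4 ^ DIM('a) * ?V) = ennreal avg_const"
    by (simp add: avg_const_def distrib_right ennreal_plus[symmetric] del: ennreal_plus)
  finally show ?thesis .
qed

text \<open>The kernel may depend on the point \<open>x\<close>, since the derivative of an average is an average of this
  more general kind.\<close>

definition average :: "('a \<Rightarrow> 'a \<Rightarrow> real) \<Rightarrow> ('a \<Rightarrow> real) \<Rightarrow> 'a \<Rightarrow> real" where
  "average q f x = (\<integral>y. q x y * f (x + r x *\<^sub>R y) \<partial>lborel)"

definition kernel :: "real \<Rightarrow> ('a \<Rightarrow> 'a \<Rightarrow> real) \<Rightarrow> bool" where
  "kernel Q q \<longleftrightarrow> 0 \<le> Q \<and> (\<lambda>(x, y). q x y) \<in> borel_measurable (borel \<Otimes>\<^sub>M borel) \<and>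
     (\<forall>x y. \<bar>q x y\<bar> \<le> Q * indicator (cball 0 1) y)"

lemma average_nn_bound:
  assumes q: "kernel Q q" and f: "integrable lborel f"
  shows "(\<integral>\<^sup>+x. (\<integral>\<^sup>+y. ennreal \<bar>q x y * f (x + r x *\<^sub>R y)\<bar> \<partial>lborel) \<partial>lborel)
    \<le> ennreal (Q * avg_const * (\<integral>x. \<bar>f x\<bar> \<partial>lborel))"
proof -
  have [measurable]: "f \<in> borel_measurable borel" using f by auto
  have Q: "0 \<le> Q" "\<And>x y. \<bar>q x y\<bar> \<le> Q * indicator (cball 0 1) y" using q by (auto simp: kernel_def)
  have "(\<integral>\<^sup>+x. (\<integral>\<^sup>+y. ennreal \<bar>q x y * f (x + r x *\<^sub>R y)\<bar> \<partial>lborel) \<partial>lborel)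
      \<le> (\<integral>\<^sup>+x. (\<integral>\<^sup>+y. ennreal Q * (indicator (cball 0 1) y * ennreal \<bar>f (x + r x *\<^sub>R y)\<bar>) \<partial>lborel) \<partial>lborel)"
  proof (intro nn_integral_mono)
    fix x y :: 'a
    have "\<bar>q x y * f (x + r x *\<^sub>R y)\<bar> \<le> (Q * indicator (cball 0 1) y) * \<bar>f (x + r x *\<^sub>R y)\<bar>"
      unfolding abs_mult using Q(2)[of x y] by (intro mult_right_mono) auto
    then show "ennreal \<bar>q x y * f (x + r x *\<^sub>R y)\<bar> \<le> ennreal Q * (indicator (cball 0 1) y * ennreal \<bar>f (x + r x *\<^sub>R y)\<bar>)"
      using Q(1) by (cases "y \<in> cball 0 1") (auto simp: ennreal_mult'[symmetric] intro!: ennreal_leI)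
  qed
  also have "\<dots> = ennreal Q * (\<integral>\<^sup>+x. (\<integral>\<^sup>+y. indicator (cball 0 1) y * ennreal \<bar>f (x + r x *\<^sub>R y)\<bar> \<partial>lborel) \<partial>lborel)"
    by (simp add: nn_integral_cmult)
  also have "\<dots> \<le> ennreal Q * (ennreal avg_const * (\<integral>\<^sup>+x. ennreal \<bar>f x\<bar> \<partial>lborel))"
    by (intro mult_left_mono average_le) auto
  also have "(\<integral>\<^sup>+x. ennreal \<bar>f x\<bar> \<partial>lborel) = ennreal (\<integral>x. \<bar>f x\<bar> \<partial>lborel)"
    using f by (intro nn_integral_eq_integral) auto
  also have "ennreal Q * (ennreal avg_const * ennreal (\<integral>x. \<bar>f x\<bar> \<partial>lborel)) = ennreal (Q * avg_const * (\<integral>x. \<bar>f x\<bar> \<partial>lborel))"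
    using Q(1) avg_const_nonneg by (simp add: ennreal_mult' mult.assoc)
  finally show ?thesis .
qed

lemma average_integrable_prod:
  assumes q: "kernel Q q" and f: "integrable lborel f"
  shows "integrable (lborel \<Otimes>\<^sub>M lborel) (\<lambda>(x, y). q x y * f (x + r x *\<^sub>R y))"
  unfolding integrable_iff_bounded
proof
  have [measurable]: "f \<in> borel_measurable borel" using f by auto
  have [measurable]: "(\<lambda>(x, y). q x y) \<in> borel_measurable (lborel \<Otimes>\<^sub>M lborel)"
    using q by (simp add: kernel_def cong: measurable_cong_sets)
  show m: "(\<lambda>(x, y). q x y * f (x + r x *\<^sub>R y)) \<in> borel_measurable (lborel \<Otimes>\<^sub>M lborel)"
    by measurable
  have "(\<integral>\<^sup>+p. ennreal (norm (case p of (x, y) \<Rightarrow> q x y * f (x + r x *\<^sub>R y))) \<partial>(lborel \<Otimes>\<^sub>M lborel))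
      = (\<integral>\<^sup>+x. (\<integral>\<^sup>+y. ennreal \<bar>q x y * f (x + r x *\<^sub>R y)\<bar> \<partial>lborel) \<partial>lborel)"
    by (subst lborel.nn_integral_fst[symmetric]) (use m in auto)
  also have "\<dots> < \<infinity>" using average_nn_bound[OF q f] by (auto intro: le_less_trans)
  finally show "(\<integral>\<^sup>+p. ennreal (norm (case p of (x, y) \<Rightarrow> q x y * f (x + r x *\<^sub>R y))) \<partial>(lborel \<Otimes>\<^sub>M lborel)) < \<infinity>" .
qed

lemma average_integrable:
  assumes "kernel Q q" "integrable lborel f"
  shows "integrable lborel (average q f)"
  using lborel_pair.integrable_fst[OF average_integrable_prod[OF assms]] by (simp add: average_def[abs_def])

lemma average_norm_le:
  assumes q: "kernel Q q" and f: "integrable lborel f"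
  shows "(\<integral>x. \<bar>average q f x\<bar> \<partial>lborel) \<le> Q * avg_const * (\<integral>x. \<bar>f x\<bar> \<partial>lborel)"
proof -
  have "ennreal (\<integral>x. \<bar>average q f x\<bar> \<partial>lborel) = (\<integral>\<^sup>+x. ennreal \<bar>average q f x\<bar> \<partial>lborel)"
    using average_integrable[OF assms] by (intro nn_integral_eq_integral[symmetric]) auto
  also have "\<dots> \<le> (\<integral>\<^sup>+x. (\<integral>\<^sup>+y. ennreal \<bar>q x y * f (x + r x *\<^sub>R y)\<bar> \<partial>lborel) \<partial>lborel)"
    using lborel_pair.AE_integrable_fst[OF average_integrable_prod[OF assms]]
    by (intro nn_integral_mono_AE, eventually_elim) (auto simp: average_def dest: integral_norm_bound_ennreal)
  also have "\<dots> \<le> ennreal (Q * avg_const * (\<integral>x. \<bar>f x\<bar> \<partial>lborel))" by (rule average_nn_bound[OF assms])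
  finally show ?thesis
    using q avg_const_nonneg by (subst (asm) ennreal_le_iff) (auto simp: kernel_def)
qed

text \<open>Only almost everywhere: at an exceptional point one of the integrals may diverge and then has the
  default value zero.\<close>

lemma average_linear_AE:
  assumes q: "kernel Q q" and f: "integrable lborel f" and g: "integrable lborel g"
  shows "AE x in lborel. average q (\<lambda>x. a * f x + b * g x) x = a * average q f x + b * average q g x"
  using lborel_pair.AE_integrable_fst[OF average_integrable_prod[OF q f]]
    lborel_pair.AE_integrable_fst[OF average_integrable_prod[OF q g]]
proof eventually_elim
  case (elim x)
  have "average q (\<lambda>x. a * f x + b * g x) x = (\<integral>y. a * (q x y * f (x + r x *\<^sub>R y)) + b * (q x y * g (x + r x *\<^sub>R y)) \<partial>lborel)"
    unfolding average_def by (intro Bochner_Integration.integral_cong) (auto simp: algebra_simps)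
  also have "\<dots> = a * average q f x + b * average q g x"
    using elim by (simp add: average_def)
  finally show ?case .
qed

lemma average_diff_le:
  assumes q: "kernel Q q" and f: "integrable lborel f" and g: "integrable lborel g"
  shows "(\<integral>x. \<bar>average q f x - average q g x\<bar> \<partial>lborel) \<le> Q * avg_const * (\<integral>x. \<bar>f x - g x\<bar> \<partial>lborel)"
proof -
  have fg: "integrable lborel (\<lambda>x. 1 * f x + (-1) * g x)" using f g by auto
  have "(\<integral>x. \<bar>average q f x - average q g x\<bar> \<partial>lborel) = (\<integral>x. \<bar>average q (\<lambda>x. 1 * f x + (-1) * g x) x\<bar> \<partial>lborel)"
  proof (rule integral_cong_AE)
    show "AE x in lborel. \<bar>average q f x - average q g x\<bar> = \<bar>average q (\<lambda>x. 1 * f x + (-1) * g x) x\<bar>"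
      using average_linear_AE[OF q f g, of 1 "-1"] by eventually_elim simp
  qed (use average_integrable[OF q f] average_integrable[OF q g] average_integrable[OF q fg] in auto)
  also have "\<dots> \<le> Q * avg_const * (\<integral>x. \<bar>1 * f x + (-1) * g x\<bar> \<partial>lborel)"
    by (rule average_norm_le[OF q fg])
  finally show ?thesis by simp
qed

end

section \<open>The derivative of a smoothed function\<close>

lemma mollify_close:
  fixes f :: "'a::euclidean_space \<Rightarrow> real"
  assumes f: "integrable lborel f" and "e > 0" "\<delta> > 0"
  shows "\<exists>\<epsilon>>0. \<epsilon> < \<delta> \<and> integrable lborel (conv f (mollifier \<epsilon>)) \<and>
    (\<integral>x. \<bar>conv f (mollifier \<epsilon>) x - f x\<bar> \<partial>lborel) \<le> e"
proof -
  obtain d where d: "d > 0" "\<And>h. norm h < d \<Longrightarrow> (\<integral>x. \<bar>f (x + h) - f x\<bar> \<partial>lborel) \<le> e"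
    using integrable_translation_continuous[OF f] \<open>e > 0\<close> by blast
  define \<epsilon> where "\<epsilon> = min d \<delta> / 2"
  have \<epsilon>: "0 < \<epsilon>" "\<epsilon> < d" "\<epsilon> < \<delta>" using d(1) \<open>\<delta> > 0\<close> by (auto simp: \<epsilon>_def)
  have "norm h < \<epsilon> \<Longrightarrow> (\<integral>x. \<bar>f (x + h) - f x\<bar> \<partial>lborel) \<le> e" for h
    using d(2)[of h] \<epsilon>(2) by simp
  from mollification_L1[OF f \<epsilon>(1) \<open>e > 0\<close> this] show ?thesis using \<epsilon> by blast
qed

lemma C_k_mollification: "integrable lborel f \<Longrightarrow> \<epsilon> > 0 \<Longrightarrow> C_k k (conv f (mollifier \<epsilon>))"
  by (rule C_k_conv[OF _ mollifier_C_k mollifier_vanish'])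

lemma abs_integral_mult_le:
  fixes f g :: "'a::euclidean_space \<Rightarrow> real"
  assumes f: "integrable lborel f" and g: "g \<in> borel_measurable borel" "\<And>x. \<bar>g x\<bar> \<le> B"
  shows "\<bar>\<integral>x. f x * g x \<partial>lborel\<bar> \<le> B * (\<integral>x. \<bar>f x\<bar> \<partial>lborel)"
proof -
  have "\<bar>\<integral>x. f x * g x \<partial>lborel\<bar> \<le> (\<integral>x. \<bar>f x * g x\<bar> \<partial>lborel)" by (rule integral_abs_bound)
  also have "\<dots> \<le> (\<integral>x. B * \<bar>f x\<bar> \<partial>lborel)"
  proof (rule integral_le_integral)
    show "integrable lborel (\<lambda>x. \<bar>f x * g x\<bar>)" by (intro integrable_abs integrable_mult_bounded[OF f g])
    show "\<bar>f x * g x\<bar> \<le> B * \<bar>f x\<bar>" for x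
    proof -
      have "\<bar>g x\<bar> * \<bar>f x\<bar> \<le> B * \<bar>f x\<bar>" using g(2)[of x] by (intro mult_right_mono) auto
      then show ?thesis by (simp add: abs_mult mult.commute)
    qed
  qed (use f in auto)
  finally show ?thesis by simp
qed

abbreviation D\<rho> :: "'a::euclidean_space \<Rightarrow> 'a \<Rightarrow> real" where
  "D\<rho> y \<equiv> frechet_derivative (mollifier 1) (at y)"

lemma D\<rho>_cont: "continuous_on S (\<lambda>y. D\<rho> y b)" "continuous_on S (\<lambda>y. D\<rho> y y)"
  by (auto intro!: continuous_on_frechet_derivative[OF mollifier_C_k] continuous_intros)

lemma D\<rho>_measurable [measurable]:
  "(\<lambda>y. D\<rho> y b) \<in> borel_measurable borel" "(\<lambda>y. D\<rho> y y) \<in> borel_measurable borel"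
  using D\<rho>_cont by (auto intro: borel_measurable_continuous_onI)

lemma D\<rho>_vanish: "1 < norm y \<Longrightarrow> D\<rho> y b = 0"
  by (rule frechet_derivative_vanish[OF mollifier_vanish', rule_format]) auto

lemma D\<rho>_bounds: "\<exists>B\<ge>0. \<forall>y. \<bar>mollifier 1 y\<bar> \<le> B \<and> \<bar>D\<rho> y b\<bar> \<le> B \<and> \<bar>D\<rho> y y\<bar> \<le> B"
proof -
  obtain B1 where B1: "B1 > 0" "\<And>y::'a. norm (mollifier 1 y) \<le> B1"
    by (rule vanish_bounded[OF mollifier_continuous[of 1] mollifier_vanish'[of 1]]) auto
  obtain B2 where B2: "B2 > 0" "\<And>y. norm (D\<rho> y b) \<le> B2"
    by (rule vanish_bounded[OF D\<rho>_cont(1)[of UNIV b], of 1]) (auto simp: D\<rho>_vanish)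
  obtain B3 where B3: "B3 > 0" "\<And>y::'a. norm (D\<rho> y y) \<le> B3"
    by (rule vanish_bounded[OF D\<rho>_cont(2)[of UNIV], of 1]) (auto simp: D\<rho>_vanish)
  show ?thesis
  proof (intro exI[of _ "B1 + B2 + B3"] conjI allI)
    fix y :: 'a
    show "\<bar>mollifier 1 y\<bar> \<le> B1 + B2 + B3" "\<bar>D\<rho> y b\<bar> \<le> B1 + B2 + B3" "\<bar>D\<rho> y y\<bar> \<le> B1 + B2 + B3"
      using B1(2)[of y] B2(2)[of y] B3(2)[of y] B1(1) B2(1) B3(1) by auto
  qed (use B1(1) B2(1) B3(1) in auto)
qed

context scale_function
begin

lemma Dr_measurable [measurable]: "Dr \<in> borel_measurable borel"
  by (rule borel_measurable_continuous_onI[OF Dr_cont])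

definition smoothing :: "('a \<Rightarrow> real) \<Rightarrow> 'a \<Rightarrow> real" where
  "smoothing = average (\<lambda>x. mollifier 1)"

text \<open>The kernel left over when the derivative of the smoothing along \<open>b\<close> is integrated by parts in the
  averaging variable. The second summand is the divergence of \<open>y \<mapsto> mollifier 1 y *\<^sub>R y\<close> and comes from
  the dependence of the radius on \<open>x\<close>.\<close>

definition grad_kernel :: "'a \<Rightarrow> 'a \<Rightarrow> 'a \<Rightarrow> real" where
  "grad_kernel b x y = - (1 / r x) * (D\<rho> y b + (Dr x \<bullet> b) * (DIM('a) * mollifier 1 y + D\<rho> y y))"

text \<open>The chain rule under the integral: the derivative of \<open>x + r x *\<^sub>R y\<close> along \<open>b\<close> is
  \<open>b + (Dr x \<bullet> b) *\<^sub>R y\<close>.\<close>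

definition smooth_deriv :: "'a \<Rightarrow> ('a \<Rightarrow> real) \<Rightarrow> 'a \<Rightarrow> real" where
  "smooth_deriv b f x = (\<integral>y. mollifier 1 y * frechet_derivative f (at (x + r x *\<^sub>R y)) (b + (Dr x \<bullet> b) *\<^sub>R y) \<partial>lborel)"

lemma ex_kernel_mollifier: "\<exists>Q. kernel Q (\<lambda>x. mollifier 1)"
proof -
  obtain B where B: "B \<ge> 0" "\<And>y::'a. \<bar>mollifier 1 y\<bar> \<le> B" using D\<rho>_bounds by blast
  have "\<bar>mollifier 1 y\<bar> \<le> B * indicator (cball 0 1) y" for y :: 'a
    using B mollifier_vanish'[of 1, where 'a = 'a] by (cases "y \<in> cball 0 1") auto
  then show ?thesis using B(1) unfolding kernel_def by (intro exI[of _ B]) (auto intro!: measurable_compose[OF measurable_snd] simp: split_beta')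
qed

definition mollifier_bound :: real where "mollifier_bound = (SOME Q. kernel Q (\<lambda>x. mollifier 1))"

lemma kernel_mollifier: "kernel mollifier_bound (\<lambda>x. mollifier 1)"
  unfolding mollifier_bound_def using ex_kernel_mollifier by (rule someI_ex)

lemma mollifier_bound_nonneg: "0 \<le> mollifier_bound" using kernel_mollifier by (simp add: kernel_def)

text \<open>Outside \<open>U\<close> the radius is zero and the bump has integral one. With the exterior of
  \<open>\<Omega>\<close> for \<open>U\<close>, the smoothing preserves the values on \<open>\<Omega>\<close> and on its boundary.\<close>

lemma smoothing_eq_outside: "x \<notin> U \<Longrightarrow> smoothing f x = f x"
proof -
  assume "x \<notin> U"
  then have "r x = 0" using r_pos[of x] r_nonneg[of x] by simp
  then show ?thesis using mollifier_integral[of 1, where 'a = 'a] by (simp add: smoothing_def average_def)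
qed

lemma grad_kernel_measurable: "(\<lambda>(x, y). grad_kernel b x y) \<in> borel_measurable (borel \<Otimes>\<^sub>M borel)"
  unfolding grad_kernel_def by measurable

text \<open>The factor \<open>1 / r x\<close> is bounded on compact subsets of \<open>U\<close>, but in general not on \<open>U\<close>.\<close>

lemma ex_kernel_grad:
  assumes K: "compact K" "K \<subseteq> U" and b: "b \<in> Basis"
  shows "\<exists>Q. kernel Q (\<lambda>x y. indicator K x * grad_kernel b x y)"
proof -
  obtain B where B: "B \<ge> 0" "\<And>y::'a. \<bar>mollifier 1 y\<bar> \<le> B" "\<And>y. \<bar>D\<rho> y b\<bar> \<le> B" "\<And>y::'a. \<bar>D\<rho> y y\<bar> \<le> B"
    using D\<rho>_bounds[of b] by blast
  have "\<exists>m>0. \<forall>x\<in>K. m \<le> r x"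
  proof (cases "K = {}")
    case False
    obtain x0 where "x0 \<in> K" "\<forall>x\<in>K. r x0 \<le> r x"
      using continuous_attains_inf[OF K(1) False, of r] r_cont continuous_on_subset by blast
    then show ?thesis using r_pos K(2) by blast
  qed (auto intro: exI[of _ 1])
  then obtain m where m: "m > 0" "\<And>x. x \<in> K \<Longrightarrow> m \<le> r x" by blast
  define Q where "Q = (1 / m) * (B + (DIM('a) * B + B))"
  have Q: "0 \<le> Q" using B(1) m(1) by (simp add: Q_def)
  have bd: "\<bar>indicator K x * grad_kernel b x y\<bar> \<le> Q * indicator (cball 0 1) y" for x y
  proof (cases "x \<in> K \<and> y \<in> cball 0 1")
    case True
    have "\<bar>Dr x \<bullet> b\<bar> \<le> 1"
      using Cauchy_Schwarz_ineq2[of "Dr x" b] Dr_le[of x] b by simp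
    moreover have "\<bar>DIM('a) * mollifier 1 y + D\<rho> y y\<bar> \<le> DIM('a) * B + B"
      using B(2)[of y] B(4)[of y] by (intro order_trans[OF abs_triangle_ineq] add_mono) (auto simp: abs_mult)
    ultimately have "\<bar>(Dr x \<bullet> b) * (DIM('a) * mollifier 1 y + D\<rho> y y)\<bar> \<le> 1 * (DIM('a) * B + B)"
      unfolding abs_mult by (intro mult_mono) auto
    then have "\<bar>D\<rho> y b + (Dr x \<bullet> b) * (DIM('a) * mollifier 1 y + D\<rho> y y)\<bar> \<le> B + (DIM('a) * B + B)"
      using B(3)[of y] by (intro order_trans[OF abs_triangle_ineq] add_mono) auto
    moreover have "\<bar>- (1 / r x)\<bar> \<le> 1 / m" using m(1) m(2)[of x] True r_nonneg[of x] by (simp add: frac_le)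
    ultimately have "\<bar>grad_kernel b x y\<bar> \<le> Q"
      unfolding grad_kernel_def Q_def abs_mult[of "- (1 / r x)"] using m(1) by (intro mult_mono) auto
    then show ?thesis using True by simp
  next
    case False
    then show ?thesis
      using Q D\<rho>_vanish[of y] mollifier_vanish'[of 1, where 'a = 'a] by (auto simp: grad_kernel_def)
  qed
  have [measurable]: "K \<in> sets borel" using K(1) by (rule borel_compact)
  have "(\<lambda>(x, y). indicator K x * grad_kernel b x y) \<in> borel_measurable (borel \<Otimes>\<^sub>M borel)"
    using grad_kernel_measurable by measurable
  then show ?thesis unfolding kernel_def using Q bd by blast
qed

lemma shift_map_cont: "continuous_on S (\<lambda>p::'a \<times> 'a. fst p + r (fst p) *\<^sub>R snd p)"
  by (intro continuous_intros continuous_on_compose2[OF r_cont]) auto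

lemma smooth_deriv_integrand_cont:
  assumes "C_k (Suc 0) f"
  shows "continuous_on UNIV (\<lambda>p::'a \<times> 'a. mollifier 1 (snd p) *
     frechet_derivative f (at (fst p + r (fst p) *\<^sub>R snd p)) (b + (Dr (fst p) \<bullet> b) *\<^sub>R snd p))"
  by (intro continuous_intros continuous_on_frechet_derivative[OF assms] shift_map_cont
      continuous_on_compose2[OF mollifier_continuous] continuous_on_compose2[OF Dr_cont]) auto

lemma smooth_deriv_measurable:
  assumes "C_k (Suc 0) f"
  shows "smooth_deriv b f \<in> borel_measurable borel"
proof -
  have "(\<lambda>(x, y). mollifier 1 y * frechet_derivative f (at (x + r x *\<^sub>R y)) (b + (Dr x \<bullet> b) *\<^sub>R y)) \<in> borel_measurable (borel \<Otimes>\<^sub>M borel)"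
    using borel_measurable_continuous_onI[OF smooth_deriv_integrand_cont[OF assms, of b]]
    by (simp add: borel_prod split_beta')
  then have "(\<lambda>(x, y). mollifier 1 y * frechet_derivative f (at (x + r x *\<^sub>R y)) (b + (Dr x \<bullet> b) *\<^sub>R y)) \<in> borel_measurable (borel \<Otimes>\<^sub>M lborel)"
    by (simp cong: measurable_cong_sets)
  from lborel.borel_measurable_lebesgue_integral[OF this]
  show ?thesis by (simp add: smooth_deriv_def[abs_def])
qed

text \<open>For fixed \<open>y\<close> the map \<open>x \<mapsto> f (x + r x *\<^sub>R y)\<close> is of class C^1 and can be integrated by parts against
  \<open>\<zeta>\<close>; Fubini's theorem exchanges this with the average over \<open>y\<close>.\<close>

lemma smoothing_weak_derivative:
  assumes f: "C_k (Suc 0) f" and \<zeta>: "C_k (Suc 0) \<zeta>" "\<forall>x. R < norm x \<longrightarrow> \<zeta> x = 0" and "b \<in> Basis"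
  shows "(\<integral>x. smoothing f x * frechet_derivative \<zeta> (at x) b \<partial>lborel) = - (\<integral>x. smooth_deriv b f x * \<zeta> x \<partial>lborel)"
proof -
  let ?D\<zeta> = "\<lambda>x. frechet_derivative \<zeta> (at x) b"
  let ?\<rho> = "mollifier 1 :: 'a \<Rightarrow> real"
  define h where "h = (\<lambda>y x. f (x + r x *\<^sub>R y))"
  have cf: "continuous_on UNIV f" and c\<zeta>: "continuous_on UNIV \<zeta>" "continuous_on UNIV ?D\<zeta>"
    using C_k_continuous[OF f] C_k_continuous[OF \<zeta>(1)] C_1_continuous_derivative[OF \<zeta>(1)] by auto
  note vD = frechet_derivative_vanish[OF \<zeta>(2), of b]
  have hder: "(h y has_derivative (\<lambda>v. frechet_derivative f (at (x + r x *\<^sub>R y)) (v + (Dr x \<bullet> v) *\<^sub>R y))) (at x)" for x y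
  proof -
    have "((\<lambda>x. x + r x *\<^sub>R y) has_derivative (\<lambda>v. v + (Dr x \<bullet> v) *\<^sub>R y)) (at x)"
      by (auto intro!: derivative_eq_intros r_deriv)
    from has_derivative_compose[OF this C_k_SucD(1)[OF f]] show ?thesis by (simp add: h_def)
  qed
  have hC: "C_k (Suc 0) (h y)" for y
  proof (rule C_k_SucI[OF hder])
    show "C_k 0 (\<lambda>x. frechet_derivative f (at (x + r x *\<^sub>R y)) (e + (Dr x \<bullet> e) *\<^sub>R y))" for e
      unfolding C_k.simps
      by (intro continuous_on_frechet_derivative[OF f] continuous_intros r_cont Dr_cont)
  qed
  have R1: "?\<rho> y = 0" if "max R 1 < norm y" for y using that mollifier_vanish'[of 1, where 'a = 'a] by simp
  have "(\<integral>x. smoothing f x * ?D\<zeta> x \<partial>lborel) = (\<integral>x. (\<integral>y. ?\<rho> y * h y x * ?D\<zeta> x \<partial>lborel) \<partial>lborel)"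
    by (simp add: smoothing_def average_def h_def)
  also have "\<dots> = (\<integral>y. (\<integral>x. ?\<rho> y * h y x * ?D\<zeta> x \<partial>lborel) \<partial>lborel)"
  proof (rule lborel_pair.Fubini_integral[symmetric], rule vanish_integrable_prod[where R = "max R 1"])
    show "continuous_on UNIV (\<lambda>(x, y). ?\<rho> y * h y x * ?D\<zeta> x)"
      unfolding h_def split_beta'
      by (intro continuous_intros shift_map_cont continuous_on_compose2[OF mollifier_continuous]
          continuous_on_compose2[OF cf] continuous_on_compose2[OF c\<zeta>(2)]) auto
    show "(case (x, y) of (x, y) \<Rightarrow> ?\<rho> y * h y x * ?D\<zeta> x) = 0" if "max R 1 < norm x \<or> max R 1 < norm y" for x y
      using that vD R1[of y] by auto
  qed
  also have "\<dots> = (\<integral>y. - (\<integral>x. ?\<rho> y * (frechet_derivative f (at (x + r x *\<^sub>R y)) (b + (Dr x \<bullet> b) *\<^sub>R y) * \<zeta> x) \<partial>lborel) \<partial>lborel)"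
  proof (intro Bochner_Integration.integral_cong refl)
    fix y
    have "(\<integral>x. ?\<rho> y * h y x * ?D\<zeta> x \<partial>lborel) = ?\<rho> y * (\<integral>x. h y x * ?D\<zeta> x \<partial>lborel)"
      by (simp add: mult.assoc)
    also have "(\<integral>x. h y x * ?D\<zeta> x \<partial>lborel) = - (\<integral>x. frechet_derivative (h y) (at x) b * \<zeta> x \<partial>lborel)"
      by (rule integral_by_parts[OF hC \<zeta>])
    also have "\<dots> = - (\<integral>x. frechet_derivative f (at (x + r x *\<^sub>R y)) (b + (Dr x \<bullet> b) *\<^sub>R y) * \<zeta> x \<partial>lborel)"
      by (simp add: frechet_derivative_eqI[OF hder])
    finally show "(\<integral>x. ?\<rho> y * h y x * ?D\<zeta> x \<partial>lborel) = - (\<integral>x. ?\<rho> y * (frechet_derivative f (at (x + r x *\<^sub>R y)) (b + (Dr x \<bullet> b) *\<^sub>R y) * \<zeta> x) \<partial>lborel)"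
      by simp
  qed
  also have "\<dots> = - (\<integral>y. (\<integral>x. ?\<rho> y * (frechet_derivative f (at (x + r x *\<^sub>R y)) (b + (Dr x \<bullet> b) *\<^sub>R y) * \<zeta> x) \<partial>lborel) \<partial>lborel)"
    by simp
  also have "(\<integral>y. (\<integral>x. ?\<rho> y * (frechet_derivative f (at (x + r x *\<^sub>R y)) (b + (Dr x \<bullet> b) *\<^sub>R y) * \<zeta> x) \<partial>lborel) \<partial>lborel)
    = (\<integral>x. (\<integral>y. ?\<rho> y * (frechet_derivative f (at (x + r x *\<^sub>R y)) (b + (Dr x \<bullet> b) *\<^sub>R y) * \<zeta> x) \<partial>lborel) \<partial>lborel)"
  proof (rule lborel_pair.Fubini_integral, rule vanish_integrable_prod[where R = "max R 1"])
    have "continuous_on UNIV (\<lambda>p::'a \<times> 'a. (?\<rho> (snd p) * frechet_derivative f (at (fst p + r (fst p) *\<^sub>R snd p)) (b + (Dr (fst p) \<bullet> b) *\<^sub>R snd p)) * \<zeta> (fst p))"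
      by (intro continuous_on_mult smooth_deriv_integrand_cont[OF f] continuous_on_compose2[OF c\<zeta>(1)] continuous_intros) auto
    then show "continuous_on UNIV (\<lambda>(x, y). ?\<rho> y * (frechet_derivative f (at (x + r x *\<^sub>R y)) (b + (Dr x \<bullet> b) *\<^sub>R y) * \<zeta> x))"
      by (simp add: split_beta' mult.assoc)
    show "(case (x, y) of (x, y) \<Rightarrow> ?\<rho> y * (frechet_derivative f (at (x + r x *\<^sub>R y)) (b + (Dr x \<bullet> b) *\<^sub>R y) * \<zeta> x)) = 0"
      if "max R 1 < norm x \<or> max R 1 < norm y" for x y
      using that \<zeta>(2) R1[of y] by auto
  qed
  also have "\<dots> = (\<integral>x. smooth_deriv b f x * \<zeta> x \<partial>lborel)"
    by (simp add: smooth_deriv_def flip: mult.assoc)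
  finally show ?thesis .
qed

text \<open>With \<open>h y = f (x + r x *\<^sub>R y)\<close> the integrand contains only derivatives of \<open>h\<close>, and integration by parts
  in \<open>y\<close> moves them to the bump. What remains depends on \<open>f\<close> only through its values and so makes sense,
  and is stable in \<open>L1\<close>, for integrable \<open>f\<close>.\<close>

lemma smooth_deriv_eq_average:
  assumes f: "C_k (Suc 0) f" and x: "x \<in> U"
  shows "smooth_deriv b f x = average (grad_kernel b) f x"
proof -
  let ?\<rho> = "mollifier 1 :: 'a \<Rightarrow> real"
  define c where "c = r x"
  define \<beta> where "\<beta> = Dr x \<bullet> b"
  have c: "c > 0" using x r_pos by (simp add: c_def)
  define h where "h = (\<lambda>y. f (x + c *\<^sub>R y))"
  have hder: "(h has_derivative (\<lambda>v. frechet_derivative f (at (x + c *\<^sub>R y)) (c *\<^sub>R v))) (at y)" for y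
  proof -
    have "((\<lambda>y. x + c *\<^sub>R y) has_derivative (\<lambda>v. c *\<^sub>R v)) (at y)" by (auto intro!: derivative_eq_intros)
    from has_derivative_compose[OF this C_k_SucD(1)[OF f]] show ?thesis by (simp add: h_def)
  qed
  have hC: "C_k (Suc 0) h"
  proof (rule C_k_SucI[OF hder])
    show "C_k 0 (\<lambda>y. frechet_derivative f (at (x + c *\<^sub>R y)) (c *\<^sub>R e))" for e
      unfolding C_k.simps by (intro continuous_on_frechet_derivative[OF f] continuous_intros)
  qed
  have linf: "linear (frechet_derivative f (at z))" for z using f by (intro linear_frechet_derivative) auto
  have linh: "linear (frechet_derivative h (at z))" for z using hC by (intro linear_frechet_derivative) auto
  have Dh: "c * frechet_derivative f (at (x + c *\<^sub>R y)) v = frechet_derivative h (at y) v" for y v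
    using frechet_derivative_eqI[OF hder, of y v] linear_cmul[OF linf] by simp
  have ch: "continuous_on UNIV h" and cDh: "continuous_on UNIV (\<lambda>y. frechet_derivative h (at y) v)" for v
    using C_k_continuous[OF hC] C_1_continuous_derivative[OF hC] by auto
  have van: "\<forall>y::'a. 1 < norm y \<longrightarrow> ?\<rho> y = 0" by (rule mollifier_vanish') simp
  \<comment> \<open>The components of the field \<open>y \<mapsto> mollifier 1 y *\<^sub>R y\<close>, to which the derivatives are moved.\<close>
  define \<sigma> where "\<sigma> = (\<lambda>e y. ?\<rho> y * (y \<bullet> e))"
  have \<sigma>C: "C_k k (\<sigma> e)" for k e unfolding \<sigma>_def by (intro C_k_mult mollifier_C_k C_k_inner)
  have \<sigma>v: "\<forall>y. 1 < norm y \<longrightarrow> \<sigma> e y = 0" for e using van by (simp add: \<sigma>_def)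
  have D\<sigma>: "frechet_derivative (\<sigma> e) (at y) e = ?\<rho> y + D\<rho> y e * (y \<bullet> e)" if "e \<in> Basis" for e y
  proof -
    have "((\<lambda>y. ?\<rho> y * (y \<bullet> e)) has_derivative (\<lambda>v. ?\<rho> y * (v \<bullet> e) + D\<rho> y v * (y \<bullet> e))) (at y)"
      by (intro has_derivative_mult C_k_SucD(1)[OF mollifier_C_k[of "Suc 0"]]) (auto intro!: derivative_eq_intros)
    from frechet_derivative_eqI[OF this[folded \<sigma>_def]] show ?thesis using that by (simp add: \<sigma>_def)
  qed
  have i1: "integrable lborel (\<lambda>y. ?\<rho> y * frechet_derivative h (at y) v)" for v
    by (rule vanish_integrable[of _ 1]) (use van in \<open>auto intro!: continuous_on_mult mollifier_continuous cDh\<close>)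
  have i2: "integrable lborel (\<lambda>y. \<sigma> e y * frechet_derivative h (at y) v)" for e v
    by (rule vanish_integrable[of _ 1]) (use \<sigma>v C_k_continuous[OF \<sigma>C] in \<open>auto intro!: continuous_on_mult cDh\<close>)
  have i3: "integrable lborel (\<lambda>y. h y * D\<rho> y b)"
    by (rule vanish_integrable[of _ 1]) (auto intro!: continuous_on_mult ch D\<rho>_cont simp: D\<rho>_vanish)
  have i4: "integrable lborel (\<lambda>y. h y * frechet_derivative (\<sigma> e) (at y) e)" for e
    by (rule vanish_integrable[of _ 1])
       (use frechet_derivative_vanish[OF \<sigma>v] in \<open>auto intro!: continuous_on_mult ch C_1_continuous_derivative[OF \<sigma>C]\<close>)
  have "c * smooth_deriv b f x = (\<integral>y. ?\<rho> y * frechet_derivative h (at y) (b + \<beta> *\<^sub>R y) \<partial>lborel)"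
    unfolding smooth_deriv_def integral_mult_right_zero[symmetric] c_def[symmetric] \<beta>_def[symmetric] Dh[symmetric]
    by (simp add: mult.left_commute)
  also have "\<dots> = (\<integral>y. ?\<rho> y * frechet_derivative h (at y) b + \<beta> * (\<Sum>e\<in>Basis. \<sigma> e y * frechet_derivative h (at y) e) \<partial>lborel)"
  proof (intro Bochner_Integration.integral_cong refl)
    fix y
    have "frechet_derivative h (at y) (b + \<beta> *\<^sub>R y) = frechet_derivative h (at y) b + \<beta> * frechet_derivative h (at y) y"
      by (simp add: linear_add[OF linh] linear_cmul[OF linh])
    also have "frechet_derivative h (at y) y = (\<Sum>e\<in>Basis. (y \<bullet> e) * frechet_derivative h (at y) e)"
      using frechet_derivative_expand[of h y y] hC by simp
    finally show "?\<rho> y * frechet_derivative h (at y) (b + \<beta> *\<^sub>R y) = ?\<rho> y * frechet_derivative h (at y) b + \<beta> * (\<Sum>e\<in>Basis. \<sigma> e y * frechet_derivative h (at y) e)"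
      by (simp add: \<sigma>_def distrib_left sum_distrib_left mult_ac)
  qed
  also have "\<dots> = (\<integral>y. ?\<rho> y * frechet_derivative h (at y) b \<partial>lborel) + \<beta> * (\<Sum>e\<in>Basis. \<integral>y. \<sigma> e y * frechet_derivative h (at y) e \<partial>lborel)"
    by (simp add: i1 i2)
  also have "(\<integral>y. ?\<rho> y * frechet_derivative h (at y) b \<partial>lborel) = - (\<integral>y. h y * D\<rho> y b \<partial>lborel)"
    using integral_by_parts[OF hC mollifier_C_k van, of b] by (simp add: mult.commute)
  also have "(\<Sum>e\<in>Basis. \<integral>y. \<sigma> e y * frechet_derivative h (at y) e \<partial>lborel) = (\<Sum>e\<in>Basis. - (\<integral>y. h y * frechet_derivative (\<sigma> e) (at y) e \<partial>lborel))"
    using integral_by_parts[OF hC \<sigma>C \<sigma>v] by (simp add: mult.commute)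
  also have "- (\<integral>y. h y * D\<rho> y b \<partial>lborel) + \<beta> * (\<Sum>e\<in>Basis. - (\<integral>y. h y * frechet_derivative (\<sigma> e) (at y) e \<partial>lborel))
      = - (\<integral>y. h y * D\<rho> y b + \<beta> * (\<Sum>e\<in>Basis. h y * frechet_derivative (\<sigma> e) (at y) e) \<partial>lborel)"
    by (simp add: i3 i4 sum_negf)
  also have "\<dots> = - (\<integral>y. (D\<rho> y b + \<beta> * (DIM('a) * ?\<rho> y + D\<rho> y y)) * h y \<partial>lborel)"
  proof -
    have "h y * D\<rho> y b + \<beta> * (\<Sum>e\<in>Basis. h y * frechet_derivative (\<sigma> e) (at y) e) = (D\<rho> y b + \<beta> * (DIM('a) * ?\<rho> y + D\<rho> y y)) * h y" for y
    proof -
      have "D\<rho> y y = (\<Sum>e\<in>Basis. D\<rho> y e * (y \<bullet> e))"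
        using frechet_derivative_expand[of "mollifier 1" y y] mollifier_C_k[of "Suc 0" 1, where 'a = 'a] by (simp add: mult.commute)
      then have "(\<Sum>e\<in>Basis. frechet_derivative (\<sigma> e) (at y) e) = DIM('a) * ?\<rho> y + D\<rho> y y"
        by (simp add: D\<sigma> sum.distrib)
      then show ?thesis by (simp add: sum_distrib_left[symmetric] algebra_simps)
    qed
    then show ?thesis by simp
  qed
  also have "\<dots> = c * average (grad_kernel b) f x"
    unfolding average_def grad_kernel_def integral_mult_right_zero[symmetric] Bochner_Integration.integral_minus[symmetric]
    using c by (intro Bochner_Integration.integral_cong) (auto simp: c_def[symmetric] \<beta>_def[symmetric] h_def field_simps)
  finally show ?thesis using c by simp
qed

end

section \<open>Smoothing of functions of bounded variation\<close>

context scale_function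
begin

lemma U_open: "open U"
proof -
  have "U = {x. 0 < r x}" using r_pos by auto
  then show ?thesis using r_cont by (auto intro!: open_Collect_less continuous_intros)
qed

text \<open>The integrand is dominated by an average of the partial derivatives of \<open>f\<close>, cut off outside the set \<open>K'\<close>
  that contains all points entering averages over \<open>K\<close>. This localisation makes the estimate usable near
  the boundary.\<close>

lemma smooth_deriv_bound:
  assumes f: "C_k (Suc 0) f" and K: "compact K" "compact K'"
    and nb: "\<And>x y. x \<in> K \<Longrightarrow> norm y \<le> 1 \<Longrightarrow> x + r x *\<^sub>R y \<in> K'" and b: "b \<in> Basis"
  shows "integrable lborel (\<lambda>x. indicator K x * smooth_deriv b f x)" (is ?I)
    and "(\<integral>x. indicator K x * \<bar>smooth_deriv b f x\<bar> \<partial>lborel)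
      \<le> 2 * mollifier_bound * avg_const * (\<Sum>e\<in>Basis. \<integral>x. indicator K' x * \<bar>frechet_derivative f (at x) e\<bar> \<partial>lborel)" (is ?B)
proof -
  let ?\<rho> = "mollifier 1 :: 'a \<Rightarrow> real"
  define S where "S = (\<lambda>z. \<Sum>e\<in>Basis. \<bar>frechet_derivative f (at z) e\<bar>)"
  \<comment> \<open>The truncation makes the majorant integrable and restricts it to \<open>K'\<close>.\<close>
  define H where "H = (\<lambda>z. indicator K' z * S z)"
  have cS: "continuous_on T S" for T
    unfolding S_def by (intro continuous_intros continuous_on_frechet_derivative[OF f])
  have S0: "0 \<le> S z" for z unfolding S_def by (intro sum_nonneg) auto
  have H0: "0 \<le> H z" for z using S0 by (simp add: H_def)
  have intH: "integrable lborel H"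
    using borel_integrable_compact[OF K(2) cS] by (simp add: H_def)
  have kr: "kernel (2 * mollifier_bound) (\<lambda>x y. 2 * ?\<rho> y)"
    using kernel_mollifier unfolding kernel_def by (auto simp: abs_mult split_beta')
  have [measurable]: "K \<in> sets borel" "smooth_deriv b f \<in> borel_measurable borel"
    using K(1) smooth_deriv_measurable[OF f] by (auto intro: borel_compact)
  have pw: "indicator K x * \<bar>smooth_deriv b f x\<bar> \<le> average (\<lambda>x y. 2 * ?\<rho> y) H x" for x
  proof (cases "x \<in> K")
    case False
    then show ?thesis unfolding average_def
      using H0 by (auto intro!: Bochner_Integration.integral_nonneg mult_nonneg_nonneg mollifier_nonneg)
  next
    case True
    have eqH: "2 * ?\<rho> y * H (x + r x *\<^sub>R y) = 2 * ?\<rho> y * S (x + r x *\<^sub>R y)" for y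
      using nb[OF True, of y] mollifier_vanish'[of 1, where 'a = 'a] by (cases "norm y \<le> 1") (auto simp: H_def)
    have van: "\<forall>y::'a. 1 < norm y \<longrightarrow> ?\<rho> y = 0" by (rule mollifier_vanish') simp
    let ?v = "\<lambda>y. b + (Dr x \<bullet> b) *\<^sub>R y"
    let ?G = "\<lambda>y. ?\<rho> y * frechet_derivative f (at (x + r x *\<^sub>R y)) (?v y)"
    have cG: "continuous_on UNIV ?G"
      by (intro continuous_intros continuous_on_frechet_derivative[OF f] continuous_on_compose2[OF mollifier_continuous]) auto
    have "\<bar>smooth_deriv b f x\<bar> \<le> (\<integral>y. \<bar>?G y\<bar> \<partial>lborel)"
      unfolding smooth_deriv_def by (rule integral_abs_bound)
    also have "\<dots> \<le> (\<integral>y. 2 * ?\<rho> y * S (x + r x *\<^sub>R y) \<partial>lborel)"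
    proof (rule integral_le_integral)
      show "integrable lborel (\<lambda>y. \<bar>?G y\<bar>)"
        by (intro integrable_abs vanish_integrable[OF cG, of 1]) (use van in auto)
      show "integrable lborel (\<lambda>y. 2 * ?\<rho> y * S (x + r x *\<^sub>R y))"
        by (rule vanish_integrable[of _ 1])
           (use van in \<open>auto intro!: continuous_intros continuous_on_compose2[OF cS] continuous_on_compose2[OF mollifier_continuous]\<close>)
      show "\<bar>?G y\<bar> \<le> 2 * ?\<rho> y * S (x + r x *\<^sub>R y)" for y
      proof (cases "norm y \<le> 1")
        case True
        have "\<bar>Dr x \<bullet> b\<bar> \<le> 1 / 2"
          using Cauchy_Schwarz_ineq2[of "Dr x" b] Dr_le[of x] b by simp
        then have "\<bar>Dr x \<bullet> b\<bar> * norm y \<le> 1 * 1" using True by (intro mult_mono) auto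
        then have nv: "norm (?v y) \<le> 2"
          using norm_triangle_ineq[of b "(Dr x \<bullet> b) *\<^sub>R y"] b by simp
        have "\<bar>frechet_derivative f (at (x + r x *\<^sub>R y)) (?v y)\<bar> \<le> norm (?v y) * S (x + r x *\<^sub>R y)"
          unfolding S_def by (rule frechet_derivative_bound) (use f in auto)
        also have "\<dots> \<le> 2 * S (x + r x *\<^sub>R y)" using nv S0 by (intro mult_right_mono)
        finally have "?\<rho> y * \<bar>frechet_derivative f (at (x + r x *\<^sub>R y)) (?v y)\<bar> \<le> ?\<rho> y * (2 * S (x + r x *\<^sub>R y))"
          by (intro mult_left_mono mollifier_nonneg)
        then show ?thesis by (simp add: abs_mult mollifier_nonneg mult_ac)
      qed (use van in auto)
    qed
    also have "\<dots> = average (\<lambda>x y. 2 * ?\<rho> y) H x" unfolding average_def eqH ..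
    finally show ?thesis using True by simp
  qed
  have iA: "integrable lborel (average (\<lambda>x y. 2 * ?\<rho> y) H)" by (rule average_integrable[OF kr intH])
  show ?I
  proof (rule Bochner_Integration.integrable_bound[OF iA])
    show "AE x in lborel. norm (indicator K x * smooth_deriv b f x) \<le> norm (average (\<lambda>x y. 2 * ?\<rho> y) H x)"
    proof (rule AE_I2)
      fix x
      show "norm (indicator K x * smooth_deriv b f x) \<le> norm (average (\<lambda>x y. 2 * ?\<rho> y) H x)"
        using pw[of x] by (simp add: abs_mult)
    qed
  qed measurable
  then have "integrable lborel (\<lambda>x. \<bar>indicator K x * smooth_deriv b f x\<bar>)" by (rule integrable_abs)
  then have "(\<integral>x. indicator K x * \<bar>smooth_deriv b f x\<bar> \<partial>lborel) \<le> (\<integral>x. \<bar>average (\<lambda>x y. 2 * ?\<rho> y) H x\<bar> \<partial>lborel)"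
    by (intro integral_le_integral integrable_abs iA order_trans[OF pw abs_ge_self]) (simp add: abs_mult)
  also have "\<dots> \<le> (2 * mollifier_bound) * avg_const * (\<integral>x. \<bar>H x\<bar> \<partial>lborel)" by (rule average_norm_le[OF kr intH])
  also have "(\<integral>x. \<bar>H x\<bar> \<partial>lborel) = (\<integral>x. (\<Sum>e\<in>Basis. indicator K' x * \<bar>frechet_derivative f (at x) e\<bar>) \<partial>lborel)"
    using S0 by (simp add: H_def S_def abs_mult sum_distrib_left sum_nonneg)
  also have "\<dots> = (\<Sum>e\<in>Basis. \<integral>x. indicator K' x * \<bar>frechet_derivative f (at x) e\<bar> \<partial>lborel)"
  proof (rule Bochner_Integration.integral_sum)
    fix e :: 'a
    have "continuous_on K' (\<lambda>x. \<bar>frechet_derivative f (at x) e\<bar>)"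
      by (intro continuous_intros continuous_on_frechet_derivative[OF f])
    from borel_integrable_compact[OF K(2) this]
    show "integrable lborel (\<lambda>x. indicator K' x * \<bar>frechet_derivative f (at x) e\<bar>)" by simp
  qed
  finally show ?B .
qed

definition grad_const :: real where "grad_const = 2 * mollifier_bound * avg_const * DIM('a)"

lemma grad_const_nonneg: "0 \<le> grad_const"
  using mollifier_bound_nonneg avg_const_nonneg by (simp add: grad_const_def)

lemma mollified_smooth_deriv_bound:
  assumes f: "integrable lborel f" and K: "compact K" "compact K'"
    and nb: "\<And>x y. x \<in> K \<Longrightarrow> norm y \<le> 1 \<Longrightarrow> x + r x *\<^sub>R y \<in> K'" and b: "b \<in> Basis"
    and \<epsilon>: "\<epsilon> > 0" "(\<Union>z\<in>K'. cball z \<epsilon>) \<subseteq> V" and v: "variation f V \<le> ereal v"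
  shows "integrable lborel (\<lambda>x. indicator K x * smooth_deriv b (conv f (mollifier \<epsilon>)) x)"
    and "(\<integral>x. indicator K x * \<bar>smooth_deriv b (conv f (mollifier \<epsilon>)) x\<bar> \<partial>lborel) \<le> grad_const * v"
proof -
  note C1 = C_k_mollification[OF f \<epsilon>(1), of "Suc 0"]
  show "integrable lborel (\<lambda>x. indicator K x * smooth_deriv b (conv f (mollifier \<epsilon>)) x)"
    by (rule smooth_deriv_bound(1)[OF C1 K nb b])
  have "(\<integral>x. indicator K x * \<bar>smooth_deriv b (conv f (mollifier \<epsilon>)) x\<bar> \<partial>lborel)
    \<le> 2 * mollifier_bound * avg_const * (\<Sum>e\<in>Basis. \<integral>x. indicator K' x * \<bar>frechet_derivative (conv f (mollifier \<epsilon>)) (at x) e\<bar> \<partial>lborel)"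
    by (rule smooth_deriv_bound(2)[OF C1 K nb b])
  also have "\<dots> \<le> 2 * mollifier_bound * avg_const * (\<Sum>e\<in>(Basis::'a set). v)"
  proof (intro mult_left_mono sum_mono)
    fix e :: 'a assume e: "e \<in> Basis"
    from order_trans[OF mollified_gradient_bound[OF f K(2) \<epsilon> e] v]
    show "(\<integral>x. indicator K' x * \<bar>frechet_derivative (conv f (mollifier \<epsilon>)) (at x) e\<bar> \<partial>lborel) \<le> v" by simp
  qed (use mollifier_bound_nonneg avg_const_nonneg in auto)
  also have "\<dots> = grad_const * v" by (simp add: grad_const_def)
  finally show "(\<integral>x. indicator K x * \<bar>smooth_deriv b (conv f (mollifier \<epsilon>)) x\<bar> \<partial>lborel) \<le> grad_const * v" .
qed

lemma smoothing_integrable: "integrable lborel f \<Longrightarrow> integrable lborel (smoothing f)"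
  unfolding smoothing_def by (rule average_integrable[OF kernel_mollifier])

lemma smoothing_norm_le: "integrable lborel f \<Longrightarrow> (\<integral>x. \<bar>smoothing f x\<bar> \<partial>lborel) \<le> mollifier_bound * avg_const * (\<integral>x. \<bar>f x\<bar> \<partial>lborel)"
  unfolding smoothing_def by (rule average_norm_le[OF kernel_mollifier])

text \<open>Stability in \<open>L1\<close>, the tool for passing from mollified functions to the given one.\<close>

lemma smoothing_test_diff:
  assumes f: "integrable lborel f" and g: "integrable lborel g"
    and p: "p \<in> borel_measurable borel" "\<And>x. \<bar>p x\<bar> \<le> L" "0 \<le> L"
    and e: "(\<integral>x. \<bar>g x - f x\<bar> \<partial>lborel) \<le> e" and q: "kernel Q q"
  shows "\<bar>(\<integral>x. average q f x * p x \<partial>lborel) - (\<integral>x. average q g x * p x \<partial>lborel)\<bar> \<le> L * (Q * avg_const * e)"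
proof -
  have i: "integrable lborel (average q f)" "integrable lborel (average q g)"
    using average_integrable[OF q] f g by auto
  have "(\<integral>x. average q f x * p x \<partial>lborel) - (\<integral>x. average q g x * p x \<partial>lborel)
      = (\<integral>x. (average q f x - average q g x) * p x \<partial>lborel)"
    using integrable_mult_bounded[OF i(1) p(1,2)] integrable_mult_bounded[OF i(2) p(1,2)] by (simp add: left_diff_distrib)
  moreover have "\<bar>\<integral>x. (average q f x - average q g x) * p x \<partial>lborel\<bar> \<le> L * (\<integral>x. \<bar>average q f x - average q g x\<bar> \<partial>lborel)"
    using i by (intro abs_integral_mult_le p) auto
  moreover have "L * (\<integral>x. \<bar>average q f x - average q g x\<bar> \<partial>lborel) \<le> L * (Q * avg_const * e)"
  proof (rule mult_left_mono[OF _ p(3)])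
    have "(\<integral>x. \<bar>average q f x - average q g x\<bar> \<partial>lborel) \<le> Q * avg_const * (\<integral>x. \<bar>f x - g x\<bar> \<partial>lborel)"
      by (rule average_diff_le[OF q f g])
    also have "\<dots> \<le> Q * avg_const * e"
      using e q avg_const_nonneg by (intro mult_left_mono) (auto simp: kernel_def abs_minus_commute)
    finally show "(\<integral>x. \<bar>average q f x - average q g x\<bar> \<partial>lborel) \<le> Q * avg_const * e" .
  qed
  ultimately show ?thesis by linarith
qed

lemma small_multiple:
  fixes M :: real
  assumes "0 \<le> M" "\<eta> > 0"
  shows "\<exists>e>0. M * e \<le> \<eta>"
  using assms by (intro exI[of _ "\<eta> / (M + 1)"]) (auto simp: field_simps)

text \<open>Mollified functions satisfy the estimate, with a mollification radius so small that only \<open>V\<close> is seen.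
  Both sides of the identity pass to the limit because the smoothing is continuous on \<open>L1\<close>. The lemma is
  applied close to the boundary, where no weak gradient is known yet.\<close>

lemma smoothing_weak_bound:
  assumes f: "integrable lborel f" and \<zeta>: "C_k (Suc 0) \<zeta>" "\<And>x. x \<notin> K \<Longrightarrow> \<zeta> x = 0" "\<And>x. \<bar>\<zeta> x\<bar> \<le> B" "0 \<le> B"
    and K: "compact K" "compact K'"
    and nb: "\<And>x y. x \<in> K \<Longrightarrow> norm y \<le> 1 \<Longrightarrow> x + r x *\<^sub>R y \<in> K'" and b: "b \<in> Basis"
    and V: "open V" "K' \<subseteq> V" and v: "variation f V \<le> ereal v"
  shows "\<bar>\<integral>x. smoothing f x * frechet_derivative \<zeta> (at x) b \<partial>lborel\<bar> \<le> B * (grad_const * v)"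
proof (rule field_le_epsilon)
  fix \<eta> :: real assume "\<eta> > 0"
  let ?D\<zeta> = "\<lambda>x. frechet_derivative \<zeta> (at x) b"
  obtain R where R: "\<forall>x\<in>K. norm x \<le> R" using compact_imp_bounded[OF K(1)] by (auto simp: bounded_iff)
  then have van: "\<forall>x. R < norm x \<longrightarrow> \<zeta> x = 0" using \<zeta>(2) by force
  have c\<zeta>: "continuous_on UNIV \<zeta>" "continuous_on UNIV ?D\<zeta>"
    using C_k_continuous[OF \<zeta>(1)] C_1_continuous_derivative[OF \<zeta>(1)] by auto
  then have [measurable]: "\<zeta> \<in> borel_measurable borel" "?D\<zeta> \<in> borel_measurable borel"
    by (auto intro: borel_measurable_continuous_onI)
  obtain L where L: "L > 0" "\<And>x. norm (?D\<zeta> x) \<le> L"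
    using vanish_bounded[OF c\<zeta>(2) frechet_derivative_vanish[OF van]] by blast
  have "0 \<le> L * (mollifier_bound * avg_const)" using L(1) mollifier_bound_nonneg avg_const_nonneg by simp
  then obtain e where e: "e > 0" "L * (mollifier_bound * avg_const) * e \<le> \<eta>" using small_multiple \<open>\<eta> > 0\<close> by blast
  obtain \<delta> where \<delta>: "\<delta> > 0" "(\<Union>z\<in>K'. ball z \<delta>) \<subseteq> V"
    using compact_subset_open_imp_ball_epsilon_subset[OF K(2) V] by blast
  obtain \<epsilon> where \<epsilon>: "\<epsilon> > 0" "\<epsilon> < \<delta>" "integrable lborel (conv f (mollifier \<epsilon>))"
    "(\<integral>x. \<bar>conv f (mollifier \<epsilon>) x - f x\<bar> \<partial>lborel) \<le> e"
    using mollify_close[OF f e(1) \<delta>(1)] by blast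
  define g where "g = conv f (mollifier \<epsilon>)"
  have "(\<Union>z\<in>K'. cball z \<epsilon>) \<subseteq> V" using \<delta>(2) \<epsilon>(2) by force
  note bd = mollified_smooth_deriv_bound[OF f K nb b \<epsilon>(1) this v, folded g_def]
  have "\<bar>(\<integral>x. smoothing f x * ?D\<zeta> x \<partial>lborel) - (\<integral>x. smoothing g x * ?D\<zeta> x \<partial>lborel)\<bar> \<le> L * (mollifier_bound * avg_const * e)"
    unfolding smoothing_def
    by (rule smoothing_test_diff[OF f _ _ _ _ _ kernel_mollifier]) (use \<epsilon> L in \<open>auto simp: g_def\<close>)
  moreover have "(\<integral>x. smoothing g x * ?D\<zeta> x \<partial>lborel) = - (\<integral>x. smooth_deriv b g x * \<zeta> x \<partial>lborel)"
    by (rule smoothing_weak_derivative[OF _ \<zeta>(1) van b]) (simp add: g_def C_k_mollification[OF f \<epsilon>(1)])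
  moreover have "\<bar>\<integral>x. smooth_deriv b g x * \<zeta> x \<partial>lborel\<bar> \<le> B * (grad_const * v)"
  proof -
    have "(\<integral>x. smooth_deriv b g x * \<zeta> x \<partial>lborel) = (\<integral>x. (indicator K x * smooth_deriv b g x) * \<zeta> x \<partial>lborel)"
      by (intro Bochner_Integration.integral_cong) (use \<zeta>(2) in \<open>auto simp: indicator_def\<close>)
    also have "\<bar>\<dots>\<bar> \<le> B * (\<integral>x. \<bar>indicator K x * smooth_deriv b g x\<bar> \<partial>lborel)"
      by (rule abs_integral_mult_le[OF bd(1)]) (use \<zeta>(3) in auto)
    also have "\<dots> \<le> B * (grad_const * v)"
      using bd(2) \<zeta>(4) by (intro mult_left_mono) (simp_all add: abs_mult)
    finally show ?thesis .
  qed
  ultimately show "\<bar>\<integral>x. smoothing f x * ?D\<zeta> x \<partial>lborel\<bar> \<le> B * (grad_const * v) + \<eta>"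
    using e(2) by (simp add: mult.assoc)
qed

lemma shift_in_neighbourhood: "x \<in> K \<Longrightarrow> norm y \<le> 1 \<Longrightarrow> x + r x *\<^sub>R y \<in> (\<Union>z\<in>K. cball z 1)"
  using r_nonneg[of x] r_le_1[of x] by (intro UN_I[of x]) (auto simp: dist_norm intro!: mult_le_one)

lemma indicator_average: "indicator K x * average q f x = average (\<lambda>x y. indicator K x * q x y) f x"
  by (simp add: average_def mult.assoc)

text \<open>On \<open>K\<close> the averages with the gradient kernel depend continuously on \<open>f\<close> in \<open>L1\<close>, and for mollified
  functions they are derivatives of smoothings, bounded by the variation. The continuity may deteriorate as
  \<open>K\<close> grows, whereas the resulting bound does not.\<close>

lemma average_grad_bound_compact:
  assumes f: "integrable lborel f" and K: "compact K" "K \<subseteq> U" and b: "b \<in> Basis"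
    and v: "variation f UNIV \<le> ereal v"
  shows "integrable lborel (\<lambda>x. indicator K x * average (grad_kernel b) f x)"
    and "(\<integral>x. \<bar>indicator K x * average (grad_kernel b) f x\<bar> \<partial>lborel) \<le> grad_const * v"
proof -
  let ?q = "\<lambda>x y. indicator K x * grad_kernel b x y"
  obtain Q where Q: "kernel Q ?q" using ex_kernel_grad[OF K b] by blast
  show "integrable lborel (\<lambda>x. indicator K x * average (grad_kernel b) f x)"
    unfolding indicator_average by (rule average_integrable[OF Q f])
  show "(\<integral>x. \<bar>indicator K x * average (grad_kernel b) f x\<bar> \<partial>lborel) \<le> grad_const * v"
  proof (rule field_le_epsilon)
    fix \<eta> :: real assume "\<eta> > 0"
    have "0 \<le> Q * avg_const" using Q avg_const_nonneg by (simp add: kernel_def)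
    then obtain e where e: "e > 0" "Q * avg_const * e \<le> \<eta>" using small_multiple \<open>\<eta> > 0\<close> by blast
    obtain \<epsilon> where \<epsilon>: "\<epsilon> > 0" "integrable lborel (conv f (mollifier \<epsilon>))"
      "(\<integral>x. \<bar>conv f (mollifier \<epsilon>) x - f x\<bar> \<partial>lborel) \<le> e"
      using mollify_close[OF f e(1), of 1] by auto
    define g where "g = conv f (mollifier \<epsilon>)"
    have ig: "integrable lborel g" using \<epsilon> by (simp add: g_def)
    note bd = mollified_smooth_deriv_bound[OF f K(1) compact_neighbourhood[OF K(1)] shift_in_neighbourhood b \<epsilon>(1) _ v, folded g_def]
    have eq: "average ?q g x = indicator K x * smooth_deriv b g x" for x
      unfolding indicator_average[symmetric] using smooth_deriv_eq_average[OF C_k_mollification[OF f \<epsilon>(1)], of x b] K(2)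
      by (cases "x \<in> K") (auto simp: g_def)
    have "(\<integral>x. \<bar>average ?q f x\<bar> \<partial>lborel) \<le> (\<integral>x. \<bar>average ?q g x\<bar> + \<bar>average ?q f x - average ?q g x\<bar> \<partial>lborel)"
      using average_integrable[OF Q f] average_integrable[OF Q ig] by (intro integral_le_integral) auto
    also have "\<dots> = (\<integral>x. \<bar>average ?q g x\<bar> \<partial>lborel) + (\<integral>x. \<bar>average ?q f x - average ?q g x\<bar> \<partial>lborel)"
      using average_integrable[OF Q f] average_integrable[OF Q ig] by (intro Bochner_Integration.integral_add) auto
    also have "(\<integral>x. \<bar>average ?q g x\<bar> \<partial>lborel) \<le> grad_const * v"
      unfolding eq abs_mult using bd(2) by simp
    also have "(\<integral>x. \<bar>average ?q f x - average ?q g x\<bar> \<partial>lborel) \<le> Q * avg_const * (\<integral>x. \<bar>f x - g x\<bar> \<partial>lborel)"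
      by (rule average_diff_le[OF Q f ig])
    also have "\<dots> \<le> Q * avg_const * e"
      using \<epsilon>(3) Q avg_const_nonneg by (intro mult_left_mono) (auto simp: kernel_def g_def abs_minus_commute)
    also have "\<dots> \<le> \<eta>" by (rule e(2))
    finally show "(\<integral>x. \<bar>indicator K x * average (grad_kernel b) f x\<bar> \<partial>lborel) \<le> grad_const * v + \<eta>"
      unfolding indicator_average by simp
  qed
qed

lemma smoothing_weak_gradient_inside:
  assumes f: "integrable lborel f" and \<zeta>: "\<zeta> \<in> test_functions U" and b: "b \<in> Basis"
  shows "(\<integral>x. smoothing f x * frechet_derivative \<zeta> (at x) b \<partial>lborel) = - (\<integral>x. average (grad_kernel b) f x * \<zeta> x \<partial>lborel)"
proof -
  let ?D\<zeta> = "\<lambda>x. frechet_derivative \<zeta> (at x) b"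
  note \<zeta>C = test_functionsD(1)[OF \<zeta>, of "Suc 0"]
  obtain K where K: "compact K" "K \<subseteq> U" "\<forall>x. x \<notin> K \<longrightarrow> \<zeta> x = 0" using test_functionsD(2)[OF \<zeta>] by blast
  obtain R where van: "\<forall>x. R < norm x \<longrightarrow> \<zeta> x = 0" using test_functionsD(4)[OF \<zeta>] by blast
  have c\<zeta>: "continuous_on UNIV \<zeta>" "continuous_on UNIV ?D\<zeta>"
    using C_k_continuous[OF \<zeta>C] C_1_continuous_derivative[OF \<zeta>C] by auto
  then have [measurable]: "\<zeta> \<in> borel_measurable borel" "?D\<zeta> \<in> borel_measurable borel"
    by (auto intro: borel_measurable_continuous_onI)
  obtain L where L: "L > 0" "\<And>x. norm (?D\<zeta> x) \<le> L"
    using vanish_bounded[OF c\<zeta>(2) frechet_derivative_vanish[OF van]] by blast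
  obtain B where B: "B > 0" "\<And>x. norm (\<zeta> x) \<le> B" using vanish_bounded[OF c\<zeta>(1) van] by blast
  let ?q = "\<lambda>x y. indicator K x * grad_kernel b x y"
  obtain Q where Q: "kernel Q ?q" using ex_kernel_grad[OF K(1,2) b] by blast
  have restr: "(\<integral>x. average (grad_kernel b) f x * \<zeta> x \<partial>lborel) = (\<integral>x. average ?q f x * \<zeta> x \<partial>lborel)"
    unfolding indicator_average[symmetric] using K(3) by (intro Bochner_Integration.integral_cong) (auto simp: indicator_def)
  let ?M = "L * (mollifier_bound * avg_const) + B * (Q * avg_const)"
  have "\<bar>(\<integral>x. smoothing f x * ?D\<zeta> x \<partial>lborel) + (\<integral>x. average ?q f x * \<zeta> x \<partial>lborel)\<bar> \<le> 0"
  proof (rule field_le_epsilon)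
    fix \<eta> :: real assume "\<eta> > 0"
    have "0 \<le> ?M" using L(1) B(1) Q mollifier_bound_nonneg avg_const_nonneg by (auto simp: kernel_def)
    then obtain e where e: "e > 0" "?M * e \<le> \<eta>" using small_multiple \<open>\<eta> > 0\<close> by blast
    obtain \<epsilon> where \<epsilon>: "\<epsilon> > 0" "integrable lborel (conv f (mollifier \<epsilon>))"
      "(\<integral>x. \<bar>conv f (mollifier \<epsilon>) x - f x\<bar> \<partial>lborel) \<le> e"
      using mollify_close[OF f e(1), of 1] by auto
    define g where "g = conv f (mollifier \<epsilon>)"
    have gC: "C_k (Suc 0) g" by (simp add: g_def C_k_mollification[OF f \<epsilon>(1)])
    have "(\<integral>x. smoothing g x * ?D\<zeta> x \<partial>lborel) = - (\<integral>x. smooth_deriv b g x * \<zeta> x \<partial>lborel)"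
      by (rule smoothing_weak_derivative[OF gC \<zeta>C van b])
    also have "(\<integral>x. smooth_deriv b g x * \<zeta> x \<partial>lborel) = (\<integral>x. average ?q g x * \<zeta> x \<partial>lborel)"
    proof (intro Bochner_Integration.integral_cong refl)
      fix x show "smooth_deriv b g x * \<zeta> x = average ?q g x * \<zeta> x"
        unfolding indicator_average[symmetric] using smooth_deriv_eq_average[OF gC, of x b] K(2,3)
        by (cases "x \<in> K") auto
    qed
    finally have eq: "(\<integral>x. smoothing g x * ?D\<zeta> x \<partial>lborel) = - (\<integral>x. average ?q g x * \<zeta> x \<partial>lborel)" .
    have d1: "\<bar>(\<integral>x. smoothing f x * ?D\<zeta> x \<partial>lborel) - (\<integral>x. smoothing g x * ?D\<zeta> x \<partial>lborel)\<bar> \<le> L * (mollifier_bound * avg_const * e)"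
      unfolding smoothing_def
      by (rule smoothing_test_diff[OF f _ _ _ _ _ kernel_mollifier]) (use \<epsilon> L in \<open>auto simp: g_def\<close>)
    have d2: "\<bar>(\<integral>x. average ?q f x * \<zeta> x \<partial>lborel) - (\<integral>x. average ?q g x * \<zeta> x \<partial>lborel)\<bar> \<le> B * (Q * avg_const * e)"
      by (rule smoothing_test_diff[OF f _ _ _ _ _ Q]) (use \<epsilon> B in \<open>auto simp: g_def\<close>)
    have "L * (mollifier_bound * avg_const * e) + B * (Q * avg_const * e) \<le> \<eta>" using e(2) by (simp add: algebra_simps)
    with d1 d2 eq show "\<bar>(\<integral>x. smoothing f x * ?D\<zeta> x \<partial>lborel) + (\<integral>x. average ?q f x * \<zeta> x \<partial>lborel)\<bar> \<le> 0 + \<eta>"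
      by linarith
  qed
  then show ?thesis unfolding restr by linarith
qed

text \<open>Exhaust \<open>U\<close> by compact sets; the bounds on them are uniform.\<close>

lemma average_grad_bound:
  assumes f: "integrable lborel f" and b: "b \<in> Basis" and v: "variation f UNIV \<le> ereal v"
  shows "integrable lborel (\<lambda>x. indicator U x * average (grad_kernel b) f x)"
    and "(\<integral>x. \<bar>indicator U x * average (grad_kernel b) f x\<bar> \<partial>lborel) \<le> grad_const * v"
proof -
  let ?G = "average (grad_kernel b) f"
  obtain C where C: "\<And>n. compact (C n)" "\<And>n. C n \<subseteq> U" "\<And>n. C n \<subseteq> interior (C (Suc n))" "\<Union>(range C) = U"
    using open_Union_compact_subsets[OF U_open] by metis
  have inc: "incseq C"
    using C(3) interior_subset by (intro incseq_SucI) blast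
  have [measurable]: "C n \<in> sets borel" for n using C(1) by (rule borel_compact)
  have mU[measurable]: "U \<in> sets borel" using U_open by simp
  have mf[measurable]: "f \<in> borel_measurable borel" using f by auto
  have [measurable]: "?G \<in> borel_measurable borel"
  proof -
    have [measurable]: "(\<lambda>(x, y). grad_kernel b x y) \<in> borel_measurable (borel \<Otimes>\<^sub>M lborel)"
      using grad_kernel_measurable by (simp cong: measurable_cong_sets)
    have "(\<lambda>(x, y). grad_kernel b x y * f (x + r x *\<^sub>R y)) \<in> borel_measurable (borel \<Otimes>\<^sub>M lborel)" by measurable
    from lborel.borel_measurable_lebesgue_integral[OF this] show ?thesis by (simp add: average_def[abs_def])
  qed
  have nn: "0 \<le> grad_const * v"
    by (rule order_trans[OF _ average_grad_bound_compact(2)[OF f C(1,2) b v, of 0]]) auto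
  have SUP: "(SUP n. indicator (C n) x * ennreal \<bar>?G x\<bar>) = indicator U x * ennreal \<bar>?G x\<bar>" for x
  proof (rule antisym)
    show "(SUP n. indicator (C n) x * ennreal \<bar>?G x\<bar>) \<le> indicator U x * ennreal \<bar>?G x\<bar>"
      using C(2) by (intro SUP_least mult_right_mono) (auto simp: indicator_def)
    show "indicator U x * ennreal \<bar>?G x\<bar> \<le> (SUP n. indicator (C n) x * ennreal \<bar>?G x\<bar>)"
    proof (cases "x \<in> U")
      case True
      then obtain n where "x \<in> C n" using C(4) by blast
      then show ?thesis using True by (intro SUP_upper2[of n]) auto
    qed simp
  qed
  have "(\<integral>\<^sup>+x. ennreal \<bar>indicator U x * ?G x\<bar> \<partial>lborel) = (\<integral>\<^sup>+x. (SUP n. indicator (C n) x * ennreal \<bar>?G x\<bar>) \<partial>lborel)"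
    unfolding SUP by (intro nn_integral_cong) (auto simp: indicator_def)
  also have "\<dots> = (SUP n. (\<integral>\<^sup>+x. indicator (C n) x * ennreal \<bar>?G x\<bar> \<partial>lborel))"
  proof (rule nn_integral_monotone_convergence_SUP)
    show "incseq (\<lambda>n x. indicator (C n) x * ennreal \<bar>?G x\<bar>)"
      using inc by (auto simp: incseq_def le_fun_def indicator_def subset_iff)
  qed measurable
  also have "\<dots> \<le> ennreal (grad_const * v)"
  proof (rule SUP_least)
    fix n
    have "(\<integral>\<^sup>+x. indicator (C n) x * ennreal \<bar>?G x\<bar> \<partial>lborel) = (\<integral>\<^sup>+x. ennreal \<bar>indicator (C n) x * ?G x\<bar> \<partial>lborel)"
      by (intro nn_integral_cong) (auto simp: indicator_def)
    also have "\<dots> = ennreal (\<integral>x. \<bar>indicator (C n) x * ?G x\<bar> \<partial>lborel)"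
      using average_grad_bound_compact(1)[OF f C(1,2) b v, of n] by (intro nn_integral_eq_integral) auto
    also have "\<dots> \<le> ennreal (grad_const * v)"
      by (intro ennreal_leI average_grad_bound_compact(2)[OF f C(1,2) b v])
    finally show "(\<integral>\<^sup>+x. indicator (C n) x * ennreal \<bar>?G x\<bar> \<partial>lborel) \<le> ennreal (grad_const * v)" .
  qed
  finally have le: "(\<integral>\<^sup>+x. ennreal \<bar>indicator U x * ?G x\<bar> \<partial>lborel) \<le> ennreal (grad_const * v)" .
  show int: "integrable lborel (\<lambda>x. indicator U x * ?G x)"
    unfolding integrable_iff_bounded using le by (auto intro: le_less_trans)
  have "ennreal (\<integral>x. \<bar>indicator U x * ?G x\<bar> \<partial>lborel) = (\<integral>\<^sup>+x. ennreal \<bar>indicator U x * ?G x\<bar> \<partial>lborel)"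
    using int by (intro nn_integral_eq_integral[symmetric]) auto
  with le have "ennreal (\<integral>x. \<bar>indicator U x * ?G x\<bar> \<partial>lborel) \<le> ennreal (grad_const * v)" by (simp only:)
  then show "(\<integral>x. \<bar>indicator U x * ?G x\<bar> \<partial>lborel) \<le> grad_const * v" using nn by (simp only: ennreal_le_iff)
qed

end

section \<open>Integrable weak gradients and variation\<close>

lemma L1_subset: "g \<in> L1 U \<Longrightarrow> S \<subseteq> U \<Longrightarrow> S \<in> sets lebesgue \<Longrightarrow> set_integrable lebesgue S g"
  unfolding L1_def by (auto intro: set_integrable_subset)

lemma L1_imp_L1_loc: "g \<in> L1 U \<Longrightarrow> g \<in> L1_loc U"
  unfolding L1_loc_def by (auto intro!: L1_subset borel_compact)

text \<open>Local integrability gives measurability only on compact subsets; a countable exhaustion extends it to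
  \<open>U\<close>.\<close>

lemma L1_loc_measurable:
  fixes g :: "'a::euclidean_space \<Rightarrow> 'b::euclidean_space"
  assumes "open U" "g \<in> L1_loc U"
  shows "(\<lambda>x. indicator U x *\<^sub>R g x) \<in> borel_measurable lebesgue"
proof -
  obtain C where C: "\<And>n. compact (C n)" "\<And>n. C n \<subseteq> U" "\<And>n. C n \<subseteq> interior (C (Suc n))" "\<Union>(range C) = U"
    using open_Union_compact_subsets[OF assms(1)] by metis
  have inc: "incseq C" using C(3) interior_subset by (intro incseq_SucI) blast
  show ?thesis
  proof (rule borel_measurable_LIMSEQ_metric)
    show "(\<lambda>x. indicator (C n) x *\<^sub>R g x) \<in> borel_measurable lebesgue" for n
    proof -
      have "set_integrable lebesgue (C n) g" using assms(2) C(1,2) by (auto simp: L1_loc_def)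
      then show ?thesis unfolding set_integrable_def by (rule borel_measurable_integrable)
    qed
    fix x
    show "(\<lambda>n. indicator (C n) x *\<^sub>R g x) \<longlonglongrightarrow> indicator U x *\<^sub>R g x"
    proof (cases "x \<in> U")
      case True
      then obtain n where n: "x \<in> C n" using C(4) by blast
      show ?thesis
      proof (rule tendsto_eventually)
        show "\<forall>\<^sub>F m in sequentially. indicator (C m) x *\<^sub>R g x = indicator U x *\<^sub>R g x"
          unfolding eventually_sequentially
          using n True inc by (intro exI[of _ n]) (auto simp: incseq_def indicator_def subset_iff)
      qed
    next
      case False
      then have "x \<notin> C n" for n using C(2) by blast
      then show ?thesis using False by simp
    qed
  qed
qed

lemma weak_gradient_norm:
  assumes U: "open U" and h: "has_weak_gradient U u h" "h \<in> L1 U"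
  shows "has_weak_gradient U u (weak_gradient U u)" "weak_gradient U u \<in> L1 U"
    "L1_norm U (weak_gradient U u) = L1_norm U h"
proof -
  show wg: "has_weak_gradient U u (weak_gradient U u)"
    unfolding weak_gradient_def by (rule someI[of "has_weak_gradient U u" h, OF h(1)])
  have ae: "AE x in lebesgue. x \<in> U \<longrightarrow> weak_gradient U u x = h x"
    by (rule weak_gradient_unique[OF U wg h(1)])
  have m: "(\<lambda>x. indicator U x *\<^sub>R weak_gradient U u x) \<in> borel_measurable lebesgue"
    "(\<lambda>x. indicator U x *\<^sub>R h x) \<in> borel_measurable lebesgue"
    using wg h(1) by (auto simp: has_weak_gradient_def intro: L1_loc_measurable[OF U])
  have ae': "AE x in lebesgue. indicator U x *\<^sub>R weak_gradient U u x = indicator U x *\<^sub>R h x"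
    using ae by eventually_elim (auto simp: indicator_def)
  have "integrable lebesgue (\<lambda>x. indicator U x *\<^sub>R weak_gradient U u x)"
    using h(2) by (subst integrable_cong_AE[OF m ae']) (simp add: L1_def set_integrable_def)
  then show "weak_gradient U u \<in> L1 U" by (simp add: L1_def set_integrable_def)
  have "(\<integral>x. norm (indicator U x *\<^sub>R weak_gradient U u x) \<partial>lebesgue) = (\<integral>x. norm (indicator U x *\<^sub>R h x) \<partial>lebesgue)"
  proof (rule integral_cong_AE)
    show "AE x in lebesgue. norm (indicator U x *\<^sub>R weak_gradient U u x) = norm (indicator U x *\<^sub>R h x)"
      using ae' by eventually_elim (simp only:)
    show "(\<lambda>x. norm (indicator U x *\<^sub>R weak_gradient U u x)) \<in> borel_measurable lebesgue"
      by (rule measurable_compose[OF m(1) borel_measurable_norm])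
    show "(\<lambda>x. norm (indicator U x *\<^sub>R h x)) \<in> borel_measurable lebesgue"
      by (rule measurable_compose[OF m(2) borel_measurable_norm])
  qed
  then show "L1_norm U (weak_gradient U u) = L1_norm U h"
    by (simp add: L1_norm_def set_lebesgue_integral_def)
qed

lemma variation_nonneg: "0 \<le> variation u U"
proof -
  have "(\<lambda>x. 0) \<in> {v \<in> test_functions U. \<forall>x. norm (v x) \<le> 1}"
    by (auto intro!: test_functionsI[where K = "{}"] C_k_const)
  then have "ereal (LINT x:U|lebesgue. u x * divergence (\<lambda>x. 0) x) \<le> variation u U"
    unfolding variation_def by (rule SUP_upper)
  then show ?thesis by (simp add: divergence_def zero_ereal_def)
qed

lemma divergence_continuous:
  assumes "C_k (Suc 0) v"
  shows "continuous_on UNIV (divergence v)"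
  unfolding divergence_def[abs_def]
  by (intro continuous_intros continuous_on_frechet_derivative[OF assms])

lemma variation_cong_AE:
  assumes f: "integrable lebesgue f" and g: "integrable lebesgue g" and ae: "AE x in lebesgue. f x = g x" and U: "open U"
  shows "variation f U = variation g U"
proof -
  have "(LINT x:U|lebesgue. f x * divergence v x) = (LINT x:U|lebesgue. g x * divergence v x)" if "v \<in> test_functions U" for v
  proof -
    have m: "divergence v \<in> borel_measurable lebesgue"
      using divergence_continuous[OF test_functionsD(1)[OF that]]
      by (intro measurable_completion) (simp add: borel_measurable_continuous_onI)
    have [measurable]: "U \<in> sets lebesgue" using U by (simp add: borel_open)
    show ?thesis unfolding set_lebesgue_integral_def
      by (rule integral_cong_AE) (use f g ae m in auto)
  qed
  then show ?thesis unfolding variation_def by (intro SUP_cong) auto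
qed

lemma variation_in_cong_AE:
  assumes "integrable lebesgue f" "integrable lebesgue g" "AE x in lebesgue. f x = g x"
  shows "variation_in U f F = variation_in U g F"
  unfolding variation_in_def using variation_cong_AE[OF assms] by (intro INF_cong) auto

text \<open>Apply the definition of the weak gradient to each component of an admissible field and sum up.
  Therefore Sobolev functions have bounded variation, and the given extension operator applies to
  them.\<close>

lemma variation_le_weak_gradient:
  fixes U :: "'a::euclidean_space set"
  assumes U: "open U" and g: "has_weak_gradient U u g" "g \<in> L1 U"
  shows "variation u U \<le> ereal (L1_norm U g)"
  unfolding variation_def
proof (rule SUP_least)
  fix v :: "'a \<Rightarrow> 'a" assume "v \<in> {v \<in> test_functions U. \<forall>x. norm (v x) \<le> 1}"
  then have v: "v \<in> test_functions U" "\<And>x. norm (v x) \<le> 1" by auto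
  obtain K where K: "compact K" "K \<subseteq> U" "\<forall>x. x \<notin> K \<longrightarrow> v x = 0" using test_functionsD(2)[OF v(1)] by blast
  have vb: "(\<lambda>x. v x \<bullet> b) \<in> test_functions U" for b
    by (rule test_functionsI[OF _ K(1,2)])
       (use K(3) C_k_bounded_linear[OF bounded_linear_inner_left test_functionsD(1)[OF v(1)]] in auto)
  have Dvb: "frechet_derivative (\<lambda>x. v x \<bullet> b) (at x) e = frechet_derivative v (at x) e \<bullet> b" for x e b
  proof -
    have "((\<lambda>x. v x \<bullet> b) has_derivative (\<lambda>h. frechet_derivative v (at x) h \<bullet> b)) (at x)"
      using C_k_SucD(1)[OF test_functionsD(1)[OF v(1), of "Suc 0"]] by (auto intro!: derivative_eq_intros)
    then show ?thesis by (rule frechet_derivative_eqI)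
  qed
  have u: "u \<in> L1_loc U" "g \<in> L1_loc U" using g(1) by (auto simp: has_weak_gradient_def)
  have c: "continuous_on UNIV (\<lambda>x. v x \<bullet> b)" "continuous_on UNIV (\<lambda>x. frechet_derivative (\<lambda>x. v x \<bullet> b) (at x) b)" for b
    using C_k_continuous[OF test_functionsD(1)[OF vb]] C_1_continuous_derivative[OF test_functionsD(1)[OF vb]] by auto
  have vanD: "frechet_derivative (\<lambda>x. v x \<bullet> b) (at x) b = 0" if "x \<notin> K" for x b
    by (rule frechet_derivative_eq_0_open[of "- K"]) (use K that compact_imp_closed in auto)
  have i1: "set_integrable lebesgue U (\<lambda>x. u x * frechet_derivative (\<lambda>x. v x \<bullet> b) (at x) b)" for b
    by (rule L1_loc_mult_test[OF u(1) c(2) K(1,2) vanD])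
  have i2: "set_integrable lebesgue U (\<lambda>x. (g x \<bullet> b) * (v x \<bullet> b))" for b
    by (rule L1_loc_mult_test[OF L1_loc_inner[OF u(2)] c(1) K(1,2)]) (use K(3) in auto)
  have "(LINT x:U|lebesgue. u x * divergence v x) = (LINT x:U|lebesgue. (\<Sum>b\<in>Basis. u x * frechet_derivative (\<lambda>x. v x \<bullet> b) (at x) b))"
    by (simp add: divergence_def Dvb sum_distrib_left)
  also have "\<dots> = (\<Sum>b\<in>Basis. LINT x:U|lebesgue. u x * frechet_derivative (\<lambda>x. v x \<bullet> b) (at x) b)"
    using i1 unfolding set_lebesgue_integral_def set_integrable_def scaleR_sum_right
    by (intro Bochner_Integration.integral_sum) auto
  also have "\<dots> = (\<Sum>b\<in>Basis. - (LINT x:U|lebesgue. (g x \<bullet> b) * (v x \<bullet> b)))"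
    using g(1) vb unfolding has_weak_gradient_def by (intro sum.cong) auto
  also have "\<dots> = - (LINT x:U|lebesgue. g x \<bullet> v x)"
  proof -
    have "(LINT x:U|lebesgue. g x \<bullet> v x) = (LINT x:U|lebesgue. (\<Sum>b\<in>Basis. (g x \<bullet> b) * (v x \<bullet> b)))"
      by (simp add: euclidean_inner[symmetric])
    also have "\<dots> = (\<Sum>b\<in>Basis. LINT x:U|lebesgue. (g x \<bullet> b) * (v x \<bullet> b))"
      using i2 unfolding set_lebesgue_integral_def set_integrable_def scaleR_sum_right
      by (intro Bochner_Integration.integral_sum) auto
    finally show ?thesis by (simp add: sum_negf)
  qed
  also have "\<dots> \<le> L1_norm U g"
  proof -
    have "norm (\<integral>x. indicator U x *\<^sub>R (g x \<bullet> v x) \<partial>lebesgue) \<le> (\<integral>x. indicator U x *\<^sub>R norm (g x) \<partial>lebesgue)"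
    proof (rule Bochner_Integration.integral_norm_bound_integral)
      show "integrable lebesgue (\<lambda>x. indicator U x *\<^sub>R (g x \<bullet> v x))"
      proof -
        have "integrable lebesgue (\<lambda>x. \<Sum>b\<in>Basis. indicator U x *\<^sub>R ((g x \<bullet> b) * (v x \<bullet> b)))"
          using i2 unfolding set_integrable_def by (intro Bochner_Integration.integrable_sum) auto
        then show ?thesis by (simp add: euclidean_inner[of "g _" "v _"] sum_distrib_left)
      qed
      show "integrable lebesgue (\<lambda>x. indicator U x *\<^sub>R norm (g x))"
        using integrable_norm[of lebesgue "\<lambda>x. indicator U x *\<^sub>R g x"] g(2) by (simp add: L1_def set_integrable_def)
      fix x
      have "\<bar>g x \<bullet> v x\<bar> \<le> norm (g x) * norm (v x)" by (rule Cauchy_Schwarz_ineq2)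
      also have "\<dots> \<le> norm (g x) * 1" by (intro mult_left_mono v) auto
      finally show "norm (indicator U x *\<^sub>R (g x \<bullet> v x)) \<le> indicator U x *\<^sub>R norm (g x)" by (simp add: indicator_def)
    qed
    then show ?thesis by (simp add: L1_norm_def set_lebesgue_integral_def)
  qed
  finally show "ereal (LINT x:U|lebesgue. u x * divergence v x) \<le> ereal (L1_norm U g)" by simp
qed

lemma set_integrable_linear:
  fixes g h :: "'a::euclidean_space \<Rightarrow> 'b::euclidean_space"
  assumes "set_integrable lebesgue S g" "set_integrable lebesgue S h"
  shows "set_integrable lebesgue S (\<lambda>x. a *\<^sub>R g x + b *\<^sub>R h x)"
proof -
  have "integrable lebesgue (\<lambda>x. a *\<^sub>R (indicator S x *\<^sub>R g x) + b *\<^sub>R (indicator S x *\<^sub>R h x))"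
    using assms unfolding set_integrable_def by (intro Bochner_Integration.integrable_add integrable_scaleR_right) auto
  moreover have "(\<lambda>x. a *\<^sub>R (indicator S x *\<^sub>R g x) + b *\<^sub>R (indicator S x *\<^sub>R h x)) = (\<lambda>x. indicator S x *\<^sub>R (a *\<^sub>R g x + b *\<^sub>R h x))"
    by (simp add: scaleR_add_right mult.commute)
  ultimately show ?thesis unfolding set_integrable_def by simp
qed

lemma has_weak_gradient_linear:
  fixes U :: "'a::euclidean_space set"
  assumes u: "has_weak_gradient U u g" and w: "has_weak_gradient U w h"
  shows "has_weak_gradient U (\<lambda>x. a * u x + b * w x) (\<lambda>x. a *\<^sub>R g x + b *\<^sub>R h x)"
proof -
  have loc: "u \<in> L1_loc U" "w \<in> L1_loc U" "g \<in> L1_loc U" "h \<in> L1_loc U"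
    using u w by (auto simp: has_weak_gradient_def)
  have "(LINT x:U|lebesgue. (a * u x + b * w x) * frechet_derivative \<phi> (at x) e)
      = - (LINT x:U|lebesgue. ((a *\<^sub>R g x + b *\<^sub>R h x) \<bullet> e) * \<phi> x)"
    if \<phi>: "\<phi> \<in> test_functions U" and e: "e \<in> Basis" for \<phi> e
  proof -
    let ?D = "\<lambda>x. frechet_derivative \<phi> (at x) e"
    obtain K where K: "compact K" "K \<subseteq> U" "\<forall>x. x \<notin> K \<longrightarrow> \<phi> x = 0" using test_functionsD(2)[OF \<phi>] by blast
    have c: "continuous_on UNIV \<phi>" "continuous_on UNIV ?D"
      using C_k_continuous[OF test_functionsD(1)[OF \<phi>]] C_1_continuous_derivative[OF test_functionsD(1)[OF \<phi>]] by auto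
    have vanD: "?D x = 0" if "x \<notin> K" for x
      by (rule frechet_derivative_eq_0_open[of "- K"]) (use K that compact_imp_closed in auto)
    have iD: "set_integrable lebesgue U (\<lambda>x. f x * ?D x)" if "f \<in> L1_loc U" for f
      by (rule L1_loc_mult_test[OF that c(2) K(1,2) vanD])
    have i\<phi>: "set_integrable lebesgue U (\<lambda>x. (f x \<bullet> e) * \<phi> x)" if "f \<in> L1_loc U" for f
      by (rule L1_loc_mult_test[OF L1_loc_inner[OF that] c(1) K(1,2)]) (use K(3) in auto)
    have "(LINT x:U|lebesgue. (a * u x + b * w x) * ?D x) = (LINT x:U|lebesgue. a * (u x * ?D x) + b * (w x * ?D x))"
      by (simp add: algebra_simps)
    also have "\<dots> = a * (LINT x:U|lebesgue. u x * ?D x) + b * (LINT x:U|lebesgue. w x * ?D x)"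
      using iD[OF loc(1)] iD[OF loc(2)] by (simp add: set_integral_add set_integral_mult_right)
    also have "(LINT x:U|lebesgue. u x * ?D x) = - (LINT x:U|lebesgue. (g x \<bullet> e) * \<phi> x)"
      using u \<phi> e unfolding has_weak_gradient_def by blast
    also have "(LINT x:U|lebesgue. w x * ?D x) = - (LINT x:U|lebesgue. (h x \<bullet> e) * \<phi> x)"
      using w \<phi> e unfolding has_weak_gradient_def by blast
    also have "a * - (LINT x:U|lebesgue. (g x \<bullet> e) * \<phi> x) + b * - (LINT x:U|lebesgue. (h x \<bullet> e) * \<phi> x)
        = - (LINT x:U|lebesgue. a * ((g x \<bullet> e) * \<phi> x) + b * ((h x \<bullet> e) * \<phi> x))"
      using i\<phi>[OF loc(3)] i\<phi>[OF loc(4)] by (simp add: set_integral_add set_integral_mult_right)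
    finally show ?thesis by (simp add: inner_add_left algebra_simps)
  qed
  moreover have "(\<lambda>x. a * u x + b * w x) \<in> L1_loc U" "(\<lambda>x. a *\<^sub>R g x + b *\<^sub>R h x) \<in> L1_loc U"
    using loc set_integrable_linear[of _ u w a b] set_integrable_linear[of _ g h a b] by (auto simp: L1_loc_def)
  ultimately show ?thesis by (simp add: has_weak_gradient_def)
qed

section \<open>Gluing across the boundary\<close>

lemma segment_crosses_frontier:
  fixes S :: "'a::euclidean_space set"
  assumes "x \<in> S \<longleftrightarrow> z \<notin> S"
  shows "\<exists>w\<in>frontier S. dist z w \<le> dist z x"
proof -
  have "closed_segment z x \<inter> S \<noteq> {}" "closed_segment z x - S \<noteq> {}"
    using assms ends_in_segment[of z x] by blast+
  from connected_Int_frontier[OF connected_segment(1) this]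
  obtain w where w: "w \<in> closed_segment z x" "w \<in> frontier S" by blast
  then show ?thesis
    using segment_bound(1)[OF w(1)] by (auto simp: dist_norm norm_minus_commute)
qed

text \<open>Mollify the indicators of a neighbourhood of the boundary and of the rest of \<open>\<Omega>\<close>; the third function is
  what is missing to 1. A ball of radius \<open>\<delta>\<close> around a point at distance at least \<open>3 * \<delta>\<close> from the boundary
  does not cross the boundary, so mollification mixes neither of \<open>\<Omega>\<close> and its complement into the other.\<close>

lemma exists_cutoffs:
  fixes \<Omega> :: "'a::euclidean_space set"
  assumes "open \<Omega>" "bounded \<Omega>" "\<delta> > 0"
  defines "N \<equiv> \<lambda>s. \<Union>w\<in>frontier \<Omega>. ball w s"
  shows "\<exists>\<eta> \<eta>1 \<eta>2 :: 'a \<Rightarrow> real. (\<forall>k. C_k k \<eta> \<and> C_k k \<eta>1 \<and> C_k k \<eta>2) \<and> (\<forall>x. \<eta> x + \<eta>1 x + \<eta>2 x = 1) \<and>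
    (\<forall>x. \<bar>\<eta> x\<bar> \<le> 3 \<and> \<bar>\<eta>1 x\<bar> \<le> 3 \<and> \<bar>\<eta>2 x\<bar> \<le> 3) \<and> (\<forall>x. x \<notin> N (4 * \<delta>) \<longrightarrow> \<eta> x = 0) \<and>
    (\<forall>x. x \<notin> \<Omega> - N \<delta> \<longrightarrow> \<eta>1 x = 0) \<and> (\<forall>x. x \<notin> - \<Omega> - N \<delta> \<longrightarrow> \<eta>2 x = 0)"
proof -
  let ?A = "N (3 * \<delta>)" and ?B = "\<Omega> - N (3 * \<delta>)"
  let ?\<rho> = "mollifier \<delta> :: 'a \<Rightarrow> real"
  have oN: "open (N s)" for s unfolding N_def by auto
  have bN: "bounded (N s)" for s
  proof -
    have "bounded (\<Union>w\<in>frontier \<Omega>. cball w s)"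
      using compact_neighbourhood[of "frontier \<Omega>" s] compact_frontier_bounded[OF assms(2)] compact_imp_bounded by blast
    then show ?thesis unfolding N_def by (rule bounded_subset) auto
  qed
  have iA: "integrable lborel (indicator ?A :: 'a \<Rightarrow> real)"
    using oN bN by (intro integrable_indicator_bounded) auto
  have iB: "integrable lborel (indicator ?B :: 'a \<Rightarrow> real)"
    using oN assms(1,2) by (intro integrable_indicator_bounded) (auto intro: bounded_subset)
  define \<eta> where "\<eta> = conv (indicator ?A) ?\<rho>"
  define \<eta>1 where "\<eta>1 = conv (indicator ?B) ?\<rho>"
  define \<eta>2 where "\<eta>2 = (\<lambda>x. 1 - \<eta> x - \<eta>1 x)"
  note van = mollifier_vanish'[OF \<open>\<delta> > 0\<close>]
  have C: "C_k k \<eta>" "C_k k \<eta>1" for k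
    unfolding \<eta>_def \<eta>1_def using C_k_mollification iA iB \<open>\<delta> > 0\<close> by auto
  have C2: "C_k k \<eta>2" for k unfolding \<eta>2_def by (intro C_k_diff C_k_const C)
  have b1: "\<bar>\<eta> x\<bar> \<le> 1" "\<bar>\<eta>1 x\<bar> \<le> 1" for x
    unfolding \<eta>_def \<eta>1_def by (rule conv_mollifier_le_1[OF _ _ \<open>\<delta> > 0\<close>]; use iA iB in \<open>auto simp: indicator_def\<close>)+
  have zero: "conv (indicator S) ?\<rho> x = 0" if "\<And>z. z \<in> S \<Longrightarrow> dist z x < \<delta> \<Longrightarrow> False" for S x
  proof -
    have "(\<lambda>z. indicator S z * ?\<rho> (x - z)) = (\<lambda>z. 0)"
    proof
      fix z show "indicator S z * ?\<rho> (x - z) = 0"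
      proof (cases "z \<in> S")
        case True
        then have "\<delta> \<le> norm (x - z)" using that[of z] by (force simp: dist_norm norm_minus_commute)
        then show ?thesis by (simp add: mollifier_vanish[OF \<open>\<delta> > 0\<close>])
      qed simp
    qed
    then show ?thesis unfolding conv_def by (simp only: Bochner_Integration.integral_zero)
  qed
  have trans: "x \<in> N (s + t)" if z: "z \<in> N s" "dist z x < t" for x z s t
  proof -
    obtain w where "w \<in> frontier \<Omega>" "dist w z < s" using z(1) by (auto simp: N_def)
    then show ?thesis using z(2) dist_triangle[of w x z] by (auto simp: N_def intro!: bexI[of _ w])
  qed
  have far: "x \<notin> N \<delta>" "x \<in> \<Omega> \<longleftrightarrow> z \<in> \<Omega>" if z: "z \<notin> N (3 * \<delta>)" "dist z x < \<delta>" for x z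
  proof -
    show "x \<notin> N \<delta>"
    proof
      assume "x \<in> N \<delta>"
      from trans[OF this, of z \<delta>] z have "z \<in> N (\<delta> + \<delta>)" by (simp add: dist_commute)
      then show False using z(1) \<open>\<delta> > 0\<close> by (auto simp: N_def)
    qed
    show "x \<in> \<Omega> \<longleftrightarrow> z \<in> \<Omega>"
    proof (rule ccontr)
      assume "\<not> (x \<in> \<Omega> \<longleftrightarrow> z \<in> \<Omega>)"
      then obtain w where "w \<in> frontier \<Omega>" "dist z w \<le> dist z x"
        using segment_crosses_frontier[of x \<Omega> z] by blast
      then show False using z \<open>\<delta> > 0\<close> by (auto simp: N_def dist_commute)
    qed
  qed
  have \<eta>0: "\<eta> x = 0" if "x \<notin> N (4 * \<delta>)" for x
    unfolding \<eta>_def using trans[of _ "3 * \<delta>" x \<delta>] that by (intro zero) (auto simp: algebra_simps)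
  have \<eta>10: "\<eta>1 x = 0" if "x \<notin> \<Omega> - N \<delta>" for x
    unfolding \<eta>1_def using far[of _ x] that by (intro zero) auto
  have \<eta>20: "\<eta>2 x = 0" if x: "x \<notin> - \<Omega> - N \<delta>" for x
  proof -
    have cov: "z \<in> ?A \<or> z \<in> ?B" if "dist z x < \<delta>" for z
      using far[of z x] that x by blast
    have "\<eta> x + \<eta>1 x = (\<integral>z. indicator ?A z * ?\<rho> (x - z) + indicator ?B z * ?\<rho> (x - z) \<partial>lborel)"
      unfolding \<eta>_def \<eta>1_def conv_def
      by (intro Bochner_Integration.integral_add[symmetric] conv_integrable_integrand[OF _ mollifier_continuous van] iA iB)
    also have "\<dots> = (\<integral>z. ?\<rho> (x - z) \<partial>lborel)"
    proof (intro Bochner_Integration.integral_cong refl)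
      fix z show "indicator ?A z * ?\<rho> (x - z) + indicator ?B z * ?\<rho> (x - z) = ?\<rho> (x - z)"
      proof (cases "dist z x < \<delta>")
        case True
        then show ?thesis using cov[OF True] by (auto simp: indicator_def)
      next
        case False
        then have "?\<rho> (x - z) = 0" by (intro mollifier_vanish[OF \<open>\<delta> > 0\<close>]) (simp add: dist_norm norm_minus_commute)
        then show ?thesis by simp
      qed
    qed
    also have "\<dots> = 1" using integral_lborel_reflect[of ?\<rho> x] mollifier_integral[OF \<open>\<delta> > 0\<close>, where 'a = 'a] by simp
    finally show ?thesis by (simp add: \<eta>2_def)
  qed
  have b2: "\<bar>\<eta>2 x\<bar> \<le> 3" for x using b1[of x] by (simp add: \<eta>2_def)
  show ?thesis
  proof (intro exI conjI allI impI)
    fix x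
    show "\<eta> x + \<eta>1 x + \<eta>2 x = 1" by (simp add: \<eta>2_def)
    show "\<bar>\<eta> x\<bar> \<le> 3" "\<bar>\<eta>1 x\<bar> \<le> 3" using b1[of x] by auto
  qed (assumption | rule C C2 b2 \<eta>0 \<eta>10 \<eta>20)+
qed

text \<open>Removing a neighbourhood of the boundary makes both \<open>\<Omega>\<close> and its complement closed, and pushes the
  complement into the exterior; the cutoffs therefore have the supports that test functions need.\<close>

lemma closed_minus_boundary_neighbourhood:
  fixes \<Omega> N :: "'a::euclidean_space set"
  assumes "open \<Omega>" "open N" "frontier \<Omega> \<subseteq> N"
  shows "closed (\<Omega> - N)" "closed (- \<Omega> - N)" "- \<Omega> - N \<subseteq> - closure \<Omega>"
proof -
  have cl: "closure \<Omega> = \<Omega> \<union> frontier \<Omega>"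
    by (rule closure_Un_frontier)
  have "\<Omega> - N = closure \<Omega> - N" using assms(3) cl by auto
  then show "closed (\<Omega> - N)" using assms(2) by auto
  show "closed (- \<Omega> - N)" using assms(1,2) by auto
  show "- \<Omega> - N \<subseteq> - closure \<Omega>" using assms(3) cl by auto
qed

lemma frechet_derivative_add3:
  fixes f g h :: "'a::euclidean_space \<Rightarrow> real"
  assumes "C_k (Suc 0) f" "C_k (Suc 0) g" "C_k (Suc 0) h" "\<And>x. F x = f x + g x + h x"
  shows "frechet_derivative F (at x) b = frechet_derivative f (at x) b + frechet_derivative g (at x) b + frechet_derivative h (at x) b"
proof -
  have F: "F = (\<lambda>x. f x + g x + h x)" using assms(4) by auto
  show ?thesis unfolding F
    by (rule frechet_derivative_eqI) (intro has_derivative_add C_k_SucD(1)[OF assms(1)] C_k_SucD(1)[OF assms(2)] C_k_SucD(1)[OF assms(3)])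
qed

lemma tendsto_integral_cutoff:
  fixes G \<phi> :: "'a \<Rightarrow> real" and \<eta> :: "nat \<Rightarrow> 'a \<Rightarrow> real"
  assumes G: "integrable M G" and \<phi>: "\<phi> \<in> borel_measurable M" "\<And>x. \<bar>\<phi> x\<bar> \<le> B"
    and \<eta>: "\<And>j. \<eta> j \<in> borel_measurable M" "\<And>j x. \<bar>\<eta> j x\<bar> \<le> C"
      "\<And>x. G x \<noteq> 0 \<Longrightarrow> \<forall>\<^sub>F j in sequentially. \<eta> j x = 1"
  shows "(\<lambda>j. \<integral>x. G x * \<phi> x * \<eta> j x \<partial>M) \<longlonglongrightarrow> (\<integral>x. G x * \<phi> x \<partial>M)"
proof (rule integral_dominated_convergence[where w = "\<lambda>x. B * C * \<bar>G x\<bar>"])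
  have m: "(\<lambda>x. G x * \<phi> x) \<in> borel_measurable M"
    by (rule borel_measurable_times[OF borel_measurable_integrable[OF G] \<phi>(1)])
  then show "(\<lambda>x. G x * \<phi> x) \<in> borel_measurable M" .
  show "(\<lambda>x. G x * \<phi> x * \<eta> j x) \<in> borel_measurable M" for j
    by (rule borel_measurable_times[OF m \<eta>(1)])
  show "integrable M (\<lambda>x. B * C * \<bar>G x\<bar>)" using G by auto
  show "AE x in M. (\<lambda>j. G x * \<phi> x * \<eta> j x) \<longlonglongrightarrow> G x * \<phi> x"
  proof (rule AE_I2)
    fix x
    show "(\<lambda>j. G x * \<phi> x * \<eta> j x) \<longlonglongrightarrow> G x * \<phi> x"
    proof (cases "G x = 0")
      case False
      from \<eta>(3)[OF this] show ?thesis
        by (intro tendsto_eventually, eventually_elim) simp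
    qed simp
  qed
  show "AE x in M. norm (G x * \<phi> x * \<eta> j x) \<le> B * C * \<bar>G x\<bar>" for j
  proof (rule AE_I2)
    fix x
    have "\<bar>\<phi> x\<bar> * \<bar>\<eta> j x\<bar> \<le> B * C"
      using \<phi>(2)[of x] \<eta>(2)[of j x] by (intro mult_mono) auto
    then have "\<bar>G x\<bar> * (\<bar>\<phi> x\<bar> * \<bar>\<eta> j x\<bar>) \<le> \<bar>G x\<bar> * (B * C)"
      by (intro mult_left_mono) auto
    then show "norm (G x * \<phi> x * \<eta> j x) \<le> B * C * \<bar>G x\<bar>"
      by (simp add: abs_mult mult_ac)
  qed
qed

locale exterior_scale = scale_function "- closure \<Omega>" r Dr
  for \<Omega> :: "'a::euclidean_space set" and r Dr +
  assumes \<Omega>_open: "open \<Omega>" and \<Omega>_bounded: "bounded \<Omega>"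
begin

text \<open>The radius vanishes on the boundary and has Lipschitz constant 1/2, so averaging around a point at
  distance \<open>s\<close> from the boundary does not reach beyond distance \<open>2 * s\<close>.\<close>

lemma near_boundary_shift:
  assumes "x \<in> (\<Union>w\<in>frontier \<Omega>. cball w s)" "norm y \<le> 1" "s > 0"
  shows "x + r x *\<^sub>R y \<in> (\<Union>w\<in>frontier \<Omega>. cball w (2 * s))"
proof -
  obtain w where w: "w \<in> frontier \<Omega>" "dist w x \<le> s" using assms(1) by auto
  have "w \<notin> - closure \<Omega>" using w(1) by (simp add: frontier_def)
  then have "r w = 0" using r_pos[of w] r_nonneg[of w] by force
  then have "r x \<le> s / 2" using r_lipschitz[of x w] w(2) by (simp add: dist_norm norm_minus_commute)
  moreover have "norm (r x *\<^sub>R y) \<le> r x * 1"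
    using r_nonneg[of x] assms(2) by (simp add: mult_left_le)
  ultimately have "dist w (x + r x *\<^sub>R y) \<le> 2 * s"
    using w(2) dist_triangle[of w "x + r x *\<^sub>R y" x] assms(3) by (simp add: dist_norm)
  then show ?thesis using w(1) by auto
qed

text \<open>The supports shrink to the boundary, around which \<open>f\<close> has arbitrarily small variation. The cutoffs have steep
  gradients, but the bound involves only their values.\<close>

lemma boundary_term_tendsto_0:
  fixes \<eta> :: "nat \<Rightarrow> 'a \<Rightarrow> real"
  assumes f: "integrable lborel f" and bd: "variation_in UNIV f (frontier \<Omega>) = 0"
    and \<phi>: "\<phi> \<in> test_functions UNIV" and b: "b \<in> Basis"
    and \<delta>: "\<And>j. 0 < \<delta> j" "\<delta> \<longlonglongrightarrow> 0"
    and \<eta>: "\<And>j k. C_k k (\<eta> j)" "\<And>j x. \<bar>\<eta> j x\<bar> \<le> 3"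
      "\<And>j x. x \<notin> (\<Union>w\<in>frontier \<Omega>. ball w (4 * \<delta> j)) \<Longrightarrow> \<eta> j x = 0"
  shows "(\<lambda>j. \<integral>x. smoothing f x * frechet_derivative (\<lambda>x. \<eta> j x * \<phi> x) (at x) b \<partial>lborel) \<longlonglongrightarrow> 0"
proof (rule LIMSEQ_I)
  fix \<theta> :: real assume "\<theta> > 0"
  obtain R where van: "\<forall>x. R < norm x \<longrightarrow> \<phi> x = 0" using test_functionsD(4)[OF \<phi>] by blast
  have "continuous_on UNIV \<phi>" by (rule C_k_continuous[OF test_functionsD(1)[OF \<phi>]])
  from vanish_bounded[OF this van] obtain B where B: "B > 0" "\<And>x. norm (\<phi> x) \<le> B" by blast
  have "0 \<le> 3 * B * grad_const" using B(1) grad_const_nonneg by simp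
  moreover have "\<theta> / 2 > 0" using \<open>\<theta> > 0\<close> by simp
  ultimately obtain v where v: "v > 0" "3 * B * grad_const * v \<le> \<theta> / 2" using small_multiple by blast
  have "variation_in UNIV f (frontier \<Omega>) < ereal v" using bd v(1) by simp
  then obtain V where V: "open V" "frontier \<Omega> \<subseteq> V" "variation f V \<le> ereal v"
    unfolding variation_in_def by (auto simp: INF_less_iff intro: less_imp_le)
  have cf: "compact (frontier \<Omega>)" by (rule compact_frontier_bounded[OF \<Omega>_bounded])
  obtain d where d: "d > 0" "(\<Union>w\<in>frontier \<Omega>. ball w d) \<subseteq> V"
    using compact_subset_open_imp_ball_epsilon_subset[OF cf V(1,2)] by blast
  \<comment> \<open>The support reaches to distance \<open>4 * \<delta> j\<close> from the boundary, and averaging doubles this distance.\<close>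
  have "\<forall>\<^sub>F j in sequentially. \<delta> j < d / 8" using order_tendstoD(2)[OF \<delta>(2), of "d / 8"] d(1) by simp
  then obtain J where J: "\<And>j. j \<ge> J \<Longrightarrow> \<delta> j < d / 8" by (auto simp: eventually_sequentially)
  have "\<bar>\<integral>x. smoothing f x * frechet_derivative (\<lambda>x. \<eta> j x * \<phi> x) (at x) b \<partial>lborel\<bar> < \<theta>" if j: "j \<ge> J" for j
  proof -
    have "\<bar>\<integral>x. smoothing f x * frechet_derivative (\<lambda>x. \<eta> j x * \<phi> x) (at x) b \<partial>lborel\<bar> \<le> (3 * B) * (grad_const * v)"
    proof (rule smoothing_weak_bound[OF f, where K = "\<Union>w\<in>frontier \<Omega>. cball w (4 * \<delta> j)"
          and K' = "\<Union>w\<in>frontier \<Omega>. cball w (2 * (4 * \<delta> j))" and V = V])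
      show "C_k (Suc 0) (\<lambda>x. \<eta> j x * \<phi> x)" by (intro C_k_mult \<eta>(1) test_functionsD(1)[OF \<phi>])
      show "\<eta> j x * \<phi> x = 0" if "x \<notin> (\<Union>w\<in>frontier \<Omega>. cball w (4 * \<delta> j))" for x
      proof -
        have "x \<notin> (\<Union>w\<in>frontier \<Omega>. ball w (4 * \<delta> j))" using that by force
        then show ?thesis using \<eta>(3) by simp
      qed
      show "\<bar>\<eta> j x * \<phi> x\<bar> \<le> 3 * B" for x
        unfolding abs_mult using \<eta>(2)[of j x] B(2)[of x] by (intro mult_mono) auto
      show "(\<Union>w\<in>frontier \<Omega>. cball w (2 * (4 * \<delta> j))) \<subseteq> V" using d(2) J[OF j] by force
      show "x + r x *\<^sub>R y \<in> (\<Union>w\<in>frontier \<Omega>. cball w (2 * (4 * \<delta> j)))"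
        if "x \<in> (\<Union>w\<in>frontier \<Omega>. cball w (4 * \<delta> j))" "norm y \<le> 1" for x y
        by (rule near_boundary_shift[OF that]) (use \<delta>(1) in simp)
    qed (use B V b compact_neighbourhood[OF cf] in auto)
    then show ?thesis using v(2) \<open>\<theta> > 0\<close> by (simp add: mult.assoc)
  qed
  then show "\<exists>no. \<forall>j\<ge>no. norm ((\<integral>x. smoothing f x * frechet_derivative (\<lambda>x. \<eta> j x * \<phi> x) (at x) b \<partial>lborel) - 0) < \<theta>"
    by auto
qed

definition exterior_gradient :: "('a \<Rightarrow> real) \<Rightarrow> 'a \<Rightarrow> 'a" where
  "exterior_gradient f x = (\<Sum>b\<in>Basis. (indicator (- closure \<Omega>) x * average (grad_kernel b) f x) *\<^sub>R b)"

lemma exterior_gradient_inner: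
  "b \<in> Basis \<Longrightarrow> exterior_gradient f x \<bullet> b = indicator (- closure \<Omega>) x * average (grad_kernel b) f x"
  by (simp add: exterior_gradient_def)

lemma exterior_gradient_L1:
  assumes f: "integrable lborel f" and v: "variation f UNIV \<le> ereal v"
  shows "integrable lborel (exterior_gradient f)"
    and "(\<integral>x. norm (exterior_gradient f x) \<partial>lborel) \<le> DIM('a) * (grad_const * v)"
proof -
  note i = average_grad_bound(1)[OF f _ v]
  show int: "integrable lborel (exterior_gradient f)"
    unfolding exterior_gradient_def[abs_def] using i by (intro Bochner_Integration.integrable_sum integrable_scaleR_left)
  have "(\<integral>x. norm (exterior_gradient f x) \<partial>lborel)
      \<le> (\<integral>x. (\<Sum>b\<in>(Basis::'a set). \<bar>indicator (- closure \<Omega>) x * average (grad_kernel b) f x\<bar>) \<partial>lborel)"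
  proof (rule integral_le_integral)
    show "integrable lborel (\<lambda>x. norm (exterior_gradient f x))" using int by (rule integrable_norm)
    show "integrable lborel (\<lambda>x. \<Sum>b\<in>(Basis::'a set). \<bar>indicator (- closure \<Omega>) x * average (grad_kernel b) f x\<bar>)"
      using i by (intro Bochner_Integration.integrable_sum integrable_abs)
    show "norm (exterior_gradient f x) \<le> (\<Sum>b\<in>(Basis::'a set). \<bar>indicator (- closure \<Omega>) x * average (grad_kernel b) f x\<bar>)" for x
      unfolding exterior_gradient_def by (rule sum_norm_le) simp
  qed
  also have "\<dots> = (\<Sum>b\<in>(Basis::'a set). \<integral>x. \<bar>indicator (- closure \<Omega>) x * average (grad_kernel b) f x\<bar> \<partial>lborel)"
    using i by (intro Bochner_Integration.integral_sum integrable_abs)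
  also have "\<dots> \<le> (\<Sum>b\<in>(Basis::'a set). grad_const * v)"
    by (intro sum_mono average_grad_bound(2)[OF f _ v])
  finally show "(\<integral>x. norm (exterior_gradient f x) \<partial>lborel) \<le> DIM('a) * (grad_const * v)" by simp
qed

text \<open>The boundary may have positive measure: the gradient is simply zero there, and what excludes a
  contribution of the boundary is the vanishing variation of \<open>f\<close> on it.\<close>

theorem smoothing_has_weak_gradient:
  fixes f u :: "'a \<Rightarrow> real" and g :: "'a \<Rightarrow> 'a"
  assumes f: "integrable lborel f" and v: "variation f UNIV \<le> ereal v"
    and bd: "variation_in UNIV f (frontier \<Omega>) = 0"
    and g: "has_weak_gradient \<Omega> u g" "g \<in> L1 \<Omega>" and ae: "AE x in lebesgue. x \<in> \<Omega> \<longrightarrow> f x = u x"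
  shows "has_weak_gradient UNIV (smoothing f) (\<lambda>x. indicator \<Omega> x *\<^sub>R g x + exterior_gradient f x)"
    and "(\<lambda>x. indicator \<Omega> x *\<^sub>R g x + exterior_gradient f x) \<in> L1 UNIV"
    and "L1_norm UNIV (\<lambda>x. indicator \<Omega> x *\<^sub>R g x + exterior_gradient f x) \<le> L1_norm \<Omega> g + DIM('a) * (grad_const * v)"
proof -
  let ?h = "\<lambda>x. indicator \<Omega> x *\<^sub>R g x + exterior_gradient f x"
  have mO: "\<Omega> \<in> sets borel" using \<Omega>_open by simp
  have ig: "integrable lebesgue (\<lambda>x. indicator \<Omega> x *\<^sub>R g x)" using g(2) by (simp add: L1_def set_integrable_def)
  have iel: "integrable lborel (exterior_gradient f)" by (rule exterior_gradient_L1(1)[OF f v])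
  then have ie: "integrable lebesgue (exterior_gradient f)" by (subst integrable_completion) auto
  have isl: "integrable lborel (smoothing f)" by (rule smoothing_integrable[OF f])
  then have is': "integrable lebesgue (smoothing f)" by (subst integrable_completion) auto
  have ih: "integrable lebesgue ?h" using ig ie by (rule Bochner_Integration.integrable_add)
  show hL1: "?h \<in> L1 UNIV" using ih by (simp add: L1_def set_integrable_def)
  have sL1: "smoothing f \<in> L1 UNIV" using is' by (simp add: L1_def set_integrable_def)
  show "L1_norm UNIV ?h \<le> L1_norm \<Omega> g + DIM('a) * (grad_const * v)"
  proof -
    have "(\<integral>x. norm (?h x) \<partial>lebesgue) \<le> (\<integral>x. norm (indicator \<Omega> x *\<^sub>R g x) + norm (exterior_gradient f x) \<partial>lebesgue)"
      by (intro integral_le_integral integrable_norm ih Bochner_Integration.integrable_add ig ie norm_triangle_ineq)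
    also have "\<dots> = (\<integral>x. norm (indicator \<Omega> x *\<^sub>R g x) \<partial>lebesgue) + (\<integral>x. norm (exterior_gradient f x) \<partial>lebesgue)"
      by (intro Bochner_Integration.integral_add integrable_norm ig ie)
    also have "(\<integral>x. norm (exterior_gradient f x) \<partial>lebesgue) = (\<integral>x. norm (exterior_gradient f x) \<partial>lborel)"
      using iel by (intro integral_lebesgue_lborel) auto
    also have "\<dots> \<le> DIM('a) * (grad_const * v)" by (rule exterior_gradient_L1(2)[OF f v])
    finally show ?thesis by (simp add: L1_norm_def set_lebesgue_integral_def)
  qed
  show "has_weak_gradient UNIV (smoothing f) ?h"
    unfolding has_weak_gradient_def
  proof (intro conjI ballI)
    show "smoothing f \<in> L1_loc UNIV" "?h \<in> L1_loc UNIV" using L1_imp_L1_loc sL1 hL1 by auto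
    fix \<phi> :: "'a \<Rightarrow> real" and b :: 'a
    assume \<phi>: "\<phi> \<in> test_functions UNIV" and b: "b \<in> Basis"
    let ?D = "\<lambda>\<psi> x. frechet_derivative \<psi> (at x) b"
    note \<phi>C = test_functionsD(1)[OF \<phi>]
    obtain R where van: "\<forall>x. R < norm x \<longrightarrow> \<phi> x = 0" using test_functionsD(4)[OF \<phi>] by blast
    have c\<phi>: "continuous_on UNIV \<phi>" by (rule C_k_continuous[OF \<phi>C])
    then have m\<phi>: "\<phi> \<in> borel_measurable borel" by (rule borel_measurable_continuous_onI)
    from vanish_bounded[OF c\<phi> van] obtain B where B: "B > 0" "\<And>x. norm (\<phi> x) \<le> B" by blast
    define \<delta> where "\<delta> = (\<lambda>j::nat. 1 / (real j + 1))"
    have \<delta>: "0 < \<delta> j" for j by (simp add: \<delta>_def)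
    have \<delta>0: "\<delta> \<longlonglongrightarrow> 0" unfolding \<delta>_def using LIMSEQ_inverse_real_of_nat by (simp add: inverse_eq_divide add.commute)
    let ?N = "\<lambda>s. \<Union>w\<in>frontier \<Omega>. ball w s"
    define P where "P = (\<lambda>j (\<eta>, \<eta>1, \<eta>2). (\<forall>k. C_k k \<eta> \<and> C_k k \<eta>1 \<and> C_k k \<eta>2) \<and> (\<forall>x. \<eta> x + \<eta>1 x + \<eta>2 x = 1) \<and>
      (\<forall>x::'a. \<bar>\<eta> x\<bar> \<le> (3::real) \<and> \<bar>\<eta>1 x\<bar> \<le> (3::real) \<and> \<bar>\<eta>2 x\<bar> \<le> (3::real)) \<and> (\<forall>x. x \<notin> ?N (4 * \<delta> j) \<longrightarrow> \<eta> x = 0) \<and>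
      (\<forall>x. x \<notin> \<Omega> - ?N (\<delta> j) \<longrightarrow> \<eta>1 x = 0) \<and> (\<forall>x. x \<notin> - \<Omega> - ?N (\<delta> j) \<longrightarrow> \<eta>2 x = 0))"
    have "\<forall>j. \<exists>p. P j p"
    proof
      fix j show "\<exists>p. P j p"
        using exists_cutoffs[OF \<Omega>_open \<Omega>_bounded \<delta>[of j]] unfolding P_def by (simp add: split_paired_Ex)
    qed
    from choice[OF this] obtain p where p: "\<And>j. P j (p j)" by blast
    define \<eta> where "\<eta> = (\<lambda>j. fst (p j))"
    define \<eta>1 where "\<eta>1 = (\<lambda>j. fst (snd (p j)))"
    define \<eta>2 where "\<eta>2 = (\<lambda>j. snd (snd (p j)))"
    have P: "P j (\<eta> j, \<eta>1 j, \<eta>2 j)" for j using p[of j] by (simp add: \<eta>_def \<eta>1_def \<eta>2_def)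
    have C: "C_k k (\<eta> j)" "C_k k (\<eta>1 j)" "C_k k (\<eta>2 j)" and sum1: "\<eta> j x + \<eta>1 j x + \<eta>2 j x = 1"
      and le3: "\<bar>\<eta> j x\<bar> \<le> 3" "\<bar>\<eta>1 j x\<bar> \<le> 3" "\<bar>\<eta>2 j x\<bar> \<le> 3"
      and z: "x \<notin> ?N (4 * \<delta> j) \<Longrightarrow> \<eta> j x = 0" and z1: "x \<notin> \<Omega> - ?N (\<delta> j) \<Longrightarrow> \<eta>1 j x = 0"
      and z2: "x \<notin> - \<Omega> - ?N (\<delta> j) \<Longrightarrow> \<eta>2 j x = 0" for j k x
      using P[of j] unfolding P_def by auto
    have mes: "\<eta>1 j \<in> borel_measurable borel" "\<eta>2 j \<in> borel_measurable borel" for j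
      using C_k_continuous[OF C(2)] C_k_continuous[OF C(3)] by (auto intro: borel_measurable_continuous_onI)
    have Nf: "open (?N s)" "s > 0 \<Longrightarrow> frontier \<Omega> \<subseteq> ?N s" for s by auto
    note cl = closed_minus_boundary_neighbourhood[OF \<Omega>_open Nf(1) Nf(2)[OF \<delta>]]
    have t1: "(\<lambda>x. \<eta>1 j x * \<phi> x) \<in> test_functions \<Omega>" for j
      by (rule test_functions_mult[OF C(2) \<phi> cl(1) z1]) auto
    have t2: "(\<lambda>x. \<eta>2 j x * \<phi> x) \<in> test_functions (- closure \<Omega>)" for j
      by (rule test_functions_mult[OF C(3) \<phi> cl(2) z2]) (use cl(3)[of j] in auto)
    have t0: "(\<lambda>x. \<eta> j x * \<phi> x) \<in> test_functions UNIV" for j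
      by (rule test_functions_mult[OF C(1) \<phi>, of UNIV]) auto
    have iD: "integrable lborel (\<lambda>x. smoothing f x * ?D \<psi> x)" if \<psi>: "\<psi> \<in> test_functions S" for \<psi> S
    proof -
      obtain R' where "\<forall>x. R' < norm x \<longrightarrow> \<psi> x = 0" using test_functionsD(4)[OF \<psi>] by blast
      from frechet_derivative_vanish[OF this] show ?thesis
        by (rule integrable_mult_vanish[OF isl C_1_continuous_derivative[OF test_functionsD(1)[OF \<psi>]], rotated]) auto
    qed
    define E where "E = (\<lambda>j. \<integral>x. smoothing f x * ?D (\<lambda>x. \<eta> j x * \<phi> x) x \<partial>lborel)"
    have E0: "E \<longlonglongrightarrow> 0"
      unfolding E_def by (rule boundary_term_tendsto_0[OF f bd \<phi> b \<delta> \<delta>0 C(1) le3(1) z])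
    have inside: "(\<integral>x. smoothing f x * ?D (\<lambda>x. \<eta>1 j x * \<phi> x) x \<partial>lborel) = - (\<integral>x. indicator \<Omega> x * (g x \<bullet> b) * \<phi> x * \<eta>1 j x \<partial>lebesgue)" for j
    proof -
      let ?\<psi> = "\<lambda>x. \<eta>1 j x * \<phi> x"
      have mD: "?D ?\<psi> \<in> borel_measurable borel"
        by (intro borel_measurable_continuous_onI C_1_continuous_derivative[OF test_functionsD(1)[OF t1]]) auto
      have "(\<integral>x. smoothing f x * ?D ?\<psi> x \<partial>lborel) = (\<integral>x. smoothing f x * ?D ?\<psi> x \<partial>lebesgue)"
        using mD isl by (intro integral_lebesgue_lborel[symmetric]) auto
      also have "\<dots> = (\<integral>x. indicator \<Omega> x *\<^sub>R (u x * ?D ?\<psi> x) \<partial>lebesgue)"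
      proof (rule integral_cong_AE)
        show "(\<lambda>x. smoothing f x * ?D ?\<psi> x) \<in> borel_measurable lebesgue"
          using mD isl by (intro measurable_completion) auto
        have "(\<lambda>x. (indicator \<Omega> x *\<^sub>R u x) * ?D ?\<psi> x) \<in> borel_measurable lebesgue"
          using g(1) mD by (intro borel_measurable_times L1_loc_measurable[OF \<Omega>_open] measurable_completion) (auto simp: has_weak_gradient_def)
        then show "(\<lambda>x. indicator \<Omega> x *\<^sub>R (u x * ?D ?\<psi> x)) \<in> borel_measurable lebesgue" by (simp add: mult.assoc)
        show "AE x in lebesgue. smoothing f x * ?D ?\<psi> x = indicator \<Omega> x *\<^sub>R (u x * ?D ?\<psi> x)"
          using ae
        proof eventually_elim
          case (elim x)
          show ?case
          proof (cases "x \<in> \<Omega>")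
            case True
            then have "x \<notin> - closure \<Omega>" using closure_subset by auto
            then show ?thesis using elim True smoothing_eq_outside[of x f] by simp
          next
            case False
            then show ?thesis using test_functions_deriv_vanish[OF t1 False] by simp
          qed
        qed
      qed
      also have "\<dots> = (LINT x:\<Omega>|lebesgue. u x * ?D ?\<psi> x)" by (simp add: set_lebesgue_integral_def)
      also have "\<dots> = - (LINT x:\<Omega>|lebesgue. (g x \<bullet> b) * ?\<psi> x)"
        using g(1) t1 b unfolding has_weak_gradient_def by blast
      finally show ?thesis by (simp add: set_lebesgue_integral_def mult_ac)
    qed
    have outside: "(\<integral>x. smoothing f x * ?D (\<lambda>x. \<eta>2 j x * \<phi> x) x \<partial>lborel) = - (\<integral>x. (exterior_gradient f x \<bullet> b) * \<phi> x * \<eta>2 j x \<partial>lborel)" for j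
    proof -
      have "(\<integral>x. smoothing f x * ?D (\<lambda>x. \<eta>2 j x * \<phi> x) x \<partial>lborel) = - (\<integral>x. average (grad_kernel b) f x * (\<eta>2 j x * \<phi> x) \<partial>lborel)"
        by (rule smoothing_weak_gradient_inside[OF f t2 b])
      also have "(\<integral>x. average (grad_kernel b) f x * (\<eta>2 j x * \<phi> x) \<partial>lborel) = (\<integral>x. (exterior_gradient f x \<bullet> b) * \<phi> x * \<eta>2 j x \<partial>lborel)"
      proof (intro Bochner_Integration.integral_cong refl)
        fix x show "average (grad_kernel b) f x * (\<eta>2 j x * \<phi> x) = (exterior_gradient f x \<bullet> b) * \<phi> x * \<eta>2 j x"
          using test_functionsD(3)[OF t2, of x j] by (cases "x \<in> - closure \<Omega>") (auto simp: exterior_gradient_inner[OF b])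
      qed
      finally show ?thesis .
    qed
    \<comment> \<open>The left side does not depend on \<open>j\<close>, so the limit of the right side is its value.\<close>
    have split: "(\<integral>x. smoothing f x * ?D \<phi> x \<partial>lborel) = E j - (\<integral>x. indicator \<Omega> x * (g x \<bullet> b) * \<phi> x * \<eta>1 j x \<partial>lebesgue)
        - (\<integral>x. (exterior_gradient f x \<bullet> b) * \<phi> x * \<eta>2 j x \<partial>lborel)" for j
    proof -
      have "\<phi> x = \<eta> j x * \<phi> x + \<eta>1 j x * \<phi> x + \<eta>2 j x * \<phi> x" for x
        using sum1[of j x] by (simp flip: distrib_right)
      then have "?D \<phi> x = ?D (\<lambda>x. \<eta> j x * \<phi> x) x + ?D (\<lambda>x. \<eta>1 j x * \<phi> x) x + ?D (\<lambda>x. \<eta>2 j x * \<phi> x) x" for x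
        by (intro frechet_derivative_add3 C_k_mult C \<phi>C)
      then have "(\<integral>x. smoothing f x * ?D \<phi> x \<partial>lborel) = (\<integral>x. smoothing f x * ?D (\<lambda>x. \<eta> j x * \<phi> x) x
          + smoothing f x * ?D (\<lambda>x. \<eta>1 j x * \<phi> x) x + smoothing f x * ?D (\<lambda>x. \<eta>2 j x * \<phi> x) x \<partial>lborel)"
        by (simp add: distrib_left)
      also have "\<dots> = E j + (\<integral>x. smoothing f x * ?D (\<lambda>x. \<eta>1 j x * \<phi> x) x \<partial>lborel) + (\<integral>x. smoothing f x * ?D (\<lambda>x. \<eta>2 j x * \<phi> x) x \<partial>lborel)"
        using iD[OF t0[of j]] iD[OF t1[of j]] iD[OF t2[of j]] by (simp add: E_def)
      finally show ?thesis unfolding inside outside by simp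
    qed
    have far: "\<forall>\<^sub>F j in sequentially. x \<notin> ?N (4 * \<delta> j)" if x: "x \<notin> frontier \<Omega>" for x
    proof -
      have "open (- frontier \<Omega>)" by auto
      then obtain e where e: "e > 0" "ball x e \<subseteq> - frontier \<Omega>" using x openE by blast
      have "\<forall>\<^sub>F j in sequentially. \<delta> j < e / 4" using order_tendstoD(2)[OF \<delta>0, of "e / 4"] e(1) by simp
      then show ?thesis
      proof eventually_elim
        case (elim j)
        show ?case
        proof
          assume "x \<in> ?N (4 * \<delta> j)"
          then obtain w where "w \<in> frontier \<Omega>" "dist w x < 4 * \<delta> j" by auto
          then have "w \<in> ball x e" using elim by (simp add: dist_commute)
          then show False using e(2) \<open>w \<in> frontier \<Omega>\<close> by blast
        qed
      qed
    qed
    have intG: "integrable lebesgue (\<lambda>x. indicator \<Omega> x * (g x \<bullet> b))"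
    proof -
      have "integrable lebesgue (\<lambda>x. (indicator \<Omega> x *\<^sub>R g x) \<bullet> b)" by (intro integrable_inner_left ig)
      then show ?thesis by simp
    qed
    have m\<phi>L: "\<phi> \<in> borel_measurable lebesgue" using m\<phi> by (intro measurable_completion) simp
    have mes1L: "\<eta>1 j \<in> borel_measurable lebesgue" for j using mes(1)[of j] by (intro measurable_completion) simp
    have B': "\<bar>\<phi> x\<bar> \<le> B" for x using B(2)[of x] by simp
    have lim1: "(\<lambda>j. \<integral>x. indicator \<Omega> x * (g x \<bullet> b) * \<phi> x * \<eta>1 j x \<partial>lebesgue) \<longlonglongrightarrow> (\<integral>x. indicator \<Omega> x * (g x \<bullet> b) * \<phi> x \<partial>lebesgue)"
    proof (rule tendsto_integral_cutoff[OF intG m\<phi>L B' mes1L le3(2)])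
      fix x assume "indicator \<Omega> x * (g x \<bullet> b) \<noteq> 0"
      then have "x \<in> \<Omega>" by (auto simp: indicator_def split: if_splits)
      then have "x \<notin> frontier \<Omega>" using \<Omega>_open by (simp add: frontier_def interior_open)
      from far[OF this] show "\<forall>\<^sub>F j in sequentially. \<eta>1 j x = 1"
      proof eventually_elim
        case (elim j)
        then show ?case using sum1[of j x] z[OF elim] z2[of x j] \<open>x \<in> \<Omega>\<close> by simp
      qed
    qed
    have intX: "integrable lborel (\<lambda>x. exterior_gradient f x \<bullet> b)"
      using iel by (intro integrable_inner_left) auto
    have lim2: "(\<lambda>j. \<integral>x. (exterior_gradient f x \<bullet> b) * \<phi> x * \<eta>2 j x \<partial>lborel) \<longlonglongrightarrow> (\<integral>x. (exterior_gradient f x \<bullet> b) * \<phi> x \<partial>lborel)"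
    proof (rule tendsto_integral_cutoff[OF intX _ B' _ le3(3)])
      fix x assume "exterior_gradient f x \<bullet> b \<noteq> 0"
      then have "x \<in> - closure \<Omega>" using exterior_gradient_inner[OF b, of f x] by (cases "x \<in> - closure \<Omega>") auto
      then have x: "x \<notin> frontier \<Omega>" "x \<notin> \<Omega>" using closure_subset by (auto simp: frontier_def)
      from far[OF x(1)] show "\<forall>\<^sub>F j in sequentially. \<eta>2 j x = 1"
      proof eventually_elim
        case (elim j)
        then show ?case using sum1[of j x] z[OF elim] z1[of x j] x(2) by simp
      qed
    qed (use m\<phi> mes(2) in auto)
    have "(\<lambda>j. E j - (\<integral>x. indicator \<Omega> x * (g x \<bullet> b) * \<phi> x * \<eta>1 j x \<partial>lebesgue) - (\<integral>x. (exterior_gradient f x \<bullet> b) * \<phi> x * \<eta>2 j x \<partial>lborel))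
        \<longlonglongrightarrow> 0 - (\<integral>x. indicator \<Omega> x * (g x \<bullet> b) * \<phi> x \<partial>lebesgue) - (\<integral>x. (exterior_gradient f x \<bullet> b) * \<phi> x \<partial>lborel)"
      by (intro tendsto_diff E0 lim1 lim2)
    then have eq: "(\<integral>x. smoothing f x * ?D \<phi> x \<partial>lborel) = - (\<integral>x. indicator \<Omega> x * (g x \<bullet> b) * \<phi> x \<partial>lebesgue) - (\<integral>x. (exterior_gradient f x \<bullet> b) * \<phi> x \<partial>lborel)"
      unfolding split[symmetric] by (simp add: LIMSEQ_const_iff)
    have mD: "?D \<phi> \<in> borel_measurable borel"
      by (intro borel_measurable_continuous_onI C_1_continuous_derivative[OF \<phi>C]) auto
    have "(LINT x:UNIV|lebesgue. smoothing f x * ?D \<phi> x) = (\<integral>x. smoothing f x * ?D \<phi> x \<partial>lborel)"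
      unfolding set_lebesgue_integral_def using mD isl by (subst integral_lebesgue_lborel[symmetric]) auto
    also have "\<dots> = - ((\<integral>x. indicator \<Omega> x * (g x \<bullet> b) * \<phi> x \<partial>lebesgue) + (\<integral>x. (exterior_gradient f x \<bullet> b) * \<phi> x \<partial>lebesgue))"
      unfolding eq using intX m\<phi> by (subst integral_lebesgue_lborel) auto
    also have "(\<integral>x. indicator \<Omega> x * (g x \<bullet> b) * \<phi> x \<partial>lebesgue) + (\<integral>x. (exterior_gradient f x \<bullet> b) * \<phi> x \<partial>lebesgue)
      = (\<integral>x. indicator \<Omega> x * (g x \<bullet> b) * \<phi> x + (exterior_gradient f x \<bullet> b) * \<phi> x \<partial>lebesgue)"
    proof (rule Bochner_Integration.integral_add[symmetric])
      have "integrable lborel (\<lambda>x. (exterior_gradient f x \<bullet> b) * \<phi> x)"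
        by (rule integrable_mult_vanish[OF intX c\<phi> van])
      then show "integrable lebesgue (\<lambda>x. (exterior_gradient f x \<bullet> b) * \<phi> x)"
        by (subst integrable_completion) auto
      show "integrable lebesgue (\<lambda>x. indicator \<Omega> x * (g x \<bullet> b) * \<phi> x)"
        by (rule integrable_mult_bounded_measure[OF intG m\<phi>L B'])
    qed
    also have "\<dots> = (LINT x:UNIV|lebesgue. (?h x \<bullet> b) * \<phi> x)"
      by (simp add: set_lebesgue_integral_def inner_add_left distrib_right)
    finally show "(LINT x:UNIV|lebesgue. smoothing f x * ?D \<phi> x) = - (LINT x:UNIV|lebesgue. (?h x \<bullet> b) * \<phi> x)" .
  qed
qed

end

section \<open>The Sobolev extension operator\<close>

text \<open>The smoothing needs a Borel function, so a Borel representative of \<open>T u\<close> is selected. The selection is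
  harmless for linearity, because the smoothing depends on its argument only up to equality almost
  everywhere.\<close>

theorem W11_extension_from_BV:
  fixes \<Omega> :: "'a::euclidean_space set"
  assumes \<Omega>: "open \<Omega>" "bounded \<Omega>" and T: "strong_BV_extension_operator \<Omega> T" and lin: "linear_ae (BV \<Omega>) T"
  shows "\<exists>R. W11_extension_operator \<Omega> R \<and> linear_ae (W11 \<Omega>) R"
proof -
  have "open (- closure \<Omega>)" by auto
  from exists_scale_function[OF this] obtain r Dr where r: "\<And>x. (r has_derivative (\<lambda>h. Dr x \<bullet> h)) (at x)"
    "continuous_on UNIV Dr" "\<And>x. norm (Dr x) \<le> 1 / 2" "\<And>x. 0 \<le> r x \<and> r x \<le> (1::real)" "\<And>x. 0 < r x \<longleftrightarrow> x \<in> - closure \<Omega>"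
    by blast
  interpret exterior_scale \<Omega> r Dr
    by unfold_locales (use r \<Omega> in auto)
  obtain C where C: "C > 0" "\<And>u. u \<in> BV \<Omega> \<Longrightarrow> ae_eq_on \<Omega> (T u) u"
    "\<And>u. u \<in> BV \<Omega> \<Longrightarrow> BV_norm UNIV (T u) \<le> ereal C * BV_norm \<Omega> u"
    "\<And>u. u \<in> BV \<Omega> \<Longrightarrow> variation_in UNIV (T u) (frontier \<Omega>) = 0"
    using T unfolding strong_BV_extension_operator_def by blast
  have TBV: "T u \<in> BV UNIV" if "u \<in> BV \<Omega>" for u
    using T that unfolding strong_BV_extension_operator_def by blast
  have Tresp: "ae_eq_on UNIV (T u) (T u')" if "u \<in> BV \<Omega>" "u' \<in> BV \<Omega>" "ae_eq_on \<Omega> u u'" for u u'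
    using T that unfolding strong_BV_extension_operator_def respects_ae_def by blast
  define S where "S = (\<lambda>u. SOME f. integrable lborel f \<and> (AE x in lebesgue. T u x = f x))"
  have iT: "integrable lebesgue (T u)" if "u \<in> BV \<Omega>" for u
    using TBV[OF that] by (simp add: BV_def L1_def set_integrable_def)
  have S: "integrable lborel (S u) \<and> (AE x in lebesgue. T u x = S u x)" if "u \<in> BV \<Omega>" for u
    unfolding S_def by (rule someI_ex[OF borel_representative[OF iT[OF that]]])
  have iS: "integrable lebesgue (S u)" if "u \<in> BV \<Omega>" for u
    using S[OF that] by (subst integrable_completion) auto
  define R where "R = (\<lambda>u. smoothing (S u))"
  define gr where "gr = weak_gradient \<Omega>"
  have gr: "has_weak_gradient \<Omega> u (gr u)" "gr u \<in> L1 \<Omega>" if "u \<in> W11 \<Omega>" for u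
    using that weak_gradient_norm[OF \<Omega>(1)] unfolding W11_def gr_def by blast+
  have W_BV: "u \<in> BV \<Omega>" "BV_norm \<Omega> u \<le> ereal (W11_norm \<Omega> u)" if "u \<in> W11 \<Omega>" for u
  proof -
    have v: "variation u \<Omega> \<le> ereal (L1_norm \<Omega> (gr u))"
      by (rule variation_le_weak_gradient[OF \<Omega>(1) gr[OF that]])
    then show "u \<in> BV \<Omega>" using that by (auto simp: BV_def W11_def intro: le_less_trans)
    have "BV_norm \<Omega> u \<le> ereal (L1_norm \<Omega> u) + ereal (L1_norm \<Omega> (gr u))"
      unfolding BV_norm_def by (intro add_mono v order_refl)
    then show "BV_norm \<Omega> u \<le> ereal (W11_norm \<Omega> u)" by (simp add: W11_norm_def gr_def)
  qed
  have Tbounds: "L1_norm UNIV (T u) \<le> C * W11_norm \<Omega> u" "variation (T u) UNIV \<le> ereal (C * W11_norm \<Omega> u)" if u: "u \<in> W11 \<Omega>" for u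
  proof -
    have "BV_norm UNIV (T u) \<le> ereal C * BV_norm \<Omega> u" by (rule C(3)[OF W_BV(1)[OF u]])
    also have "\<dots> \<le> ereal C * ereal (W11_norm \<Omega> u)"
      using C(1) W_BV(2)[OF u] by (intro ereal_mult_left_mono) auto
    finally have le: "ereal (L1_norm UNIV (T u)) + variation (T u) UNIV \<le> ereal (C * W11_norm \<Omega> u)" by (simp add: BV_norm_def)
    have n: "0 \<le> L1_norm UNIV (T u)" by (simp add: L1_norm_def set_lebesgue_integral_def)
    have "ereal (L1_norm UNIV (T u)) + 0 \<le> ereal (L1_norm UNIV (T u)) + variation (T u) UNIV"
      by (intro add_left_mono variation_nonneg)
    from order_trans[OF this le] have "ereal (L1_norm UNIV (T u)) \<le> ereal (C * W11_norm \<Omega> u)" by simp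
    then show "L1_norm UNIV (T u) \<le> C * W11_norm \<Omega> u" by simp
    have "0 + variation (T u) UNIV \<le> ereal (L1_norm UNIV (T u)) + variation (T u) UNIV"
      using n by (intro add_right_mono) simp
    from order_trans[OF this le] show "variation (T u) UNIV \<le> ereal (C * W11_norm \<Omega> u)" by simp
  qed
  define h where "h = (\<lambda>u x. indicator \<Omega> x *\<^sub>R gr u x + exterior_gradient (S u) x)"
  have R: "has_weak_gradient UNIV (R u) (h u)" "h u \<in> L1 UNIV"
    "L1_norm UNIV (h u) \<le> L1_norm \<Omega> (gr u) + DIM('a) * (grad_const * (C * W11_norm \<Omega> u))" if u: "u \<in> W11 \<Omega>" for u
  proof -
    note ub = W_BV(1)[OF u]
    have ae: "AE x in lebesgue. T u x = S u x" using S[OF ub] by blast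
    have ae1: "AE x in lebesgue. x \<in> \<Omega> \<longrightarrow> S u x = u x"
      using C(2)[OF ub] ae unfolding ae_eq_on_def by eventually_elim auto
    have v: "variation (S u) UNIV \<le> ereal (C * W11_norm \<Omega> u)"
      using Tbounds(2)[OF u] variation_cong_AE[OF iT[OF ub] iS[OF ub] ae] by simp
    have b: "variation_in UNIV (S u) (frontier \<Omega>) = 0"
      using C(4)[OF ub] variation_in_cong_AE[OF iT[OF ub] iS[OF ub] ae] by simp
    have i: "integrable lborel (S u)" using S[OF ub] by blast
    show "has_weak_gradient UNIV (R u) (h u)" "h u \<in> L1 UNIV"
      "L1_norm UNIV (h u) \<le> L1_norm \<Omega> (gr u) + DIM('a) * (grad_const * (C * W11_norm \<Omega> u))"
      using smoothing_has_weak_gradient[OF i v b gr[OF u] ae1] unfolding R_def h_def by blast+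
  qed
  have iR: "integrable lborel (R u)" if "u \<in> BV \<Omega>" for u
    unfolding R_def using S[OF that] by (intro smoothing_integrable) blast
  have RW: "R u \<in> W11 UNIV" if u: "u \<in> W11 \<Omega>" for u
  proof -
    have "integrable lebesgue (R u)" using iR[OF W_BV(1)[OF u]] by (subst integrable_completion) auto
    then show ?thesis unfolding W11_def using R[OF u] by (auto simp: L1_def set_integrable_def)
  qed
  define C' where "C' = mollifier_bound * avg_const * C + (1 + DIM('a) * (grad_const * C))"
  have "C' > 0" unfolding C'_def using mollifier_bound_nonneg avg_const_nonneg grad_const_nonneg C(1)
    by (intro add_nonneg_pos add_pos_nonneg mult_nonneg_nonneg) auto
  have normR: "W11_norm UNIV (R u) \<le> C' * W11_norm \<Omega> u" if u: "u \<in> W11 \<Omega>" for u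
  proof -
    note ub = W_BV(1)[OF u]
    let ?M = "W11_norm \<Omega> u"
    have "L1_norm UNIV (R u) = (\<integral>x. \<bar>R u x\<bar> \<partial>lborel)"
      unfolding L1_norm_def set_lebesgue_integral_def using iR[OF ub] by (subst integral_lebesgue_lborel[symmetric]) auto
    also have "\<dots> \<le> mollifier_bound * avg_const * (\<integral>x. \<bar>S u x\<bar> \<partial>lborel)"
      unfolding R_def using S[OF ub] by (intro smoothing_norm_le) blast
    also have "(\<integral>x. \<bar>S u x\<bar> \<partial>lborel) = (\<integral>x. \<bar>S u x\<bar> \<partial>lebesgue)"
      using S[OF ub] by (intro integral_lebesgue_lborel[symmetric]) auto
    also have "\<dots> = (\<integral>x. \<bar>T u x\<bar> \<partial>lebesgue)"
      using S[OF ub] iT[OF ub] iS[OF ub] by (intro integral_cong_AE) auto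
    also have "\<dots> = L1_norm UNIV (T u)" by (simp add: L1_norm_def set_lebesgue_integral_def)
    also have "mollifier_bound * avg_const * L1_norm UNIV (T u) \<le> mollifier_bound * avg_const * (C * ?M)"
      using mollifier_bound_nonneg avg_const_nonneg by (intro mult_left_mono Tbounds(1)[OF u]) auto
    finally have 1: "L1_norm UNIV (R u) \<le> mollifier_bound * avg_const * (C * ?M)" .
    have "L1_norm UNIV (weak_gradient UNIV (R u)) = L1_norm UNIV (h u)"
      by (rule weak_gradient_norm(3)[OF open_UNIV R(1,2)[OF u]])
    also have "\<dots> \<le> L1_norm \<Omega> (gr u) + DIM('a) * (grad_const * (C * ?M))" by (rule R(3)[OF u])
    also have "L1_norm \<Omega> (gr u) \<le> ?M"
      by (simp add: W11_norm_def gr_def) (simp add: L1_norm_def set_lebesgue_integral_def)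
    finally have 2: "L1_norm UNIV (weak_gradient UNIV (R u)) \<le> ?M + DIM('a) * (grad_const * (C * ?M))" by simp
    have "W11_norm UNIV (R u) \<le> mollifier_bound * avg_const * (C * ?M) + (?M + DIM('a) * (grad_const * (C * ?M)))"
      unfolding W11_norm_def[of UNIV] by (rule add_mono[OF 1 2])
    also have "\<dots> = C' * ?M" by (simp add: C'_def algebra_simps)
    finally show ?thesis .
  qed
  have Rae: "ae_eq_on \<Omega> (R u) u" if u: "u \<in> W11 \<Omega>" for u
  proof -
    note ub = W_BV(1)[OF u]
    have "AE x in lebesgue. T u x = S u x" using S[OF ub] by blast
    with C(2)[OF ub] show ?thesis
      unfolding ae_eq_on_def
    proof eventually_elim
      case (elim x)
      show ?case
      proof
        assume "x \<in> \<Omega>"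
        then have "x \<notin> - closure \<Omega>" using closure_subset by auto
        then show "R u x = u x" using elim \<open>x \<in> \<Omega>\<close> by (simp add: R_def smoothing_eq_outside)
      qed
    qed
  qed
  have smoothing_cong: "AE x in lebesgue. smoothing f x = smoothing g x"
    if f: "integrable lborel f" and g: "integrable lborel g" and ae: "AE x in lebesgue. f x = g x" for f g
  proof -
    have "(\<integral>x. \<bar>smoothing f x - smoothing g x\<bar> \<partial>lborel) \<le> mollifier_bound * avg_const * (\<integral>x. \<bar>f x - g x\<bar> \<partial>lborel)"
      unfolding smoothing_def by (rule average_diff_le[OF kernel_mollifier f g])
    also have "(\<integral>x. \<bar>f x - g x\<bar> \<partial>lborel) = (\<integral>x. \<bar>f x - g x\<bar> \<partial>lebesgue)"
      using f g by (intro integral_lebesgue_lborel[symmetric]) auto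
    also have "\<dots> = (\<integral>x. 0 \<partial>(lebesgue :: 'a measure))"
      using ae f g by (intro integral_cong_AE measurable_completion) auto
    finally have "(\<integral>x. \<bar>smoothing f x - smoothing g x\<bar> \<partial>lborel) = 0"
      by (intro antisym Bochner_Integration.integral_nonneg) auto
    moreover have "integrable lborel (\<lambda>x. \<bar>smoothing f x - smoothing g x\<bar>)"
      using smoothing_integrable[OF f] smoothing_integrable[OF g] by auto
    ultimately have "AE x in lborel. \<bar>smoothing f x - smoothing g x\<bar> = 0"
      using integral_nonneg_eq_0_iff_AE[of lborel "\<lambda>x. \<bar>smoothing f x - smoothing g x\<bar>"] by auto
    then have "AE x in lborel. smoothing f x = smoothing g x" by eventually_elim simp
    then show ?thesis by (rule AE_completion)
  qed
  have resp: "respects_ae \<Omega> (W11 \<Omega>) R"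
    unfolding respects_ae_def
  proof (intro ballI impI)
    fix u u' assume u: "u \<in> W11 \<Omega>" "u' \<in> W11 \<Omega>" and ae: "ae_eq_on \<Omega> u u'"
    note ub = W_BV(1)[OF u(1)] W_BV(1)[OF u(2)]
    have "AE x in lebesgue. S u x = S u' x"
      using Tresp[OF ub ae] S[OF ub(1)] S[OF ub(2)] unfolding ae_eq_on_def by auto
    then have "AE x in lebesgue. R u x = R u' x"
      unfolding R_def using S[OF ub(1)] S[OF ub(2)] by (intro smoothing_cong) auto
    then show "ae_eq_on UNIV (R u) (R u')" by (simp add: ae_eq_on_def)
  qed
  have W11_lin: "(\<lambda>x. a * u x + b * u' x) \<in> BV \<Omega>" if "u \<in> W11 \<Omega>" "u' \<in> W11 \<Omega>" for a b u u'
  proof -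
    note wg = has_weak_gradient_linear[OF gr(1)[OF that(1)] gr(1)[OF that(2)], of a b]
    have "(\<lambda>x. a *\<^sub>R gr u x + b *\<^sub>R gr u' x) \<in> L1 \<Omega>"
      using gr(2)[OF that(1)] gr(2)[OF that(2)] set_integrable_linear[of \<Omega> "gr u" "gr u'" a b] by (simp add: L1_def)
    from variation_le_weak_gradient[OF \<Omega>(1) wg this] have "variation (\<lambda>x. a * u x + b * u' x) \<Omega> < \<infinity>"
      by (rule le_less_trans) simp
    moreover have "(\<lambda>x. a * u x + b * u' x) \<in> L1 \<Omega>"
      using that set_integrable_linear[of \<Omega> u u' a b] by (simp add: L1_def W11_def)
    ultimately show ?thesis by (simp add: BV_def)
  qed
  have linR: "linear_ae (W11 \<Omega>) R"
    unfolding linear_ae_def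
  proof (intro ballI allI)
    fix u u' a b assume u: "u \<in> W11 \<Omega>" "u' \<in> W11 \<Omega>"
    note ub = W_BV(1)[OF u(1)] W_BV(1)[OF u(2)]
    let ?w = "\<lambda>x. a * u x + b * u' x"
    have wb: "?w \<in> BV \<Omega>" by (rule W11_lin[OF u])
    have "ae_eq_on UNIV (T ?w) (\<lambda>x. a * T u x + b * T u' x)"
      using lin ub unfolding linear_ae_def by blast
    then have ae: "AE x in lebesgue. S ?w x = a * S u x + b * S u' x"
      using S[OF ub(1)] S[OF ub(2)] S[OF wb] unfolding ae_eq_on_def by auto
    have i: "integrable lborel (\<lambda>x. a * S u x + b * S u' x)"
      using S[OF ub(1)] S[OF ub(2)] by auto
    have 1: "AE x in lebesgue. smoothing (S ?w) x = smoothing (\<lambda>x. a * S u x + b * S u' x) x"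
      by (rule smoothing_cong[OF _ i ae]) (use S[OF wb] in blast)
    have "AE x in lborel. smoothing (\<lambda>x. a * S u x + b * S u' x) x = a * smoothing (S u) x + b * smoothing (S u') x"
      unfolding smoothing_def using S[OF ub(1)] S[OF ub(2)] by (intro average_linear_AE[OF kernel_mollifier]) blast+
    then have 2: "AE x in lebesgue. smoothing (\<lambda>x. a * S u x + b * S u' x) x = a * smoothing (S u) x + b * smoothing (S u') x"
      by (rule AE_completion)
    from 1 2 have "AE x in lebesgue. R ?w x = a * R u x + b * R u' x"
      unfolding R_def by eventually_elim simp
    then show "ae_eq_on UNIV (R ?w) (\<lambda>x. a * R u x + b * R u' x)" by (simp add: ae_eq_on_def)
  qed
  have "W11_extension_operator \<Omega> R"
    unfolding W11_extension_operator_def using RW resp Rae normR \<open>C' > 0\<close> by blast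
  with linR show ?thesis by blast
qed

theorem corollary1p5:
  fixes \<Omega> :: "(real ^ 'n) set"
    and T :: "(real ^ 'n \<Rightarrow> real) \<Rightarrow> real ^ 'n \<Rightarrow> real"
  assumes "CARD('n) \<ge> 2"
    and "bounded \<Omega>"
    and "strong_BV_extension_domain \<Omega>"
    and "strong_BV_extension_operator \<Omega> T"
    and "linear_ae (BV \<Omega>) T"
  shows "\<exists>R. W11_extension_operator \<Omega> R \<and> linear_ae (W11 \<Omega>) R"
proof (rule W11_extension_from_BV)
  show "open \<Omega>" using assms(3) by (simp add: strong_BV_extension_domain_def is_domain_def)
qed (use assms in auto)

end
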